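(* Let $E/\mathbb{Q}$ be an elliptic curve, let $D$ be a $\mathbb{Q}$-rational effective divisor of degree $4$ on $E$ that is a sum of four pairwise distinct geometric points, let $D'$ be a $\mathbb{Q}$-rational divisor on $E$ with $D\sim 2D'$, let $f\in\mathbb{Q}(E)^*$ satisfy $\mathrm{div}(f)=D-2D'$, and let $\phi\colon C\to E$ be the genus $3$ double cover obtained by adjoining $\sqrt{f}$ to the function field of $E$. Suppose that $E$ has good reduction at $2$. Let $\mathcal{E}$ be a good Weierstrass model of $E$ over $\mathbb{Z}_2$ with projective coordinates $x,y,z$. Suppose $D=P_1+P_2+P_3+P_4$ with $P_1,P_2,P_3$ defined over $\overline{\mathbb{Q}_2}$, and fix $P_4=0_E$ and $D'=2\cdot 0_E$. Let $v_2$ be the valuation on $\overline{\mathbb{Q}_2}$ normalised so that $v_2(2)=1$. Assume that $P_i=(x_i:1:z_i)$ with $v_2(x_i),v_2(z_i)>0$ for all $i=1,2,3$, and that the $2$-adic distances between the points $P_1,P_2,P_3,P_4$ are $2^{-2/3}$, i.e. $\min(v_2(x_i-x_j),v_2(z_i-z_j))=\tfrac23$ for all $i\neq j$ in $\{1,2,3,4\}$, where $P_4=(x_4:1:z_4)=(0:1:0)$. Then, after twisting if necessary, the curve $C$ has good reduction at $2$.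
   Context: Curves over $\mathbb{Q}$ are smooth, projective and geometrically connected. A good Weierstrass model over $\mathbb{Z}_2$ is an integral Weierstrass equation $y^2z+a_1xyz+a_3yz^2=x^3+a_2x^2z+a_4xz^2+a_6z^3$ with $a_i\in\mathbb{Z}_2$ whose reduction modulo $2$ is smooth; $0_E=(0:1:0)$ is the identity. Twisting means replacing $f$ by $d\cdot f$ for some $d\in\mathbb{Q}^*$; "after twisting if necessary" means that the conclusion holds for the curve obtained from $d\cdot f$ for some $d\in\mathbb{Q}^*$. *)

theory Defs
  imports
    Complex_Main
    "HOL-Library.Extended_Real"
    "HOL-Algebra.Algebraic_Closure_Type"
    "HOL-Library.Poly_Mapping"
    "HOL-Library.Z2"
begin

section \<open>The field of 2-adic numbers\<close>

definition val2_rat :: "rat \<Rightarrow> int" where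
  "val2_rat q = int (multiplicity 2 (fst (quotient_of q))) - int (multiplicity 2 (snd (quotient_of q)))"

definition abs2_rat :: "rat \<Rightarrow> real" where
  "abs2_rat q = (if q = 0 then 0 else 2 powi (- val2_rat q))"

lemma val2_rat_divide:
  assumes "a \<noteq> 0" "b \<noteq> 0"
  shows "val2_rat (of_int a / of_int b) = int (multiplicity 2 a) - int (multiplicity 2 b)"
proof -
  obtain c d where cd: "quotient_of (of_int a / of_int b) = (c, d)" by force
  have d: "d > 0" using quotient_of_denom_pos[OF cd] .
  have eq: "of_int a / of_int b = (of_int c / of_int d :: rat)" using quotient_of_div[OF cd] .
  have c: "c \<noteq> 0" using eq assms d by auto
  have "of_int (a * d) = (of_int (c * b) :: rat)" using eq assms d by (simp add: field_simps)
  then have "a * d = c * b" by (simp only: of_int_eq_iff)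
  then have "multiplicity 2 (a * d) = multiplicity 2 (c * b)" by simp
  then have "multiplicity 2 a + multiplicity 2 d = multiplicity 2 c + multiplicity 2 b"
    using assms c d by (simp add: prime_elem_multiplicity_mult_distrib)
  then show ?thesis by (simp add: val2_rat_def cd)
qed

lemma rat_as_quotient: "\<exists>a b. (b::int) \<noteq> 0 \<and> q = of_int a / (of_int b :: rat)"
  using quotient_of_div quotient_of_denom_pos by (metis less_irrefl prod.exhaust)

lemma val2_rat_mult:
  assumes "x \<noteq> 0" "y \<noteq> 0"
  shows "val2_rat (x * y) = val2_rat x + val2_rat y"
proof -
  obtain a b where x: "b \<noteq> 0" "x = of_int a / of_int b" using rat_as_quotient by blast
  obtain c d where y: "d \<noteq> 0" "y = of_int c / of_int d" using rat_as_quotient by blast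
  have "a \<noteq> 0" "c \<noteq> 0" using x y assms by auto
  moreover have "x * y = of_int (a * c) / of_int (b * d)" using x y by simp
  ultimately show ?thesis using x y
    by (simp add: val2_rat_divide prime_elem_multiplicity_mult_distrib del: of_int_mult)
qed

lemma val2_rat_minus: "val2_rat (- x) = val2_rat x"
proof (cases "x = 0")
  case False
  obtain a b where x: "b \<noteq> 0" "x = of_int a / of_int b" using rat_as_quotient by blast
  have x': "- x = of_int (- a) / of_int b" using x by simp
  show ?thesis unfolding x' unfolding x(2) using x False
    by (subst (1 2) val2_rat_divide) (auto intro: multiplicity_cong)
qed simp

lemma val2_rat_add:
  assumes "x \<noteq> 0" "y \<noteq> 0" "x + y \<noteq> 0"
  shows "val2_rat (x + y) \<ge> min (val2_rat x) (val2_rat y)"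
proof -
  obtain a b where x: "b \<noteq> 0" "x = of_int a / of_int b" using rat_as_quotient by blast
  obtain c d where y: "d \<noteq> 0" "y = of_int c / of_int d" using rat_as_quotient by blast
  have x': "x = of_int (a * d) / of_int (b * d)" using x y by simp
  have y': "y = of_int (c * b) / of_int (b * d)" using x y by simp
  have s: "x + y = of_int (a * d + c * b) / of_int (b * d)" using x y by (simp add: field_simps)
  have nz: "a * d \<noteq> 0" "c * b \<noteq> 0" "b * d \<noteq> 0"
    using x y assms by auto
  have nz4: "a * d + c * b \<noteq> 0"
    using s assms(3) by (metis div_0 of_int_0)
  let ?k = "min (multiplicity 2 (a * d)) (multiplicity 2 (c * b))"
  have "2 ^ ?k dvd a * d" "2 ^ ?k dvd c * b" by (simp_all add: multiplicity_dvd')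
  then have "2 ^ ?k dvd a * d + c * b" by simp
  then have "multiplicity 2 (a * d + c * b) \<ge> ?k"
    using nz4 by (intro multiplicity_geI) auto
  then show ?thesis
    unfolding s unfolding x' y' using nz nz4 by (simp add: val2_rat_divide del: of_int_mult of_int_add)
qed

lemma abs2_rat_zero [simp]: "abs2_rat 0 = 0" by (simp add: abs2_rat_def)

lemma abs2_rat_one [simp]: "abs2_rat 1 = 1" by (simp add: abs2_rat_def val2_rat_def)

lemma abs2_rat_nonneg [simp]: "abs2_rat x \<ge> 0" by (simp add: abs2_rat_def)

lemma abs2_rat_eq_0_iff [simp]: "abs2_rat x = 0 \<longleftrightarrow> x = 0" by (simp add: abs2_rat_def)

lemma abs2_rat_minus [simp]: "abs2_rat (- x) = abs2_rat x"
  by (simp add: abs2_rat_def val2_rat_minus)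

lemma abs2_rat_mult: "abs2_rat (x * y) = abs2_rat x * abs2_rat y"
  by (simp add: abs2_rat_def val2_rat_mult power_int_add power_int_diff power_int_minus divide_simps)

lemma abs2_rat_inverse: "abs2_rat (inverse x) = inverse (abs2_rat x)"
proof (cases "x = 0")
  case False
  then have "abs2_rat x * abs2_rat (inverse x) = 1" by (simp flip: abs2_rat_mult)
  then show ?thesis by (metis inverse_unique)
qed simp

lemma abs2_rat_ultra: "abs2_rat (x + y) \<le> max (abs2_rat x) (abs2_rat y)"
proof (cases "x = 0 \<or> y = 0 \<or> x + y = 0")
  case False
  then have "- val2_rat (x + y) \<le> max (- val2_rat x) (- val2_rat y)"
    using val2_rat_add[of x y] by auto
  then have "- val2_rat (x + y) \<le> - val2_rat x \<or> - val2_rat (x + y) \<le> - val2_rat y" by linarith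
  then have "2 powi (- val2_rat (x + y)) \<le> (2::real) powi (- val2_rat x)
      \<or> 2 powi (- val2_rat (x + y)) \<le> (2::real) powi (- val2_rat y)"
    using power_int_increasing[of _ _ "2::real"] by auto
  then show ?thesis using False by (auto simp: abs2_rat_def)
qed (auto simp: le_max_iff_disj)

lemma abs2_rat_add_le: "abs2_rat (x + y) \<le> abs2_rat x + abs2_rat y"
  using abs2_rat_ultra[of x y] abs2_rat_nonneg[of x] abs2_rat_nonneg[of y] by linarith

lemma abs2_rat_diff_le: "\<bar>abs2_rat x - abs2_rat y\<bar> \<le> abs2_rat (x - y)"
  using abs2_rat_add_le[of "x - y" y] abs2_rat_add_le[of "y - x" x] abs2_rat_minus[of "x - y"] by simp

definition null2 :: "(nat \<Rightarrow> rat) \<Rightarrow> bool" where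
  "null2 U \<longleftrightarrow> (\<lambda>n. abs2_rat (U n)) \<longlonglongrightarrow> 0"

definition cauchy2 :: "(nat \<Rightarrow> rat) \<Rightarrow> bool" where
  "cauchy2 U \<longleftrightarrow> (\<forall>e>0. \<exists>N. \<forall>m\<ge>N. \<forall>n\<ge>N. abs2_rat (U m - U n) < e)"

lemma null2_zero [simp]: "null2 (\<lambda>_. 0)" by (simp add: null2_def)

lemma null2_dom:
  assumes "g \<longlonglongrightarrow> 0" "\<forall>\<^sub>F n in sequentially. abs2_rat (U n) \<le> g n"
  shows "null2 U"
  unfolding null2_def
  by (rule tendsto_sandwich[of "\<lambda>_. 0" _ _ g]) (use assms in auto)

lemma null2_add: "null2 U \<Longrightarrow> null2 V \<Longrightarrow> null2 (\<lambda>n. U n + V n)"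
  by (rule null2_dom[of "\<lambda>n. abs2_rat (U n) + abs2_rat (V n)"])
    (auto simp: null2_def abs2_rat_add_le intro: tendsto_add_zero)

lemma null2_minus: "null2 U \<Longrightarrow> null2 (\<lambda>n. - U n)"
  by (simp add: null2_def)

lemma null2_diff_commute: "null2 (\<lambda>n. U n - V n) \<longleftrightarrow> null2 (\<lambda>n. V n - U n)"
  using null2_minus[of "\<lambda>n. U n - V n"] null2_minus[of "\<lambda>n. V n - U n"] by auto

lemma null2_diff: "null2 U \<Longrightarrow> null2 V \<Longrightarrow> null2 (\<lambda>n. U n - V n)"
  using null2_add[of U "\<lambda>n. - V n"] null2_minus[of V] by simp

lemma cauchy2_const [simp]: "cauchy2 (\<lambda>_. c)" by (simp add: cauchy2_def)

lemma cauchy2_add: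
  assumes "cauchy2 U" "cauchy2 V" shows "cauchy2 (\<lambda>n. U n + V n)"
  unfolding cauchy2_def
proof (intro allI impI)
  fix e :: real assume "e > 0"
  then obtain M N where M: "\<forall>m\<ge>M. \<forall>n\<ge>M. abs2_rat (U m - U n) < e"
    and N: "\<forall>m\<ge>N. \<forall>n\<ge>N. abs2_rat (V m - V n) < e"
    using assms unfolding cauchy2_def by meson
  have "abs2_rat (U m + V m - (U n + V n)) < e" if "m \<ge> max M N" "n \<ge> max M N" for m n
  proof -
    have "U m + V m - (U n + V n) = (U m - U n) + (V m - V n)" by simp
    then have "abs2_rat (U m + V m - (U n + V n)) \<le> max (abs2_rat (U m - U n)) (abs2_rat (V m - V n))"
      by (metis abs2_rat_ultra)
    also have "\<dots> < e" using M N that by simp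
    finally show ?thesis .
  qed
  then show "\<exists>N. \<forall>m\<ge>N. \<forall>n\<ge>N. abs2_rat (U m + V m - (U n + V n)) < e" by blast
qed

lemma cauchy2_minus: "cauchy2 U \<Longrightarrow> cauchy2 (\<lambda>n. - U n)"
  unfolding cauchy2_def by (metis abs2_rat_minus minus_diff_eq minus_diff_minus)

lemma cauchy2_Cauchy_abs:
  assumes "cauchy2 U" shows "Cauchy (\<lambda>n. abs2_rat (U n))"
  unfolding Cauchy_def dist_real_def
  using assms unfolding cauchy2_def by (meson abs2_rat_diff_le le_less_trans)

lemma cauchy2_convergent_abs: "cauchy2 U \<Longrightarrow> convergent (\<lambda>n. abs2_rat (U n))"
  using cauchy2_Cauchy_abs Cauchy_convergent by blast

lemma cauchy2_LIMSEQ_abs: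
  "cauchy2 U \<Longrightarrow> (\<lambda>n. abs2_rat (U n)) \<longlonglongrightarrow> lim (\<lambda>n. abs2_rat (U n))"
  by (simp add: cauchy2_convergent_abs flip: convergent_LIMSEQ_iff)

lemma cauchy2_bounded:
  assumes "cauchy2 U" obtains B where "B > 0" "\<And>n. abs2_rat (U n) \<le> B"
proof -
  have "Bseq (\<lambda>n. abs2_rat (U n))" using cauchy2_convergent_abs[OF assms] by (rule convergent_imp_Bseq)
  then show ?thesis using that unfolding Bseq_def by auto
qed

lemma cauchy2_mult:
  assumes "cauchy2 U" "cauchy2 V" shows "cauchy2 (\<lambda>n. U n * V n)"
  unfolding cauchy2_def
proof (intro allI impI)
  fix e :: real assume e: "e > 0"
  obtain B where B: "B > 0" "\<And>n. abs2_rat (U n) \<le> B" using cauchy2_bounded[OF assms(1)] by blast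
  obtain C where C: "C > 0" "\<And>n. abs2_rat (V n) \<le> C" using cauchy2_bounded[OF assms(2)] by blast
  have "e / C > 0" "e / B > 0" using e B C by auto
  then obtain M N where M: "\<forall>m\<ge>M. \<forall>n\<ge>M. abs2_rat (U m - U n) < e / C"
    and N: "\<forall>m\<ge>N. \<forall>n\<ge>N. abs2_rat (V m - V n) < e / B"
    using assms unfolding cauchy2_def by meson
  have "abs2_rat (U m * V m - U n * V n) < e" if mn: "m \<ge> max M N" "n \<ge> max M N" for m n
  proof -
    have "abs2_rat (U m * (V m - V n)) \<le> B * abs2_rat (V m - V n)"
      unfolding abs2_rat_mult by (intro mult_right_mono B) simp
    also have "\<dots> < B * (e / B)" using N mn B by (intro mult_strict_left_mono) auto
    finally have 1: "abs2_rat (U m * (V m - V n)) < e" using B by simp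
    have "abs2_rat ((U m - U n) * V n) \<le> abs2_rat (U m - U n) * C"
      unfolding abs2_rat_mult by (intro mult_left_mono C) simp
    also have "\<dots> < (e / C) * C" using M mn C by (intro mult_strict_right_mono) auto
    finally have 2: "abs2_rat ((U m - U n) * V n) < e" using C by simp
    have "U m * V m - U n * V n = U m * (V m - V n) + (U m - U n) * V n" by (simp add: algebra_simps)
    then have "abs2_rat (U m * V m - U n * V n) \<le> max (abs2_rat (U m * (V m - V n))) (abs2_rat ((U m - U n) * V n))"
      by (metis abs2_rat_ultra)
    then show ?thesis using 1 2 by linarith
  qed
  then show "\<exists>N. \<forall>m\<ge>N. \<forall>n\<ge>N. abs2_rat (U m * V m - U n * V n) < e" by blast
qed

lemma null2_mult:
  assumes "null2 U" "cauchy2 V" shows "null2 (\<lambda>n. U n * V n)"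
proof -
  obtain C where C: "C > 0" "\<And>n. abs2_rat (V n) \<le> C" using cauchy2_bounded[OF assms(2)] by blast
  have "(\<lambda>n. abs2_rat (U n) * C) \<longlonglongrightarrow> 0"
    using assms(1) unfolding null2_def by (rule tendsto_mult_left_zero)
  then show ?thesis
    by (rule null2_dom) (intro always_eventually allI, simp add: abs2_rat_mult mult_left_mono C)
qed

lemma not_null2_bound:
  assumes "cauchy2 U" "\<not> null2 U"
  obtains c N where "c > 0" "\<And>n. n \<ge> N \<Longrightarrow> abs2_rat (U n) > c"
proof -
  obtain L where L: "(\<lambda>n. abs2_rat (U n)) \<longlonglongrightarrow> L"
    using cauchy2_convergent_abs[OF assms(1)] unfolding convergent_def by blast
  have "L \<ge> 0" by (rule LIMSEQ_le_const[OF L]) simp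
  moreover have "L \<noteq> 0" using L assms(2) unfolding null2_def by blast
  ultimately have "L > 0" by simp
  then have "\<forall>\<^sub>F n in sequentially. abs2_rat (U n) > L / 2"
    by (intro order_tendstoD(1)[OF L]) simp
  then show ?thesis using that \<open>L > 0\<close> unfolding eventually_sequentially by (metis half_gt_zero)
qed

lemma cauchy2_inverse:
  assumes "cauchy2 U" "\<not> null2 U" shows "cauchy2 (\<lambda>n. inverse (U n))"
  unfolding cauchy2_def
proof (intro allI impI)
  fix e :: real assume e: "e > 0"
  obtain c M where c: "c > 0" "\<And>n. n \<ge> M \<Longrightarrow> abs2_rat (U n) > c" using not_null2_bound[OF assms] by blast
  have "e * (c * c) > 0" using e c by simp
  then obtain N where N: "\<forall>m\<ge>N. \<forall>n\<ge>N. abs2_rat (U m - U n) < e * (c * c)"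
    using assms(1) unfolding cauchy2_def by meson
  have "abs2_rat (inverse (U m) - inverse (U n)) < e" if mn: "m \<ge> max M N" "n \<ge> max M N" for m n
  proof -
    have am: "abs2_rat (U m) > c" and an: "abs2_rat (U n) > c" using c mn by auto
    then have nz: "U m \<noteq> 0" "U n \<noteq> 0" using c(1) by auto
    have "c * c \<le> abs2_rat (U m * U n)" unfolding abs2_rat_mult using am an c(1) by (intro mult_mono) auto
    then have p: "c * c \<le> abs2_rat (U m * U n)" .
    have "(inverse (U m) - inverse (U n)) * (U m * U n) = - (U m - U n)"
      using nz by (simp add: field_simps)
    then have "abs2_rat (inverse (U m) - inverse (U n)) * abs2_rat (U m * U n) = abs2_rat (U m - U n)"
      by (metis abs2_rat_minus abs2_rat_mult)
    also have "\<dots> < e * (c * c)" using N mn by simp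
    also have "\<dots> \<le> e * abs2_rat (U m * U n)" using p e by (intro mult_left_mono) auto
    finally show ?thesis using nz by (metis abs2_rat_nonneg mult_less_cancel_right not_less)
  qed
  then show "\<exists>N. \<forall>m\<ge>N. \<forall>n\<ge>N. abs2_rat (inverse (U m) - inverse (U n)) < e" by blast
qed

definition q2rel :: "(nat \<Rightarrow> rat) \<Rightarrow> (nat \<Rightarrow> rat) \<Rightarrow> bool" where
  "q2rel U V \<longleftrightarrow> cauchy2 U \<and> cauchy2 V \<and> null2 (\<lambda>n. U n - V n)"

lemma part_equivp_q2rel: "part_equivp q2rel"
proof (rule part_equivpI)
  show "\<exists>U. q2rel U U" by (rule exI[of _ "\<lambda>_. 0"]) (simp add: q2rel_def)
  show "symp q2rel" 
  proof (rule sympI)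
    fix U V assume "q2rel U V"
    then show "q2rel V U" using null2_diff_commute[of U V] by (simp add: q2rel_def)
  qed
  show "transp q2rel"
  proof (rule transpI)
    fix U V W assume "q2rel U V" "q2rel V W"
    then show "q2rel U W" unfolding q2rel_def using null2_add[of "\<lambda>n. U n - V n" "\<lambda>n. V n - W n"] by simp
  qed
qed

text \<open>The completion of the rationals for the 2-adic absolute value.\<close>

quotient_type q2 = "nat \<Rightarrow> rat" / partial: q2rel
  by (rule part_equivp_q2rel)

instantiation q2 :: field
begin

lift_definition zero_q2 :: q2 is "\<lambda>_. 0" by (simp add: q2rel_def)
lift_definition one_q2 :: q2 is "\<lambda>_. 1" by (simp add: q2rel_def)

lift_definition plus_q2 :: "q2 \<Rightarrow> q2 \<Rightarrow> q2" is "\<lambda>U V n. U n + V n"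
  unfolding q2rel_def by (auto simp: cauchy2_add add_diff_add null2_add)

lift_definition uminus_q2 :: "q2 \<Rightarrow> q2" is "\<lambda>U n. - U n"
proof -
  fix U V assume a: "q2rel U V"
  then have "null2 (\<lambda>n. V n - U n)" using null2_diff_commute[of U V] by (simp add: q2rel_def)
  then show "q2rel (\<lambda>n. - U n) (\<lambda>n. - V n)" using a by (simp add: q2rel_def cauchy2_minus)
qed

lift_definition times_q2 :: "q2 \<Rightarrow> q2 \<Rightarrow> q2" is "\<lambda>U V n. U n * V n"
proof -
  fix U U' V V' assume a: "q2rel U U'" "q2rel V V'"
  then have c: "cauchy2 U" "cauchy2 U'" "cauchy2 V" "cauchy2 V'"
    "null2 (\<lambda>n. U n - U' n)" "null2 (\<lambda>n. V n - V' n)" by (auto simp: q2rel_def)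
  have "null2 (\<lambda>n. (U n - U' n) * V n + (V n - V' n) * U' n)"
    by (intro null2_add null2_mult c)
  then have "null2 (\<lambda>n. U n * V n - U' n * V' n)" by (simp add: algebra_simps)
  then show "q2rel (\<lambda>n. U n * V n) (\<lambda>n. U' n * V' n)" by (simp add: q2rel_def cauchy2_mult c)
qed

lift_definition inverse_q2 :: "q2 \<Rightarrow> q2" is "\<lambda>U n. if null2 U then 0 else inverse (U n)"
proof -
  fix U V assume a: "q2rel U V"
  then have c: "cauchy2 U" "cauchy2 V" "null2 (\<lambda>n. U n - V n)" by (auto simp: q2rel_def)
  have nn: "null2 U \<longleftrightarrow> null2 V"
    using null2_diff[of U "\<lambda>n. U n - V n"] null2_add[of V "\<lambda>n. U n - V n"] c(3) by auto
  show "q2rel (\<lambda>n. if null2 U then 0 else inverse (U n)) (\<lambda>n. if null2 V then 0 else inverse (V n))"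
  proof (cases "null2 U")
    case True
    then show ?thesis using nn by (simp add: q2rel_def)
  next
    case False
    then have n: "\<not> null2 U" "\<not> null2 V" using nn by auto
    have ci: "cauchy2 (\<lambda>n. inverse (U n))" "cauchy2 (\<lambda>n. inverse (V n))"
      using cauchy2_inverse c n by auto
    obtain c1 M where M: "c1 > 0" "\<And>n. n \<ge> M \<Longrightarrow> abs2_rat (U n) > c1" using not_null2_bound[OF c(1) n(1)] by blast
    obtain c2 N where N: "c2 > 0" "\<And>n. n \<ge> N \<Longrightarrow> abs2_rat (V n) > c2" using not_null2_bound[OF c(2) n(2)] by blast
    have "null2 (\<lambda>n. (U n - V n) * (inverse (U n) * inverse (V n)))"
      by (intro null2_mult c cauchy2_mult ci)
    then have t: "(\<lambda>n. abs2_rat ((U n - V n) * (inverse (U n) * inverse (V n)))) \<longlonglongrightarrow> 0" by (simp add: null2_def)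
    have "\<forall>\<^sub>F n in sequentially. abs2_rat (inverse (U n) - inverse (V n))
        \<le> abs2_rat ((U n - V n) * (inverse (U n) * inverse (V n)))"
      using eventually_ge_at_top[of "max M N"]
    proof eventually_elim
      case (elim n)
      then have "U n \<noteq> 0" "V n \<noteq> 0" using M(1) M(2)[of n] N(1) N(2)[of n] by auto
      then have "inverse (U n) - inverse (V n) = - ((U n - V n) * (inverse (U n) * inverse (V n)))"
        by (simp add: field_simps)
      then show ?case by (metis abs2_rat_minus order_refl)
    qed
    then have "null2 (\<lambda>n. inverse (U n) - inverse (V n))" by (rule null2_dom[OF t])
    then show ?thesis using n ci by (simp add: q2rel_def)
  qed
qed

definition minus_q2 :: "q2 \<Rightarrow> q2 \<Rightarrow> q2" where "x - y = x + - (y::q2)"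
definition divide_q2 :: "q2 \<Rightarrow> q2 \<Rightarrow> q2" where "x div y = x * inverse (y::q2)"

instance
proof
  fix a b c :: q2
  show "a + b + c = a + (b + c)"
    by transfer (simp add: q2rel_def cauchy2_add add.assoc)
  show "a + b = b + a" by transfer (simp add: q2rel_def cauchy2_add add.commute)
  show "0 + a = a" by transfer (simp add: q2rel_def)
  show "- a + a = 0" by transfer (simp add: q2rel_def)
  show "a - b = a + - b" by (simp add: minus_q2_def)
  show "a * b * c = a * (b * c)"
    by transfer (simp add: q2rel_def cauchy2_mult mult.assoc)
  show "a * b = b * a" by transfer (simp add: q2rel_def cauchy2_mult mult.commute)
  show "1 * a = a" by transfer (simp add: q2rel_def)
  show "(a + b) * c = a * c + b * c"
    by transfer (simp add: q2rel_def cauchy2_mult cauchy2_add distrib_right)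
  show "(0::q2) \<noteq> 1" by transfer (simp add: q2rel_def null2_def LIMSEQ_const_iff)
  show "a div b = a * inverse b" by (simp add: divide_q2_def)
  show "inverse (0::q2) = 0" by transfer (simp add: q2rel_def)
  have "a \<noteq> 0 \<longrightarrow> inverse a * a = 1"
  proof (transfer, rule impI)
    fix U assume U: "q2rel U U" "\<not> q2rel U (\<lambda>_. 0)"
    then have c: "cauchy2 U" and n: "\<not> null2 U" by (auto simp: q2rel_def)
    obtain c' N where N: "c' > 0" "\<And>n. n \<ge> N \<Longrightarrow> abs2_rat (U n) > c'" using not_null2_bound[OF c n] by blast
    have "\<forall>\<^sub>F k in sequentially. abs2_rat (inverse (U k) * U k - 1) \<le> 0"
      using eventually_ge_at_top[of N]
    proof eventually_elim
      case (elim k)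
      then have "U k \<noteq> 0" using N(1) N(2)[of k] by auto
      then show ?case by simp
    qed
    then have "null2 (\<lambda>k. inverse (U k) * U k - 1)" by (intro null2_dom[of "\<lambda>_. 0"]) auto
    then show "q2rel (\<lambda>k. (if null2 U then 0 else inverse (U k)) * U k) (\<lambda>_. 1)"
      using n c by (simp add: q2rel_def cauchy2_mult cauchy2_inverse)
  qed
  then show "a \<noteq> 0 \<Longrightarrow> inverse a * a = 1" by blast
qed

end

lift_definition norm_q2 :: "q2 \<Rightarrow> real" is "\<lambda>U. lim (\<lambda>n. abs2_rat (U n))"
proof -
  fix U V assume a: "q2rel U V"
  then obtain L where L: "(\<lambda>n. abs2_rat (U n)) \<longlonglongrightarrow> L"
    using cauchy2_convergent_abs unfolding convergent_def q2rel_def by blast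
  have t: "(\<lambda>n. abs2_rat (U n - V n)) \<longlonglongrightarrow> 0" using a by (simp add: q2rel_def null2_def)
  have "(\<lambda>n. abs2_rat (U n) - abs2_rat (V n)) \<longlonglongrightarrow> 0"
    by (rule tendsto_rabs_zero_cancel, rule tendsto_sandwich[OF _ _ tendsto_const t])
      (simp_all add: abs2_rat_diff_le)
  from tendsto_diff[OF L this] have "(\<lambda>n. abs2_rat (V n)) \<longlonglongrightarrow> L" by simp
  then show "lim (\<lambda>n. abs2_rat (U n)) = lim (\<lambda>n. abs2_rat (V n))" using L limI by metis
qed

definition val_q2 :: "q2 \<Rightarrow> ereal" where
  "val_q2 x = (if x = 0 then \<infinity> else ereal (- log 2 (norm_q2 x)))"

lemma q2rel_const [simp]: "q2rel (\<lambda>_. a) (\<lambda>_. b) \<longleftrightarrow> a = b"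
  by (simp add: q2rel_def null2_def LIMSEQ_const_iff)

lemma of_nat_q2: "of_nat k = abs_q2 (\<lambda>_. of_nat k)"
proof (induction k)
  case (Suc k)
  then show ?case by (simp add: one_q2_def plus_q2.abs_eq)
qed (simp add: zero_q2_def)

instance q2 :: field_char_0
proof
  show "inj (of_nat :: nat \<Rightarrow> q2)"
  proof (rule injI)
    fix m n :: nat assume "of_nat m = (of_nat n :: q2)"
    then have "q2rel (\<lambda>_. of_nat m) (\<lambda>_. of_nat n)"
      unfolding of_nat_q2 by (subst Quotient_rel[OF Quotient_q2, symmetric]) (simp del: of_nat_eq_iff)
    then show "m = n" by simp
  qed
qed

lemma of_int_q2: "of_int k = abs_q2 (\<lambda>_. of_int k)"
proof (cases k)
  case (nonneg n)
  then show ?thesis by (simp add: of_nat_q2)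
next
  case (neg n)
  have "of_int k = - (of_nat (Suc n) :: q2)" using neg by simp
  also have "\<dots> = abs_q2 (\<lambda>_. - of_nat (Suc n))"
    unfolding of_nat_q2 by (rule uminus_q2.abs_eq) simp
  finally show ?thesis using neg by simp
qed

lemma of_rat_q2: "of_rat r = abs_q2 (\<lambda>_. r)"
proof -
  obtain a b where r: "b \<noteq> 0" "r = of_int a / of_int b" using rat_as_quotient by blast
  have "\<not> null2 (\<lambda>_. of_int b)" using r by (simp add: null2_def LIMSEQ_const_iff)
  then have "inverse (of_int b) = abs_q2 (\<lambda>_. inverse (of_int b))"
    by (simp add: of_int_q2 inverse_q2.abs_eq)
  then have "of_int a * inverse (of_int b) = abs_q2 (\<lambda>_. of_int a * inverse (of_int b))"
    by (simp add: of_int_q2 times_q2.abs_eq)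
  then show ?thesis using r by (simp add: of_rat_mult of_rat_inverse divide_inverse)
qed

lemma norm_q2_of_rat: "norm_q2 (of_rat r) = abs2_rat r"
  unfolding of_rat_q2 by (subst norm_q2.abs_eq) simp_all

lemma norm_q2_eq_0_iff: "norm_q2 x = 0 \<longleftrightarrow> x = 0"
proof transfer
  fix U assume "q2rel U U"
  then have c: "cauchy2 U" by (simp add: q2rel_def)
  then have L: "(\<lambda>n. abs2_rat (U n)) \<longlonglongrightarrow> lim (\<lambda>n. abs2_rat (U n))"
    by (rule cauchy2_LIMSEQ_abs)
  have "q2rel U (\<lambda>_. 0) \<longleftrightarrow> null2 U" using c by (simp add: q2rel_def)
  also have "\<dots> \<longleftrightarrow> lim (\<lambda>n. abs2_rat (U n)) = 0"
    unfolding null2_def using L limI[of "\<lambda>n. abs2_rat (U n)" 0] by metis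
  finally show "lim (\<lambda>n. abs2_rat (U n)) = 0 \<longleftrightarrow> q2rel U (\<lambda>_. 0)" by simp
qed

lemma norm_q2_mult: "norm_q2 (x * y) = norm_q2 x * norm_q2 y"
proof transfer
  fix U V assume "q2rel U U" "q2rel V V"
  then have "(\<lambda>n. abs2_rat (U n)) \<longlonglongrightarrow> lim (\<lambda>n. abs2_rat (U n))"
    "(\<lambda>n. abs2_rat (V n)) \<longlonglongrightarrow> lim (\<lambda>n. abs2_rat (V n))"
    unfolding q2rel_def by (simp_all add: cauchy2_LIMSEQ_abs)
  then show "lim (\<lambda>n. abs2_rat (U n * V n)) = lim (\<lambda>n. abs2_rat (U n)) * lim (\<lambda>n. abs2_rat (V n))"
    unfolding abs2_rat_mult by (intro limI tendsto_mult)
qed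

lemma norm_q2_ultra: "norm_q2 (x + y) \<le> max (norm_q2 x) (norm_q2 y)"
proof transfer
  fix U V assume a: "q2rel U U" "q2rel V V"
  have l: "(\<lambda>n. abs2_rat (U n)) \<longlonglongrightarrow> lim (\<lambda>n. abs2_rat (U n))"
    "(\<lambda>n. abs2_rat (V n)) \<longlonglongrightarrow> lim (\<lambda>n. abs2_rat (V n))"
    "(\<lambda>n. abs2_rat (U n + V n)) \<longlonglongrightarrow> lim (\<lambda>n. abs2_rat (U n + V n))"
    using a unfolding q2rel_def by (simp_all add: cauchy2_LIMSEQ_abs cauchy2_add)
  show "lim (\<lambda>n. abs2_rat (U n + V n)) \<le> max (lim (\<lambda>n. abs2_rat (U n))) (lim (\<lambda>n. abs2_rat (V n)))"
    by (rule LIMSEQ_le[OF l(3) tendsto_max[OF l(1,2)]]) (intro exI allI impI abs2_rat_ultra)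
qed

lemma val_q2_of_rat: "r \<noteq> 0 \<Longrightarrow> val_q2 (of_rat r) = ereal (of_int (val2_rat r))"
  by (simp add: val_q2_def norm_q2_of_rat abs2_rat_def flip: powr_real_of_int')

definition Z2 :: "q2 set" where
  "Z2 = {c. val_q2 c \<ge> 0}"

text \<open>Reduction modulo 2; it is meaningful on \<^const>\<open>Z2\<close> only.\<close>

definition reduce2 :: "q2 \<Rightarrow> bit" where
  "reduce2 c = (if val_q2 c > 0 then 0 else 1)"

text \<open>The extension to the algebraic closure of the 2-adic valuation, which is unique.\<close>

definition extends_val2 :: "(q2 alg_closure \<Rightarrow> ereal) \<Rightarrow> bool" where
  "extends_val2 v \<longleftrightarrow>
     v 0 = \<infinity> \<and> (\<forall>c. c \<noteq> 0 \<longrightarrow> \<bar>v c\<bar> \<noteq> \<infinity>) \<and>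
     (\<forall>c d. v (c * d) = v c + v d) \<and> (\<forall>c d. v (c + d) \<ge> min (v c) (v d)) \<and>
     (\<forall>c. v (to_ac c) = val_q2 c)"

definition field_hom :: "('a::field \<Rightarrow> 'b::field) \<Rightarrow> bool" where
  "field_hom h \<longleftrightarrow> h 1 = 1 \<and> (\<forall>c d. h (c + d) = h c + h d) \<and> (\<forall>c d. h (c * d) = h c * h d)"


section \<open>Forms, projective points and function fields\<close>

text \<open>Polynomials in the variables with indices 0, 1, 2, \dots; a monomial is its exponent vector.\<close>

type_synonym 'a mpoly = "(nat \<Rightarrow>\<^sub>0 nat) \<Rightarrow>\<^sub>0 'a"

definition mconst :: "'a \<Rightarrow> 'a::zero mpoly" where
  "mconst c = Poly_Mapping.single 0 c"

definition mvar :: "nat \<Rightarrow> 'a::zero_neq_one mpoly" where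
  "mvar i = Poly_Mapping.single (Poly_Mapping.single i 1) 1"

text \<open>Evaluation at a vector, the coefficients being mapped by \<open>h\<close>.\<close>

definition meval :: "('a::zero \<Rightarrow> 'b::comm_semiring_1) \<Rightarrow> (nat \<Rightarrow> 'b) \<Rightarrow> 'a mpoly \<Rightarrow> 'b" where
  "meval h p F = (\<Sum>m\<in>Poly_Mapping.keys F.
     h (Poly_Mapping.lookup F m) * (\<Prod>i\<in>Poly_Mapping.keys m. p i ^ Poly_Mapping.lookup m i))"

definition mderiv :: "nat \<Rightarrow> 'a::comm_semiring_1 mpoly \<Rightarrow> 'a mpoly" where
  "mderiv i F = (\<Sum>m\<in>Poly_Mapping.keys F.
     Poly_Mapping.single (m - Poly_Mapping.single i 1)
       (of_nat (Poly_Mapping.lookup m i) * Poly_Mapping.lookup F m))"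

text \<open>Polynomials in the first \<open>N\<close> variables with coefficients in \<open>R\<close>, and homogeneous ones
  of degree \<open>d\<close> (the zero polynomial has every degree).\<close>

definition mpolys :: "'a::zero set \<Rightarrow> nat \<Rightarrow> 'a mpoly set" where
  "mpolys R N = {F. \<forall>m\<in>Poly_Mapping.keys F. Poly_Mapping.lookup F m \<in> R \<and> Poly_Mapping.keys m \<subseteq> {..<N}}"

definition forms :: "'a::zero set \<Rightarrow> nat \<Rightarrow> nat \<Rightarrow> 'a mpoly set" where
  "forms R N d = {F \<in> mpolys R N. \<forall>m\<in>Poly_Mapping.keys F.
     (\<Sum>i\<in>Poly_Mapping.keys m. Poly_Mapping.lookup m i) = d}"

definition mideal :: "'a::comm_ring_1 set \<Rightarrow> nat \<Rightarrow> 'a mpoly set \<Rightarrow> 'a mpoly set" where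
  "mideal R N S = {\<Sum>s\<in>T. c s * s | T c. finite T \<and> T \<subseteq> S \<and> (\<forall>s\<in>T. c s \<in> mpolys R N)}"

text \<open>Function fields of curves over \<open>k\<close> are taken inside an algebraic closure of the rational
  function field \<open>k(t)\<close>, in which every function field in one variable over \<open>k\<close> can be embedded.\<close>

type_synonym 'k ffc = "'k poly fract alg_closure"

definition ffc_const :: "'k::field \<Rightarrow> 'k ffc" where
  "ffc_const c = to_ac (Fract [:c:] 1)"

definition ffc_t :: "'k::field ffc" where
  "ffc_t = to_ac (Fract [:0, 1:] 1)"

text \<open>The field generated over \<open>k\<close> by the quotients of the homogeneous coordinates of a point,
  that is, the function field of the projective variety with this generic point.\<close>

definition fun_field :: "nat \<Rightarrow> (nat \<Rightarrow> 'k::field ffc) \<Rightarrow> 'k ffc set" where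
  "fun_field N p = {meval ffc_const p F / meval ffc_const p G | F G d.
     F \<in> forms UNIV N d \<and> G \<in> forms UNIV N d \<and> meval ffc_const p G \<noteq> 0}"


section \<open>Weierstrass curves\<close>

datatype 'k wcoeffs = WCoeffs (a1: 'k) (a2: 'k) (a3: 'k) (a4: 'k) (a6: 'k)

definition vec3 :: "'k \<Rightarrow> 'k \<Rightarrow> 'k \<Rightarrow> nat \<Rightarrow> 'k" where
  "vec3 x y z = (\<lambda>i. if i = 0 then x else if i = 1 then y else z)"

definition wform :: "'k::comm_ring_1 wcoeffs \<Rightarrow> 'k mpoly" where
  "wform a = (let x = mvar 0; y = mvar 1; z = mvar 2 in
     y^2 * z + mconst (a1 a) * x * y * z + mconst (a3 a) * y * z^2
     - (x^3 + mconst (a2 a) * x^2 * z + mconst (a4 a) * x * z^2 + mconst (a6 a) * z^3))"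

definition smooth_weierstrass :: "'k::field wcoeffs \<Rightarrow> bool" where
  "smooth_weierstrass a \<longleftrightarrow>
     (\<forall>p :: nat \<Rightarrow> 'k alg_closure. (\<exists>i<3. p i \<noteq> 0) \<and> meval to_ac p (wform a) = 0
        \<longrightarrow> (\<exists>i<3. meval to_ac p (mderiv i (wform a)) \<noteq> 0))"

datatype 'k wpoint = Infty | Aff 'k 'k

fun pcoords :: "'k::field wpoint \<Rightarrow> nat \<Rightarrow> 'k" where
  "pcoords Infty = vec3 0 1 0"
| "pcoords (Aff x y) = vec3 x y 1"

definition wpoints :: "'k::field wcoeffs \<Rightarrow> 'k wpoint set" where
  "wpoints a = {P. meval id (pcoords P) (wform a) = 0}"

text \<open>The generic point \<open>(t : y : 1)\<close>, with \<open>y\<close> a root of the Weierstrass equation over \<open>k(t)\<close>;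
  the function field is \<open>k(t, y)\<close>. The choice of the root does not matter, since the two roots
  are conjugate over \<open>k(t)\<close>.\<close>

definition wgeneric :: "'k::field wcoeffs \<Rightarrow> nat \<Rightarrow> 'k ffc" where
  "wgeneric a = vec3 ffc_t (SOME y. meval ffc_const (vec3 ffc_t y 1) (wform a) = 0) 1"

text \<open>Nonzero rational functions are given by quotients \<open>F / G\<close> of ternary forms of equal degree
  that do not vanish identically on the curve.\<close>

definition nonzero_ratfun :: "'k::field wcoeffs \<Rightarrow> 'k mpoly \<Rightarrow> 'k mpoly \<Rightarrow> bool" where
  "nonzero_ratfun a F G \<longleftrightarrow> (\<exists>d. F \<in> forms UNIV 3 d \<and> G \<in> forms UNIV 3 d) \<and>
     meval ffc_const (wgeneric a) F \<noteq> 0 \<and> meval ffc_const (wgeneric a) G \<noteq> 0"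

definition ratfun :: "'k::field wcoeffs \<Rightarrow> 'k mpoly \<Rightarrow> 'k mpoly \<Rightarrow> 'k ffc" where
  "ratfun a F G = meval ffc_const (wgeneric a) F / meval ffc_const (wgeneric a) G"

definition local_ring :: "'k::field wcoeffs \<Rightarrow> 'k wpoint \<Rightarrow> 'k ffc set" where
  "local_ring a P = {ratfun a F G | F G d.
     F \<in> forms UNIV 3 d \<and> G \<in> forms UNIV 3 d \<and> meval id (pcoords P) G \<noteq> 0}"

definition local_max_ideal :: "'k::field wcoeffs \<Rightarrow> 'k wpoint \<Rightarrow> 'k ffc set" where
  "local_max_ideal a P = {ratfun a F G | F G d.
     F \<in> forms UNIV 3 d \<and> G \<in> forms UNIV 3 d \<and> meval id (pcoords P) F = 0 \<and>
     meval id (pcoords P) G \<noteq> 0}"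

definition uniformizer :: "'k::field wcoeffs \<Rightarrow> 'k wpoint \<Rightarrow> 'k ffc \<Rightarrow> bool" where
  "uniformizer a P \<pi> \<longleftrightarrow> \<pi> \<in> local_max_ideal a P \<and>
     (\<forall>s\<in>local_max_ideal a P. \<exists>r\<in>local_ring a P. s = r * \<pi>)"

definition ord_at :: "'k::field wcoeffs \<Rightarrow> 'k wpoint \<Rightarrow> 'k ffc \<Rightarrow> int" where
  "ord_at a P f = (THE n. \<exists>\<pi> u. uniformizer a P \<pi> \<and> u \<noteq> 0 \<and>
     u \<in> local_ring a P \<and> inverse u \<in> local_ring a P \<and> f = \<pi> powi n * u)"


section \<open>Divisors on an elliptic curve over the rationals\<close>

text \<open>A divisor is a function on the points over the algebraic closure of the rationals.\<close>

type_synonym divisor = "rat alg_closure wpoint \<Rightarrow> int"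

definition geom :: "rat wcoeffs \<Rightarrow> rat alg_closure wcoeffs" where
  "geom a = map_wcoeffs to_ac a"

definition rational_divisor :: "rat wcoeffs \<Rightarrow> divisor \<Rightarrow> bool" where
  "rational_divisor a D \<longleftrightarrow> finite {P. D P \<noteq> 0} \<and> {P. D P \<noteq> 0} \<subseteq> wpoints (geom a) \<and>
     (\<forall>\<sigma>. field_hom \<sigma> \<and> bij \<sigma> \<longrightarrow> (\<forall>P. D (map_wpoint \<sigma> P) = D P))"

definition div_of :: "rat wcoeffs \<Rightarrow> rat mpoly \<Rightarrow> rat mpoly \<Rightarrow> divisor" where
  "div_of a F G = (\<lambda>P. if P \<in> wpoints (geom a)
     then ord_at (geom a) P (ratfun (geom a) (Poly_Mapping.map to_ac F) (Poly_Mapping.map to_ac G))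
     else 0)"

definition lin_equiv :: "rat wcoeffs \<Rightarrow> divisor \<Rightarrow> divisor \<Rightarrow> bool" where
  "lin_equiv a D D' \<longleftrightarrow> (\<exists>F G. nonzero_ratfun a F G \<and> div_of a F G = (\<lambda>P. D P - D' P))"


section \<open>Good Weierstrass models at 2\<close>

text \<open>The substitution \<open>x = u\<^sup>2 x' + r z', y = u\<^sup>3 y' + u\<^sup>2 s x' + t z', z = z'\<close>; these are the
  isomorphisms between Weierstrass curves that respect the point \<open>(0 : 1 : 0)\<close>.\<close>

definition wchange :: "'k::field \<Rightarrow> 'k \<Rightarrow> 'k \<Rightarrow> 'k \<Rightarrow> (nat \<Rightarrow> 'k) \<Rightarrow> nat \<Rightarrow> 'k" where
  "wchange u r s t p = vec3 (u^2 * p 0 + r * p 2) (u^3 * p 1 + u^2 * s * p 0 + t * p 2) (p 2)"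

definition good_weierstrass_model ::
    "rat wcoeffs \<Rightarrow> q2 wcoeffs \<Rightarrow> q2 \<Rightarrow> q2 \<Rightarrow> q2 \<Rightarrow> q2 \<Rightarrow> bool" where
  "good_weierstrass_model a b u r s t \<longleftrightarrow>
     set_wcoeffs b \<subseteq> Z2 \<and> smooth_weierstrass (map_wcoeffs reduce2 b) \<and> u \<noteq> 0 \<and>
     (\<forall>p. meval of_rat (wchange u r s t p) (wform a) = u^6 * meval id p (wform b))"


section \<open>Good reduction at 2\<close>

text \<open>The closed subscheme of projective \<open>n\<close>-space over the 2-adic integers defined by the forms
  in \<open>S\<close> is smooth of relative dimension 1 at the geometric point \<open>p\<close> (whose field is a
  \<^const>\<open>Z2\<close>-algebra via \<open>h\<close>): locally at \<open>p\<close> its ideal is generated by \<open>n - 1\<close> elements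
  whose differentials are linearly independent at \<open>p\<close>. By the Euler relation, the homogeneous
  Jacobian matrix has the same rank as the one in an affine chart. A form \<open>q\<close> with \<open>q p \<noteq> 0\<close> is a
  unit in the homogeneous localisation at \<open>p\<close>.\<close>

definition smooth_curve_at :: "nat \<Rightarrow> q2 mpoly set \<Rightarrow> (q2 \<Rightarrow> 'b::field) \<Rightarrow> (nat \<Rightarrow> 'b) \<Rightarrow> bool" where
  "smooth_curve_at n S h p \<longleftrightarrow> (\<exists>g :: nat \<Rightarrow> q2 mpoly.
     (\<forall>i<n-1. g i \<in> mideal Z2 (n+1) S \<and> (\<exists>d. g i \<in> forms Z2 (n+1) d)) \<and>
     (\<forall>c. (\<forall>j\<le>n. (\<Sum>i<n-1. c i * meval h p (mderiv j (g i))) = 0) \<longrightarrow> (\<forall>i<n-1. c i = 0)) \<and>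
     (\<forall>s\<in>S. \<exists>q d. q \<in> forms Z2 (n+1) d \<and> meval h p q \<noteq> 0 \<and> q * s \<in> mideal Z2 (n+1) (g ` {..<n-1})))"

definition smooth_proj_curve_Z2 :: "nat \<Rightarrow> q2 mpoly set \<Rightarrow> bool" where
  "smooth_proj_curve_Z2 n S \<longleftrightarrow> n \<ge> 1 \<and> finite S \<and> (\<forall>s\<in>S. \<exists>d. s \<in> forms Z2 (n+1) d) \<and>
     (\<forall>p :: nat \<Rightarrow> q2 alg_closure. (\<exists>i\<le>n. p i \<noteq> 0) \<and> (\<forall>s\<in>S. meval to_ac p s = 0)
        \<longrightarrow> smooth_curve_at n S to_ac p) \<and>
     (\<forall>p :: nat \<Rightarrow> bit alg_closure.
        (\<exists>i\<le>n. p i \<noteq> 0) \<and> (\<forall>s\<in>S. meval (\<lambda>c. to_ac (reduce2 c)) p s = 0)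
        \<longrightarrow> smooth_curve_at n S (\<lambda>c. to_ac (reduce2 c)) p)"

text \<open>The subscheme of projective \<open>n\<close>-space over the 2-adic numbers defined by \<open>S\<close> is integral with
  generic point \<open>p\<close>: its saturated ideal is the prime ideal of all forms that vanish at \<open>p\<close>.\<close>

definition generic_point :: "nat \<Rightarrow> q2 mpoly set \<Rightarrow> (nat \<Rightarrow> q2 ffc) \<Rightarrow> bool" where
  "generic_point n S p \<longleftrightarrow> (\<exists>i\<le>n. p i \<noteq> 0) \<and>
     (\<forall>d. \<forall>F\<in>forms UNIV (n+1) d. meval ffc_const p F = 0 \<longleftrightarrow>
        (\<exists>e. \<forall>i\<le>n. mvar i ^ e * F \<in> mideal UNIV (n+1) S))"

text \<open>The smooth projective curve over the 2-adic numbers with function field \<open>L\<close> has good reduction: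
  it is the generic fibre of a smooth projective scheme over the 2-adic integers. Smooth projective
  curves are isomorphic if and only if their function fields are. Every smooth proper model of a
  curve over a discrete valuation ring is projective.\<close>

definition good_reduction :: "q2 ffc set \<Rightarrow> bool" where
  "good_reduction L \<longleftrightarrow>
     (\<exists>n S p. smooth_proj_curve_Z2 n S \<and> generic_point n S p \<and> fun_field (n+1) p = L)"

text \<open>The field obtained from the function field of a Weierstrass curve by adjoining a square root
  of \<open>F / G\<close>, that is, the function field of the double cover.\<close>

definition double_cover_field :: "'k::field wcoeffs \<Rightarrow> 'k mpoly \<Rightarrow> 'k mpoly \<Rightarrow> 'k ffc set" where
  "double_cover_field a F G = fun_field 4
     (\<lambda>i. if i < 2 then wgeneric a i else if i = 2 then SOME w. w^2 = ratfun a F G else 1)"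

text \<open>A curve over the rationals has good reduction at 2 if its base change to the 2-adic numbers has;
  for the double cover, the base change is the double cover given by the same data over the
  2-adic numbers.\<close>

definition double_cover_good_reduction :: "rat wcoeffs \<Rightarrow> rat mpoly \<Rightarrow> rat mpoly \<Rightarrow> bool" where
  "double_cover_good_reduction a F G \<longleftrightarrow>
     good_reduction (double_cover_field (map_wcoeffs of_rat a)
       (Poly_Mapping.map of_rat F) (Poly_Mapping.map of_rat G))"

end

(*
  By Riemann-Roch on E, the function f with divisor P1 + P2 + P3 - 3 * Infty is a linear form
  c (y + alpha x + gamma). All P_i lie in the formal group with x of valuation 2/3 and z of valuation 2,
  so 1 + alpha x + gamma z = 0 forces alpha to be integral and gamma to have valuation -2. After a
  twist by a sign and a power of 2, f is rho (1 + (y + alpha x) / gamma) with rho = 1 modulo 4, and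
  w = 1 + 2 v turns w^2 = f into the Artin-Schreier form v^2 + v = m + E (y + alpha x) with a
  unit E. Solving for y embeds C as a plane quartic over the 2-adic integers. Modulo 2 its affine part
  is etale over the smooth curve E; over the 2-adic numbers a singular point would be a point of
  tangency of the line y + alpha x + gamma = 0, which valuations exclude.
*)

theory Submission
  imports Defs
begin

text \<open>The divisor hypothesis speaks of orders at points over the closure of the rationals,
  while the equation of f is needed over the 2-adic numbers. As \<open>ord_at\<close> is a definite
  description, nothing can be read from it before a uniformizer is exhibited at the point. Functions
  are therefore written (A(x) + B(x) s) / C(x), where s^2 is the discriminant cubic: at infinity x
  and s have orders -2 and -3, and parity rules out cancellation. Coefficients stay rational, with a
  Bezout identity as certificate of lowest terms, so that a single polynomial identity serves in
  every extension. The distance 2/3 enters twice. The coefficient 4 gamma / rho = 1/E of v^2 + v is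
  a unit exactly because gamma has valuation -2, which comes from z having valuation 3 * 2/3. And
  the valuation of alpha x lies in 2/3 + Z, so it never meets the integral valuations of 1 and gamma
  z. The quartic has one point on the line at infinity, (1 : 0 : 0), and is smooth there in both
  fibres.\<close>

section \<open>Evaluation of polynomials in several variables\<close>

definition mono_eval :: "(nat \<Rightarrow> 'b::comm_semiring_1) \<Rightarrow> (nat \<Rightarrow>\<^sub>0 nat) \<Rightarrow> 'b" where
  "mono_eval p m = (\<Prod>i\<in>Poly_Mapping.keys m. p i ^ Poly_Mapping.lookup m i)"

definition mono_degree :: "(nat \<Rightarrow>\<^sub>0 nat) \<Rightarrow> nat" where
  "mono_degree m = (\<Sum>i\<in>Poly_Mapping.keys m. Poly_Mapping.lookup m i)"

lemma keys_add_nat: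
  fixes m n :: "nat \<Rightarrow>\<^sub>0 nat"
  shows "Poly_Mapping.keys (m + n) = Poly_Mapping.keys m \<union> Poly_Mapping.keys n"
  by (auto simp: in_keys_iff lookup_add)

lemma mono_eval_superset:
  assumes "finite I" "Poly_Mapping.keys m \<subseteq> I"
  shows "mono_eval p m = (\<Prod>i\<in>I. p i ^ Poly_Mapping.lookup m i)"
  unfolding mono_eval_def
  by (rule prod.mono_neutral_left) (use assms in \<open>auto simp: in_keys_iff\<close>)

lemma mono_degree_superset:
  assumes "finite I" "Poly_Mapping.keys m \<subseteq> I"
  shows "mono_degree m = (\<Sum>i\<in>I. Poly_Mapping.lookup m i)"
  unfolding mono_degree_def
  by (rule sum.mono_neutral_left) (use assms in \<open>auto simp: in_keys_iff\<close>)

lemma mono_eval_add: "mono_eval p (m + n) = mono_eval p m * mono_eval p n"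
proof -
  let ?I = "Poly_Mapping.keys m \<union> Poly_Mapping.keys n"
  have "mono_eval p (m + n) = (\<Prod>i\<in>?I. p i ^ Poly_Mapping.lookup (m + n) i)"
    by (rule mono_eval_superset) (simp_all add: keys_add_nat)
  also have "\<dots> = mono_eval p m * mono_eval p n"
    by (simp add: mono_eval_superset[of ?I] lookup_add power_add prod.distrib)
  finally show ?thesis .
qed

lemma mono_degree_add: "mono_degree (m + n) = mono_degree m + mono_degree n"
proof -
  let ?I = "Poly_Mapping.keys m \<union> Poly_Mapping.keys n"
  have "mono_degree (m + n) = (\<Sum>i\<in>?I. Poly_Mapping.lookup (m + n) i)"
    by (rule mono_degree_superset) (simp_all add: keys_add_nat)
  also have "\<dots> = mono_degree m + mono_degree n"
    by (simp add: mono_degree_superset[of ?I] lookup_add sum.distrib)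
  finally show ?thesis .
qed

lemma mono_eval_0 [simp]: "mono_eval p 0 = 1"
  and mono_degree_0 [simp]: "mono_degree 0 = 0"
  and mono_eval_var [simp]: "mono_eval p (Poly_Mapping.single i 1) = p i"
  and mono_degree_var [simp]: "mono_degree (Poly_Mapping.single i 1) = 1"
  by (simp_all add: mono_eval_def mono_degree_def)

lemma mpoly_expand:
  fixes F :: "'a::comm_monoid_add mpoly"
  shows "F = (\<Sum>m\<in>Poly_Mapping.keys F. Poly_Mapping.single m (Poly_Mapping.lookup F m))"
proof (rule poly_mapping_eqI)
  fix k
  have "(\<Sum>m\<in>Poly_Mapping.keys F. Poly_Mapping.lookup (Poly_Mapping.single m (Poly_Mapping.lookup F m)) k)
      = (\<Sum>m\<in>Poly_Mapping.keys F. if m = k then Poly_Mapping.lookup F m else 0)"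
    by (intro sum.cong) (auto simp: lookup_single when_def)
  then show "Poly_Mapping.lookup F k = Poly_Mapping.lookup
      (\<Sum>m\<in>Poly_Mapping.keys F. Poly_Mapping.single m (Poly_Mapping.lookup F m)) k"
    by (simp add: lookup_sum in_keys_iff)
qed

lemma mpoly_mult_expand:
  fixes F G :: "'a::comm_ring_1 mpoly"
  shows "F * G = (\<Sum>m\<in>Poly_Mapping.keys F. \<Sum>n\<in>Poly_Mapping.keys G.
     Poly_Mapping.single (m + n) (Poly_Mapping.lookup F m * Poly_Mapping.lookup G n))"
  by (subst mpoly_expand[of F], subst mpoly_expand[of G])
    (simp add: sum_distrib_left sum_distrib_right mult_single sum.swap[of _ "Poly_Mapping.keys F"])

lemma map_to_poly_mapping_lookup: "h 0 = 0 \<Longrightarrow> Poly_Mapping.lookup (Poly_Mapping.map h F) m = h (Poly_Mapping.lookup F m)"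
  by (transfer) (simp add: when_def)

definition mcoeffs :: "'a::zero set \<Rightarrow> 'a mpoly set" where
  "mcoeffs R = {F. \<forall>m. Poly_Mapping.lookup F m \<in> R}"

lemma mcoeffs_UNIV [simp]: "mcoeffs UNIV = UNIV"
  by (simp add: mcoeffs_def)

section \<open>Coefficient rings and homomorphisms defined on them\<close>

locale coeff_ring =
  fixes R :: "'a::comm_ring_1 set"
  assumes R0 [simp]: "0 \<in> R" and R1 [simp]: "1 \<in> R"
    and R_add: "a \<in> R \<Longrightarrow> b \<in> R \<Longrightarrow> a + b \<in> R"
    and R_mult: "a \<in> R \<Longrightarrow> b \<in> R \<Longrightarrow> a * b \<in> R"
    and R_uminus: "a \<in> R \<Longrightarrow> - a \<in> R"
begin

lemma R_diff: "a \<in> R \<Longrightarrow> b \<in> R \<Longrightarrow> a - b \<in> R"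
  using R_add[of a "- b"] R_uminus[of b] by simp

lemma R_power: "a \<in> R \<Longrightarrow> a ^ n \<in> R"
  by (induction n) (auto intro: R_mult)

lemma mcoeffs_single [simp]: "c \<in> R \<Longrightarrow> Poly_Mapping.single m c \<in> mcoeffs R"
  by (auto simp: mcoeffs_def lookup_single when_def)

lemma mcoeffs_add: "F \<in> mcoeffs R \<Longrightarrow> G \<in> mcoeffs R \<Longrightarrow> F + G \<in> mcoeffs R"
  by (auto simp: mcoeffs_def lookup_add intro: R_add)

lemma mcoeffs_uminus: "F \<in> mcoeffs R \<Longrightarrow> - F \<in> mcoeffs R"
  by (auto simp: mcoeffs_def intro: R_uminus)

lemma mcoeffs_diff: "F \<in> mcoeffs R \<Longrightarrow> G \<in> mcoeffs R \<Longrightarrow> F - G \<in> mcoeffs R"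
  by (auto simp: mcoeffs_def lookup_minus intro: R_diff)

lemma mcoeffs_0 [simp]: "0 \<in> mcoeffs R"
  by (simp add: mcoeffs_def)

lemma mcoeffs_sum: "(\<And>i. i \<in> I \<Longrightarrow> f i \<in> mcoeffs R) \<Longrightarrow> sum f I \<in> mcoeffs R"
  by (induction I rule: infinite_finite_induct) (auto intro: mcoeffs_add)

lemma mcoeffs_mult: "F \<in> mcoeffs R \<Longrightarrow> G \<in> mcoeffs R \<Longrightarrow> F * G \<in> mcoeffs R"
  by (subst mpoly_mult_expand, intro mcoeffs_sum mcoeffs_single R_mult) (simp_all add: mcoeffs_def)

lemma mcoeffs_1 [simp]: "1 \<in> mcoeffs R"
  using mcoeffs_single[of 1 0] by simp

lemma mcoeffs_power: "F \<in> mcoeffs R \<Longrightarrow> F ^ n \<in> mcoeffs R"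
  by (induction n) (auto intro: mcoeffs_mult)

lemma mcoeffs_const: "c \<in> R \<Longrightarrow> mconst c \<in> mcoeffs R"
  by (simp add: mconst_def)

lemma mcoeffs_var: "mvar i \<in> mcoeffs R"
  by (simp add: mvar_def)

lemmas mcoeffs_intros = mcoeffs_add mcoeffs_diff mcoeffs_uminus mcoeffs_mult mcoeffs_power
  mcoeffs_const mcoeffs_var

end

text \<open>The operations are respected on \<open>R\<close> only. This covers reduction modulo 2,
  because \<open>reduce2\<close> sends everything outside \<open>Z2\<close> to 1, and also maps of
  fields, with \<open>R = UNIV\<close>. Evaluation is then compatible with the operations for
  polynomials with coefficients in \<open>R\<close>.\<close>

locale coeff_hom = coeff_ring R for R :: "'a::comm_ring_1 set" +
  fixes h :: "'a \<Rightarrow> 'b::comm_ring_1"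
  assumes h0 [simp]: "h 0 = 0" and h1 [simp]: "h 1 = 1"
    and h_add: "a \<in> R \<Longrightarrow> b \<in> R \<Longrightarrow> h (a + b) = h a + h b"
    and h_mult: "a \<in> R \<Longrightarrow> b \<in> R \<Longrightarrow> h (a * b) = h a * h b"
begin

lemma h_uminus: "a \<in> R \<Longrightarrow> h (- a) = - h a"
  using h_add[of "- a" a] R_uminus[of a] by (simp add: eq_neg_iff_add_eq_0)

lemma h_diff: "a \<in> R \<Longrightarrow> b \<in> R \<Longrightarrow> h (a - b) = h a - h b"
  using h_add[of a "- b"] R_uminus[of b] h_uminus[of b] by simp

lemma h_power: "a \<in> R \<Longrightarrow> h (a ^ n) = h a ^ n"
  by (induction n) (auto simp: h_mult R_power)

lemma meval_superset:
  assumes "finite S" "Poly_Mapping.keys F \<subseteq> S"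
  shows "meval h p F = (\<Sum>m\<in>S. h (Poly_Mapping.lookup F m) * mono_eval p m)"
  unfolding meval_def mono_eval_def
  by (rule sum.mono_neutral_left) (use assms in \<open>auto simp: in_keys_iff\<close>)

lemma meval_single: "meval h p (Poly_Mapping.single m c) = h c * mono_eval p m"
  by (subst meval_superset[of "{m}"]) auto

lemma meval_const: "meval h p (mconst c) = h c"
  by (simp add: mconst_def meval_single)

lemma meval_var: "meval h p (mvar i) = p i"
  by (simp add: mvar_def meval_single del: One_nat_def)

lemma meval_0 [simp]: "meval h p 0 = 0"
  by (simp add: meval_def)

lemma meval_1 [simp]: "meval h p 1 = 1"
  using meval_const[of p 1] by (simp add: mconst_def)

lemma meval_add:
  assumes "F \<in> mcoeffs R" "G \<in> mcoeffs R"
  shows "meval h p (F + G) = meval h p F + meval h p G"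
proof -
  let ?S = "Poly_Mapping.keys F \<union> Poly_Mapping.keys G"
  have "Poly_Mapping.keys (F + G) \<subseteq> ?S" by (rule Poly_Mapping.keys_add)
  then show ?thesis
    using assms by (simp add: meval_superset[of ?S] lookup_add h_add mcoeffs_def distrib_right sum.distrib)
qed

lemma meval_uminus:
  assumes "F \<in> mcoeffs R"
  shows "meval h p (- F) = - meval h p F"
  using meval_add[OF assms mcoeffs_uminus[OF assms], of p]
  by (simp add: eq_neg_iff_add_eq_0 add.commute)

lemma meval_diff:
  assumes "F \<in> mcoeffs R" "G \<in> mcoeffs R"
  shows "meval h p (F - G) = meval h p F - meval h p G"
  using meval_add[OF assms(1) mcoeffs_uminus[OF assms(2)], of p] meval_uminus[OF assms(2), of p] by simp

lemma meval_sum: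
  "(\<And>i. i \<in> I \<Longrightarrow> f i \<in> mcoeffs R) \<Longrightarrow> meval h p (sum f I) = (\<Sum>i\<in>I. meval h p (f i))"
  by (induction I rule: infinite_finite_induct) (auto simp: meval_add mcoeffs_sum)

lemma meval_mult:
  assumes F: "F \<in> mcoeffs R" and G: "G \<in> mcoeffs R"
  shows "meval h p (F * G) = meval h p F * meval h p G"
proof -
  have c: "Poly_Mapping.lookup F m \<in> R" "Poly_Mapping.lookup G m \<in> R" for m
    using assms by (auto simp: mcoeffs_def)
  have "meval h p (F * G) = (\<Sum>m\<in>Poly_Mapping.keys F. \<Sum>n\<in>Poly_Mapping.keys G.
      h (Poly_Mapping.lookup F m * Poly_Mapping.lookup G n) * mono_eval p (m + n))"
    by (subst mpoly_mult_expand) (simp add: meval_sum mcoeffs_sum R_mult c meval_single)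
  also have "\<dots> = meval h p F * meval h p G"
    by (simp add: meval_superset[OF finite_keys subset_refl] h_mult c mono_eval_add
        sum_product algebra_simps)
  finally show ?thesis .
qed

lemma meval_power: "F \<in> mcoeffs R \<Longrightarrow> meval h p (F ^ n) = meval h p F ^ n"
  by (induction n) (auto simp: meval_mult mcoeffs_power)

lemmas meval_rules = meval_add meval_diff meval_uminus meval_mult meval_power meval_const meval_var

end

section \<open>Maps of fields\<close>

locale field_map = coeff_hom UNIV h for h :: "'a::field \<Rightarrow> 'b::field"
begin

lemma h_add' [simp]: "h (a + b) = h a + h b" by (simp add: h_add)
lemma h_mult' [simp]: "h (a * b) = h a * h b" by (simp add: h_mult)
lemma h_uminus' [simp]: "h (- a) = - h a" by (simp add: h_uminus)
lemma h_diff' [simp]: "h (a - b) = h a - h b" by (simp add: h_diff)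
lemma h_power' [simp]: "h (a ^ n) = h a ^ n" by (simp add: h_power)
lemma h_of_nat [simp]: "h (of_nat n) = of_nat n" by (induction n) auto
lemma h_numeral [simp]: "h (numeral n) = numeral n"
  using h_of_nat[of "numeral n"] by (simp del: h_of_nat)
lemma h_eq_0_iff [simp]: "h a = 0 \<longleftrightarrow> a = 0"
proof
  assume "h a = 0"
  then have "h (a * inverse a) = 0" by simp
  then show "a = 0" by (metis h1 right_inverse zero_neq_one)
qed simp
lemma h_inverse [simp]: "h (inverse a) = inverse (h a)"
proof (cases "a = 0")
  case False
  then have "h a * h (inverse a) = 1" by (simp flip: h_mult')
  then show ?thesis by (metis inverse_unique)
qed simp
lemma h_divide [simp]: "h (a / b) = h a / h b"
  by (simp add: divide_inverse)
lemma map_poly_h_add [simp]: "map_poly h (A + B) = map_poly h A + map_poly h B"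
  by (rule poly_eqI) (simp add: coeff_map_poly)
lemma map_poly_h_uminus [simp]: "map_poly h (- A) = - map_poly h A"
  by (rule poly_eqI) (simp add: coeff_map_poly)
lemma map_poly_h_diff [simp]: "map_poly h (A - B) = map_poly h A - map_poly h B"
  by (rule poly_eqI) (simp add: coeff_map_poly)
lemma h_sum: "h (sum f I) = (\<Sum>i\<in>I. h (f i))"
  by (induction I rule: infinite_finite_induct) auto
lemma map_poly_h_mult [simp]: "map_poly h (A * B) = map_poly h A * map_poly h B"
  by (rule poly_eqI) (simp add: coeff_map_poly coeff_mult h_sum)
lemma map_poly_h_pCons [simp]: "map_poly h (pCons a A) = pCons (h a) (map_poly h A)"
  by (rule map_poly_pCons) simp
lemma map_poly_h_1 [simp]: "map_poly h 1 = 1"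
  by (simp add: one_pCons)
lemma map_poly_h_eq_0_iff [simp]: "map_poly h A = 0 \<longleftrightarrow> A = 0"
  by (simp add: poly_eq_iff coeff_map_poly)
lemma map_poly_h_power [simp]: "map_poly h (A ^ n) = map_poly h A ^ n"
  by (induction n) auto
lemma degree_map_poly_h [simp]: "Polynomial.degree (map_poly h A) = Polynomial.degree A"
  by (rule degree_map_poly) auto

end

lemma field_map_to_ac: "field_map to_ac"
  by unfold_locales auto

lemma field_map_of_rat: "field_map (of_rat :: rat \<Rightarrow> 'a::field_char_0)"
  by unfold_locales (auto simp: of_rat_add of_rat_mult)

lemma field_map_ffc_const: "field_map ffc_const"
  by unfold_locales (auto simp: ffc_const_def fract_collapse mult.commute simp flip: to_ac_add to_ac_mult One_fract_def one_pCons)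

lemma field_map_comp: "field_map g \<Longrightarrow> field_map h \<Longrightarrow> field_map (\<lambda>x. g (h x))"
proof -
  assume "field_map g" "field_map h"
  then interpret g: field_map g + h: field_map h by simp_all
  show ?thesis by unfold_locales auto
qed

lemma field_map_field_hom: "field_hom h \<Longrightarrow> field_map h"
proof unfold_locales
  assume h: "field_hom h"
  show "h 0 = 0" using h unfolding field_hom_def by (metis add_cancel_right_left add_0)
qed (auto simp: field_hom_def)

text \<open>Such a map is determined on integers and hence on quotients. This compares the two ways
  from the rationals to the closure of the 2-adic numbers, through \<iota> and through
  \<open>of_rat\<close>.\<close>

lemma field_map_of_rat_unique:
  assumes "field_map (h :: rat \<Rightarrow> 'a::field_char_0)"
  shows "h q = of_rat q"
proof -
  interpret h: field_map h by fact
  have n: "h (of_int n) = of_int n" for n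
    by (cases n) auto
  obtain a b where "q = of_int a / of_int b" using rat_as_quotient by blast
  then show ?thesis by (simp add: n of_rat_divide)
qed

lemma (in field_map) meval_map:
  assumes "field_map g"
  shows "meval g p (Poly_Mapping.map h F) = meval (\<lambda>c. g (h c)) p F"
proof -
  interpret g: field_map g by fact
  have k: "Poly_Mapping.keys (Poly_Mapping.map h F) = Poly_Mapping.keys F"
    by (auto simp: in_keys_iff map_to_poly_mapping_lookup)
  show ?thesis
    by (simp add: meval_def k map_to_poly_mapping_lookup)
qed

section \<open>Forms\<close>

context coeff_ring
begin

lemma forms_iff: "F \<in> forms R N d \<longleftrightarrow> F \<in> mcoeffs R \<and>
   (\<forall>m\<in>Poly_Mapping.keys F. Poly_Mapping.keys m \<subseteq> {..<N} \<and> mono_degree m = d)"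
  unfolding forms_def mpolys_def mcoeffs_def mono_degree_def
  by (auto simp: in_keys_iff)

lemma forms_add: "F \<in> forms R N d \<Longrightarrow> G \<in> forms R N d \<Longrightarrow> F + G \<in> forms R N d"
  unfolding forms_iff using Poly_Mapping.keys_add[of F G] by (auto intro: mcoeffs_add)

lemma forms_uminus: "F \<in> forms R N d \<Longrightarrow> - F \<in> forms R N d"
  unfolding forms_iff by (auto intro: mcoeffs_uminus simp: in_keys_iff)

lemma forms_diff: "F \<in> forms R N d \<Longrightarrow> G \<in> forms R N d \<Longrightarrow> F - G \<in> forms R N d"
  using forms_add[of F N d "- G"] forms_uminus[of G N d] by simp

lemma forms_mult: "F \<in> forms R N d \<Longrightarrow> G \<in> forms R N e \<Longrightarrow> F * G \<in> forms R N (d + e)"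
proof -
  assume a: "F \<in> forms R N d" "G \<in> forms R N e"
  have "Poly_Mapping.keys m \<subseteq> {..<N} \<and> mono_degree m = d + e"
    if m: "m \<in> Poly_Mapping.keys (F * G)" for m
  proof -
    obtain k l where "m = k + l" "k \<in> Poly_Mapping.keys F" "l \<in> Poly_Mapping.keys G"
      using m Poly_Mapping.keys_mult[of F G] by blast
    then show ?thesis using a by (auto simp: forms_iff keys_add_nat mono_degree_add)
  qed
  then show ?thesis using a by (auto simp: forms_iff mcoeffs_mult)
qed

lemma forms_const: "c \<in> R \<Longrightarrow> mconst c \<in> forms R N 0"
  unfolding forms_iff by (simp add: mcoeffs_const) (simp add: mconst_def)

lemma forms_1: "1 \<in> forms R N 0"
  using forms_const[of 1] by (simp add: mconst_def)

lemma forms_0: "0 \<in> forms R N d"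
  by (simp add: forms_iff)

lemma forms_var: "i < N \<Longrightarrow> mvar i \<in> forms R N 1"
  unfolding forms_iff by (simp add: mcoeffs_var) (simp add: mvar_def del: One_nat_def)

lemma forms_power: "F \<in> forms R N d \<Longrightarrow> F ^ n \<in> forms R N (n * d)"
  by (induction n) (auto simp: forms_1 intro: forms_mult)

lemma forms_const_mult: "c \<in> R \<Longrightarrow> F \<in> forms R N d \<Longrightarrow> mconst c * F \<in> forms R N d"
  using forms_mult[OF forms_const] by fastforce

lemma forms_mpolys: "F \<in> forms R N d \<Longrightarrow> F \<in> mpolys R N"
  by (simp add: forms_def)

end

lemma coeff_ring_UNIV: "coeff_ring UNIV"
  by unfold_locales auto

section \<open>Partial derivatives\<close>

lemma mderiv_superset:
  assumes "finite S" "Poly_Mapping.keys F \<subseteq> S"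
  shows "mderiv i F = (\<Sum>m\<in>S. Poly_Mapping.single (m - Poly_Mapping.single i 1)
       (of_nat (Poly_Mapping.lookup m i) * Poly_Mapping.lookup F m))"
  unfolding mderiv_def
  by (rule sum.mono_neutral_left) (use assms in \<open>auto simp: in_keys_iff\<close>)

lemma mderiv_single: "mderiv i (Poly_Mapping.single m c) =
   Poly_Mapping.single (m - Poly_Mapping.single i 1) (of_nat (Poly_Mapping.lookup m i) * c)"
  by (subst mderiv_superset[of "{m}"]) auto

lemma mderiv_add: "mderiv i (F + G) = mderiv i F + mderiv i G"
proof -
  let ?S = "Poly_Mapping.keys F \<union> Poly_Mapping.keys G"
  have "Poly_Mapping.keys (F + G) \<subseteq> ?S" by (rule Poly_Mapping.keys_add)
  then show ?thesis
    by (simp add: mderiv_superset[of ?S] lookup_add distrib_left single_add sum.distrib)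
qed

lemma mderiv_0 [simp]: "mderiv i 0 = 0"
  by (simp add: mderiv_def)

lemma mderiv_sum: "mderiv i (sum f I) = (\<Sum>j\<in>I. mderiv i (f j))"
  by (induction I rule: infinite_finite_induct) (auto simp: mderiv_add)

lemma mderiv_uminus: "mderiv i (- F) = - mderiv i (F :: 'a::comm_ring_1 mpoly)"
  using mderiv_add[of i F "- F"] by (simp add: eq_neg_iff_add_eq_0 add.commute)

lemma mderiv_diff: "mderiv i (F - G) = mderiv i F - mderiv i (G :: 'a::comm_ring_1 mpoly)"
  using mderiv_add[of i F "- G"] by (simp add: mderiv_uminus)

text \<open>Subtraction of exponents is truncated at 0, so it passes an addition only where the
  exponent is positive. In the Leibniz rule the other case is harmless, as the factor
  \<open>of_nat 0\<close> removes the term.\<close>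

lemma single_minus_unit_add:
  fixes m n :: "nat \<Rightarrow>\<^sub>0 nat"
  assumes "Poly_Mapping.lookup m i \<noteq> 0"
  shows "m - Poly_Mapping.single i 1 + n = m + n - Poly_Mapping.single i 1"
  using assms by (intro poly_mapping_eqI) (auto simp: lookup_add lookup_minus lookup_single when_def)

lemma mderiv_mult_single:
  fixes c d :: "'a::comm_ring_1"
  shows "mderiv i (Poly_Mapping.single m c * Poly_Mapping.single n d) =
    mderiv i (Poly_Mapping.single m c) * Poly_Mapping.single n d +
    Poly_Mapping.single m c * mderiv i (Poly_Mapping.single n d)"
proof -
  have 1: "mderiv i (Poly_Mapping.single m c) * Poly_Mapping.single n d
     = Poly_Mapping.single (m + n - Poly_Mapping.single i 1) (of_nat (Poly_Mapping.lookup m i) * (c * d))"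
    for m n :: "nat \<Rightarrow>\<^sub>0 nat" and c d :: 'a
    by (cases "Poly_Mapping.lookup m i = 0")
      (simp_all add: mderiv_single mult_single single_minus_unit_add mult.assoc del: One_nat_def)
  have 2: "Poly_Mapping.single m c * mderiv i (Poly_Mapping.single n d)
     = Poly_Mapping.single (m + n - Poly_Mapping.single i 1) (of_nat (Poly_Mapping.lookup n i) * (c * d))"
    using 1[of n d m c] by (simp add: mult.commute add.commute)
  show ?thesis
    unfolding 1 2 by (simp add: mult_single mderiv_single lookup_add distrib_right flip: single_add)
qed

lemma mderiv_mult:
  fixes F G :: "'a::comm_ring_1 mpoly"
  shows "mderiv i (F * G) = mderiv i F * G + F * mderiv i G"
proof -
  let ?f = "\<lambda>F m. Poly_Mapping.single m (Poly_Mapping.lookup F m) :: 'a mpoly"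
  have F: "F = (\<Sum>m\<in>Poly_Mapping.keys F. ?f F m)" and G: "G = (\<Sum>m\<in>Poly_Mapping.keys G. ?f G m)"
    by (rule mpoly_expand)+
  have "mderiv i ((\<Sum>m\<in>S. ?f F m) * (\<Sum>n\<in>T. ?f G n)) =
      mderiv i (\<Sum>m\<in>S. ?f F m) * (\<Sum>n\<in>T. ?f G n) + (\<Sum>m\<in>S. ?f F m) * mderiv i (\<Sum>n\<in>T. ?f G n)" for S T
    by (simp add: sum_product mderiv_sum mderiv_mult_single sum.distrib)
  from this[of "Poly_Mapping.keys F" "Poly_Mapping.keys G"] show ?thesis
    by (simp flip: F G)
qed

lemma mderiv_const [simp]: "mderiv i (mconst c) = 0"
  by (simp add: mconst_def mderiv_single)

lemma mderiv_var: "mderiv i (mvar j :: 'a::comm_ring_1 mpoly) = (if i = j then 1 else 0)"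
  by (auto simp: mvar_def mderiv_single lookup_single)

lemma mderiv_power2: "mderiv i (F ^ 2) = 2 * F * mderiv i (F :: 'a::comm_ring_1 mpoly)"
  by (simp add: power2_eq_square mderiv_mult)

lemma mderiv_power3: "mderiv i (F ^ 3) = 3 * F ^ 2 * mderiv i (F :: 'a::comm_ring_1 mpoly)"
  by (simp add: power3_eq_cube power2_eq_square mderiv_mult algebra_simps)

lemmas mderiv_rules = mderiv_add mderiv_diff mderiv_uminus mderiv_mult mderiv_power2 mderiv_power3
  mderiv_const mderiv_var


section \<open>Functions on a Weierstrass curve\<close>

definition weq :: "'k::comm_ring_1 wcoeffs \<Rightarrow> 'k \<Rightarrow> 'k \<Rightarrow> 'k" where
  "weq a x y = y^2 + a1 a * x * y + a3 a * y - (x^3 + a2 a * x^2 + a4 a * x + a6 a)"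

lemma vec3_simps [simp]: "vec3 x y z 0 = x" "vec3 x y z 1 = y" "vec3 x y z (Suc 0) = y" "vec3 x y z 2 = z"
  by (simp_all add: vec3_def)

lemmas wcoeffs_sel = wcoeffs.map_sel

context coeff_hom
begin

lemma set_wcoeffs_iff: "set_wcoeffs a \<subseteq> R \<longleftrightarrow> a1 a \<in> R \<and> a2 a \<in> R \<and> a3 a \<in> R \<and> a4 a \<in> R \<and> a6 a \<in> R"
  by (cases a) auto

lemma meval_wform:
  assumes "set_wcoeffs a \<subseteq> R"
  shows "meval h p (wform a) = p 1 ^ 2 * p 2 + h (a1 a) * p 0 * p 1 * p 2 + h (a3 a) * p 1 * p 2 ^ 2
     - (p 0 ^ 3 + h (a2 a) * p 0 ^ 2 * p 2 + h (a4 a) * p 0 * p 2 ^ 2 + h (a6 a) * p 2 ^ 3)"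
  using assms unfolding wform_def Let_def set_wcoeffs_iff
  by (simp add: meval_rules mcoeffs_intros)

lemma mcoeffs_numeral: "numeral n \<in> mcoeffs R"
proof -
  have "of_nat k \<in> mcoeffs R" for k by (induction k) (auto intro: mcoeffs_add)
  from this[of "numeral n"] show ?thesis by simp
qed

lemma meval_numeral: "meval h p (numeral n) = numeral n"
proof -
  have c: "of_nat k \<in> mcoeffs R" for k by (induction k) (auto intro: mcoeffs_add)
  have "meval h p (of_nat k) = of_nat k" for k by (induction k) (auto simp: meval_add c)
  from this[of "numeral n"] show ?thesis by simp
qed

lemma meval_mderiv_wform:
  assumes "set_wcoeffs a \<subseteq> R"
  shows "meval h p (mderiv 0 (wform a)) = h (a1 a) * p 1 * p 2
      - (3 * p 0 ^ 2 + 2 * h (a2 a) * p 0 * p 2 + h (a4 a) * p 2 ^ 2)"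
    and "meval h p (mderiv 1 (wform a)) = 2 * p 1 * p 2 + h (a1 a) * p 0 * p 2 + h (a3 a) * p 2 ^ 2"
    and "meval h p (mderiv 2 (wform a)) = p 1 ^ 2 + h (a1 a) * p 0 * p 1 + 2 * h (a3 a) * p 1 * p 2
      - (h (a2 a) * p 0 ^ 2 + 2 * h (a4 a) * p 0 * p 2 + 3 * h (a6 a) * p 2 ^ 2)"
  using assms unfolding wform_def Let_def set_wcoeffs_iff
  by (simp_all add: mderiv_rules meval_rules mcoeffs_intros meval_numeral mcoeffs_numeral algebra_simps)

end

lemma (in field_map) meval_wform_field:
  "meval h p (wform a) = p 1 ^ 2 * p 2 + h (a1 a) * p 0 * p 1 * p 2 + h (a3 a) * p 1 * p 2 ^ 2
     - (p 0 ^ 3 + h (a2 a) * p 0 ^ 2 * p 2 + h (a4 a) * p 0 * p 2 ^ 2 + h (a6 a) * p 2 ^ 3)"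
  by (rule meval_wform) simp

lemma (in field_map) meval_wform_affine: "meval h (vec3 x y 1) (wform a) = weq (map_wcoeffs h a) x y"
  by (simp add: meval_wform_field weq_def wcoeffs_sel)

subsection \<open>Pairs of polynomials\<close>

text \<open>The pair \<open>(A, B)\<close> stands for the function \<open>A(x) + B(x) y\<close>, where \<open>y\<^sup>2 = wq + wp y\<close>.\<close>

definition wp :: "'k::comm_ring_1 wcoeffs \<Rightarrow> 'k poly" where "wp a = [:- a3 a, - a1 a:]"
definition wq :: "'k::comm_ring_1 wcoeffs \<Rightarrow> 'k poly" where "wq a = [:a6 a, a4 a, a2 a, 1:]"
text \<open>The discriminant of y^2 - \<open>wp\<close> y - \<open>wq\<close> as a quadratic in y,
  classically 4 x^3 + b_2 x^2 + 2 b_4 x + b_6. Its roots are the abscissas of the affine points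
  fixed by y -> \<open>wp\<close> - y.\<close>

definition wdisc :: "'k::comm_ring_1 wcoeffs \<Rightarrow> 'k poly" where "wdisc a = wp a ^ 2 + 4 * wq a"

type_synonym 'k pair = "'k poly \<times> 'k poly"

fun pmul :: "'k::comm_ring_1 wcoeffs \<Rightarrow> 'k pair \<Rightarrow> 'k pair \<Rightarrow> 'k pair" where
  "pmul a (A, B) (C, D) = (A * C + B * D * wq a, A * D + B * C + B * D * wp a)"

text \<open>The product of A + B y with its conjugate under y -> \<open>wp\<close> - y, that is, the
  norm to the functions of x.\<close>

fun pnorm :: "'k::comm_ring_1 wcoeffs \<Rightarrow> 'k pair \<Rightarrow> 'k poly" where
  "pnorm a (A, B) = A^2 + A * B * wp a - B^2 * wq a"

fun pval :: "('k::zero \<Rightarrow> 'b::comm_ring_1) \<Rightarrow> 'k pair \<Rightarrow> 'b \<Rightarrow> 'b \<Rightarrow> 'b" where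
  "pval h (A, B) x y = poly (map_poly h A) x + poly (map_poly h B) x * y"

definition ypow :: "'k::comm_ring_1 wcoeffs \<Rightarrow> nat \<Rightarrow> 'k pair" where
  "ypow a n = (pmul a (0, 1) ^^ n) (1, 0)"

text \<open>Normal form of F(x, y, 1): the exponent of z is dropped and powers of y are reduced by
  the curve equation. Being a pair over the base field, it can be evaluated in any
  extension.\<close>

definition wred :: "'k::comm_ring_1 wcoeffs \<Rightarrow> 'k mpoly \<Rightarrow> 'k pair" where
  "wred a F = (\<Sum>m\<in>Poly_Mapping.keys F. smult (Poly_Mapping.lookup F m)
       (monom 1 (Poly_Mapping.lookup m 0) * fst (ypow a (Poly_Mapping.lookup m 1))),
     \<Sum>m\<in>Poly_Mapping.keys F. smult (Poly_Mapping.lookup F m)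
       (monom 1 (Poly_Mapping.lookup m 0) * snd (ypow a (Poly_Mapping.lookup m 1))))"

lemma pnorm_mult: "pnorm a (pmul a P Q) = pnorm a P * pnorm a Q"
  by (cases P; cases Q) (simp add: power2_eq_square algebra_simps)

lemma degree_wdisc:
  fixes a :: "'k::field_char_0 wcoeffs"
  shows "Polynomial.degree (wdisc a) = 3"
  by (simp add: wdisc_def wp_def wq_def power2_eq_square numeral_poly)

lemma four_pnorm: "4 * pnorm a (A, B) = (2 * A + B * wp a) ^ 2 - B ^ 2 * wdisc a"
  by (simp add: wdisc_def power2_eq_square algebra_simps)

text \<open>Parity of degrees: \<open>four_pnorm\<close> writes four times the norm as a square
  minus \<open>B ^ 2\<close> times a cubic, and a nonzero \<open>B\<close> would equate an even
  degree with an odd one.\<close>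

lemma pnorm_eq_0:
  fixes a :: "'k::field_char_0 wcoeffs"
  assumes "pnorm a P = 0"
  shows "P = (0, 0)"
proof -
  obtain A B where P: "P = (A, B)" by force
  have eq: "(2 * A + B * wp a) ^ 2 = B ^ 2 * wdisc a"
    using four_pnorm[of a A B] assms unfolding P by (simp only: mult_zero_right eq_iff_diff_eq_0[of "_ ^ 2"])
  have nz: "wdisc a \<noteq> 0" using degree_wdisc[of a] by auto
  have "B = 0"
  proof (rule ccontr)
    assume B: "B \<noteq> 0"
    have "Polynomial.degree (B ^ 2 * wdisc a) = 2 * Polynomial.degree B + 3"
      using B nz by (simp add: degree_mult_eq degree_power_eq degree_wdisc)
    then have d: "Polynomial.degree ((2 * A + B * wp a) ^ 2) = 2 * Polynomial.degree B + 3"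
      by (simp only: eq)
    then have "2 * A + B * wp a \<noteq> 0" by auto
    then have "Polynomial.degree ((2 * A + B * wp a) ^ 2) = 2 * Polynomial.degree (2 * A + B * wp a)"
      by (simp add: degree_power_eq)
    with d have "2 * Polynomial.degree (2 * A + B * wp a) = 2 * Polynomial.degree B + 3" by simp
    then show False by presburger
  qed
  then show ?thesis using eq P by simp
qed

lemma weq_pw:
  fixes x y :: "'b::comm_ring_1"
  shows "weq a x y = 0 \<longleftrightarrow> y^2 = poly (wq a) x + poly (wp a) x * y"
  by (simp add: weq_def wp_def wq_def power2_eq_square power3_eq_cube algebra_simps)

context field_map
begin

lemma map_poly_wp: "map_poly h (wp a) = wp (map_wcoeffs h a)"
  and map_poly_wq: "map_poly h (wq a) = wq (map_wcoeffs h a)"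
  by (simp_all add: wp_def wq_def wcoeffs_sel)

lemma pval_pmul:
  assumes "weq (map_wcoeffs h a) x y = 0"
  shows "pval h (pmul a P Q) x y = pval h P x y * pval h Q x y"
proof -
  obtain A B C D where P: "P = (A, B)" "Q = (C, D)" by (cases P; cases Q)
  have y: "y^2 = poly (wq (map_wcoeffs h a)) x + poly (wp (map_wcoeffs h a)) x * y"
    using assms weq_pw by blast
  have "(poly (map_poly h A) x + poly (map_poly h B) x * y) * (poly (map_poly h C) x + poly (map_poly h D) x * y)
     = poly (map_poly h A) x * poly (map_poly h C) x + (poly (map_poly h A) x * poly (map_poly h D) x
       + poly (map_poly h B) x * poly (map_poly h C) x) * y + poly (map_poly h B) x * poly (map_poly h D) x
       * (poly (wq (map_wcoeffs h a)) x + poly (wp (map_wcoeffs h a)) x * y)"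
    by (simp only: y[symmetric]) (simp add: algebra_simps power2_eq_square)
  then show ?thesis
    by (simp add: P map_poly_wp map_poly_wq algebra_simps)
qed

lemma pval_ypow:
  assumes "weq (map_wcoeffs h a) x y = 0"
  shows "pval h (ypow a n) x y = y ^ n"
  by (induction n) (simp_all add: ypow_def pval_pmul[OF assms])

lemma map_poly_h_sum: "map_poly h (sum f I) = (\<Sum>i\<in>I. map_poly h (f i))"
  by (induction I rule: infinite_finite_induct) auto

lemma map_poly_h_smult: "map_poly h (smult c A) = smult (h c) (map_poly h A)"
  by (rule poly_eqI) (simp add: coeff_map_poly)

lemma map_poly_h_monom: "map_poly h (monom c n) = monom (h c) n"
  by (rule poly_eqI) (simp add: coeff_map_poly coeff_monom)

lemma meval_affine:
  assumes w: "weq (map_wcoeffs h a) x y = 0" and F: "F \<in> mpolys UNIV 3"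
  shows "meval h (vec3 x y 1) F = pval h (wred a F) x y"
proof -
  have m: "mono_eval (vec3 x y 1) m = x ^ Poly_Mapping.lookup m 0 * pval h (ypow a (Poly_Mapping.lookup m 1)) x y"
    if "m \<in> Poly_Mapping.keys F" for m
  proof -
    have "Poly_Mapping.keys m \<subseteq> {..<3}" using F that by (auto simp: mpolys_def)
    then have "mono_eval (vec3 x y 1) m = (\<Prod>i<3. vec3 x y 1 i ^ Poly_Mapping.lookup m i)"
      by (intro mono_eval_superset) auto
    also have "{..<3::nat} = {0, 1, 2}" by auto
    finally show ?thesis by (simp add: pval_ypow[OF w])
  qed
  have "meval h (vec3 x y 1) F = (\<Sum>m\<in>Poly_Mapping.keys F. h (Poly_Mapping.lookup F m) *
     (x ^ Poly_Mapping.lookup m 0 * pval h (ypow a (Poly_Mapping.lookup m 1)) x y))"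
    by (simp add: meval_superset[OF finite_keys subset_refl] m cong: sum.cong)
  also have "\<dots> = (\<Sum>m\<in>Poly_Mapping.keys F.
     poly (map_poly h (smult (Poly_Mapping.lookup F m)
       (monom 1 (Poly_Mapping.lookup m 0) * fst (ypow a (Poly_Mapping.lookup m 1))))) x
     + poly (map_poly h (smult (Poly_Mapping.lookup F m)
       (monom 1 (Poly_Mapping.lookup m 0) * snd (ypow a (Poly_Mapping.lookup m 1))))) x * y)"
    by (intro sum.cong refl, rename_tac m, case_tac "ypow a (Poly_Mapping.lookup m 1)")
      (simp add: map_poly_h_smult map_poly_h_monom poly_monom algebra_simps)
  also have "\<dots> = pval h (wred a F) x y"
    by (simp add: wred_def map_poly_h_sum poly_sum sum.distrib sum_distrib_right)
  finally show ?thesis .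
qed

end

subsection \<open>Generic points\<close>

lemma poly_ffc_t: "poly (map_poly ffc_const A) ffc_t = to_ac (Fract A 1)"
proof -
  interpret c: field_map "ffc_const :: 'a \<Rightarrow> 'a ffc" by (rule field_map_ffc_const)
  show ?thesis
  proof (induction A)
    case 0
    then show ?case by (simp add: fract_collapse)
  next
    case (pCons c A)
    have "to_ac (Fract (pCons c A) 1) = to_ac (Fract [:c:] 1 + Fract [:0, 1:] 1 * Fract A 1)"
      by simp
    also have "\<dots> = poly (map_poly ffc_const (pCons c A)) ffc_t"
      using pCons.IH by (simp only: to_ac_add to_ac_mult c.map_poly_h_pCons poly_pCons)
        (simp add: ffc_const_def ffc_t_def)
    finally show ?case by simp
  qed
qed

text \<open>Genericity as independence of 1 and y over the polynomials in x. Unlike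
  \<open>wgeneric\<close>, this notion is not tied to the choice x = t, so it survives a change of
  Weierstrass coordinates.\<close>

definition generic_xy :: "'k::field wcoeffs \<Rightarrow> 'k ffc \<Rightarrow> 'k ffc \<Rightarrow> bool" where
  "generic_xy a x y \<longleftrightarrow> weq (map_wcoeffs ffc_const a) x y = 0 \<and>
     (\<forall>P. pval ffc_const P x y = 0 \<longrightarrow> P = (0, 0))"

lemma weq_root_exists:
  fixes a :: "'k::alg_closed_field wcoeffs"
  shows "\<exists>y. weq a x y = 0"
proof -
  have "\<exists>y. poly [:- (x^3 + a2 a * x^2 + a4 a * x + a6 a), a1 a * x + a3 a, 1:] y = 0"
    by (rule alg_closed_imp_poly_has_root) simp
  then obtain y where "poly [:- (x^3 + a2 a * x^2 + a4 a * x + a6 a), a1 a * x + a3 a, 1:] y = 0" ..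
  then have "weq a x y = 0" by (simp add: weq_def algebra_simps power2_eq_square)
  then show ?thesis ..
qed

lemma wgeneric_simps: "wgeneric a 0 = ffc_t" "wgeneric a 2 = 1"
  by (simp_all add: wgeneric_def)

lemma wgeneric_vec3: "wgeneric a = vec3 ffc_t (wgeneric a 1) 1"
  by (simp add: wgeneric_def)

lemma weq_wgeneric: "weq (map_wcoeffs ffc_const a) ffc_t (wgeneric a 1) = 0"
proof -
  interpret c: field_map "ffc_const :: 'a \<Rightarrow> 'a ffc" by (rule field_map_ffc_const)
  show ?thesis
    unfolding wgeneric_def vec3_simps c.meval_wform_affine
    by (rule someI_ex) (rule weq_root_exists)
qed

text \<open>Multiplying by the conjugate turns a vanishing pair into its norm, a polynomial
  evaluated at the transcendental t; so the norm is zero, and with it the pair.\<close>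

lemma generic_wgeneric:
  fixes a :: "'k::field_char_0 wcoeffs"
  shows "generic_xy a ffc_t (wgeneric a 1)"
proof -
  interpret c: field_map "ffc_const :: 'k \<Rightarrow> 'k ffc" by (rule field_map_ffc_const)
  let ?y = "wgeneric a 1"
  have "P = (0, 0)" if P: "pval ffc_const P ffc_t ?y = 0" for P
  proof -
    obtain A B where AB: "P = (A, B)" by force
    have "pmul a P (A + B * wp a, - B) = (pnorm a P, 0)"
      by (simp add: AB power2_eq_square algebra_simps)
    then have "pval ffc_const (pnorm a P, 0) ffc_t ?y = 0"
      using c.pval_pmul[OF weq_wgeneric[of a], of P "(A + B * wp a, - B)"] P by simp
    then have "to_ac (Fract (pnorm a P) 1) = 0" by (simp add: poly_ffc_t)
    then have "pnorm a P = 0" by (simp add: Zero_fract_def eq_fract)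
    then show ?thesis by (rule pnorm_eq_0)
  qed
  then show ?thesis using weq_wgeneric by (auto simp: generic_xy_def)
qed


section \<open>Local rings\<close>

text \<open>A local ring \<open>A\<close> with maximal ideal \<open>M\<close> inside a field. Orders
  are treated at this level, away from forms and points; \<open>unif\<close> and the description in
  \<open>ord_eqI\<close> are the abstract shapes of \<open>uniformizer\<close> and
  \<open>ord_at\<close>.\<close>

locale local_pair =
  fixes A M :: "'a::field set"
  assumes A_1 [simp]: "1 \<in> A"
    and A_add: "f \<in> A \<Longrightarrow> g \<in> A \<Longrightarrow> f + g \<in> A"
    and A_mult: "f \<in> A \<Longrightarrow> g \<in> A \<Longrightarrow> f * g \<in> A"
    and M_A: "f \<in> M \<Longrightarrow> f \<in> A"
    and M_0 [simp]: "0 \<in> M"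
    and M_add: "f \<in> M \<Longrightarrow> g \<in> M \<Longrightarrow> f + g \<in> M"
    and M_mult: "f \<in> A \<Longrightarrow> g \<in> M \<Longrightarrow> f * g \<in> M"
    and M_uminus: "f \<in> M \<Longrightarrow> - f \<in> M"
    and one_notin_M: "1 \<notin> M"
    and A_inverse: "f \<in> A \<Longrightarrow> f \<notin> M \<Longrightarrow> inverse f \<in> A"
begin

definition units where "units = A - M"

lemma units_nonzero: "u \<in> units \<Longrightarrow> u \<noteq> 0"
  by (auto simp: units_def)

lemma unitsI: "u \<noteq> 0 \<Longrightarrow> u \<in> A \<Longrightarrow> inverse u \<in> A \<Longrightarrow> u \<in> units"
  using M_mult[of "inverse u" u] one_notin_M by (auto simp: units_def)

lemma units_inverse: "u \<in> units \<Longrightarrow> inverse u \<in> units"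
  using units_nonzero[of u] by (intro unitsI) (auto simp: units_def A_inverse)

lemma units_mult: "u \<in> units \<Longrightarrow> v \<in> units \<Longrightarrow> u * v \<in> units"
  using units_nonzero units_inverse[of u] units_inverse[of v]
  by (intro unitsI) (auto simp: units_def intro: A_mult)

lemma units_1 [simp]: "1 \<in> units"
  by (simp add: units_def one_notin_M)

lemma units_divide: "u \<in> units \<Longrightarrow> v \<in> units \<Longrightarrow> u / v \<in> units"
  by (simp add: divide_inverse units_mult units_inverse)

lemma units_power: "u \<in> units \<Longrightarrow> u ^ n \<in> units"
  by (induction n) (auto intro: units_mult)

lemma units_powi: "u \<in> units \<Longrightarrow> u powi n \<in> units"
  by (simp add: power_int_def units_power units_inverse)

lemma M_diff: "f \<in> M \<Longrightarrow> g \<in> M \<Longrightarrow> f - g \<in> M"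
  using M_add[of f "- g"] M_uminus[of g] by simp

lemma A_0 [simp]: "0 \<in> A"
  by (simp add: M_A)


lemma M_power: "f \<in> M \<Longrightarrow> n > 0 \<Longrightarrow> f ^ n \<in> M"
proof (induction n)
  case (Suc n)
  then show ?case using M_mult[of f "f ^ n"] M_A by (cases n) auto
qed simp

lemma units_add_M: "u \<in> units \<Longrightarrow> f \<in> M \<Longrightarrow> u + f \<in> units"
  using M_diff[of "u + f" f] by (auto simp: units_def intro: A_add M_A)

definition unif where "unif \<pi> \<longleftrightarrow> \<pi> \<in> M \<and> (\<forall>s\<in>M. \<exists>r\<in>A. s = r * \<pi>)"

lemma powi_units_eq_0:
  assumes "\<pi> \<in> M" "\<pi> powi k \<in> units"
  shows "k = 0"
proof (rule ccontr)
  assume "k \<noteq> 0"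
  then obtain n where n: "n > 0" "\<pi> powi k = \<pi> ^ n \<or> \<pi> powi k = inverse (\<pi> ^ n)"
    by (cases "k > 0") (auto simp: power_int_def power_inverse intro: that[of "nat \<bar>k\<bar>"])
  then have "\<pi> ^ n \<in> units" using assms(2) units_inverse by force
  moreover have "\<pi> ^ n \<in> M" using M_power assms(1) n by blast
  ultimately show False by (simp add: units_def)
qed

text \<open>\<open>ord_at\<close> quantifies over the uniformizer too, so two of them must be
  compared. Each divides the other, so their ratio is a unit; what remains is a power of \<pi> that
  is a unit, whose exponent is 0.\<close>

lemma unif_exponent_unique:
  assumes "unif \<pi>" "unif \<rho>" "\<pi> \<noteq> 0" "u \<in> units" "v \<in> units"
    and eq: "\<pi> powi m * u = \<rho> powi n * v"
  shows "m = n"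
proof -
  have "\<rho> \<in> M" "\<pi> \<in> M" using assms(1,2) by (auto simp: unif_def)
  then obtain r r' where r: "r \<in> A" "\<rho> = r * \<pi>" "r' \<in> A" "\<pi> = r' * \<rho>"
    using assms(1,2) unfolding unif_def by metis
  have "1 * \<pi> = (r' * r) * \<pi>" using r(2,4) by (simp only: mult.assoc mult_1_left)
  then have 1: "1 = r' * r" using assms(3) by (simp only: mult_cancel_right) simp
  then have "r \<noteq> 0" by auto
  moreover have "inverse r = r'" using 1 by (metis inverse_unique mult.commute)
  ultimately have ru: "r \<in> units" using r(1,3) by (intro unitsI) auto
  have "\<pi> powi m * u = (r * \<pi>) powi n * v"
    using eq unfolding r(2) .
  then have e: "\<pi> powi m * u = r powi n * \<pi> powi n * v"
    by (simp only: power_int_mult_distrib)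
  have nz: "\<pi> powi n \<noteq> 0" "u \<noteq> 0" using assms(3) units_nonzero[OF assms(4)] by auto
  have "\<pi> powi (m - n) = (\<pi> powi m * u) / (\<pi> powi n * u)"
    using assms(3) nz by (simp add: power_int_diff)
  also have "\<dots> = r powi n * v / u"
    unfolding e using nz by (simp add: divide_simps assms(3))
  finally have "\<pi> powi (m - n) = r powi n * v / u" .
  then have "\<pi> powi (m - n) \<in> units"
    using ru assms(4,5) by (simp add: units_divide units_mult units_powi)
  then have "m - n = 0" by (rule powi_units_eq_0[OF \<open>\<pi> \<in> M\<close>])
  then show ?thesis by simp
qed

lemma ord_eqI:
  assumes "unif \<pi>" "\<pi> \<noteq> 0" "u \<in> units" "f = \<pi> powi n * u"
  shows "(THE n. \<exists>\<pi> u. unif \<pi> \<and> u \<noteq> 0 \<and> u \<in> A \<and> inverse u \<in> A \<and> f = \<pi> powi n * u) = n"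
proof (rule the_equality)
  show "\<exists>\<pi> u. unif \<pi> \<and> u \<noteq> 0 \<and> u \<in> A \<and> inverse u \<in> A \<and> f = \<pi> powi n * u"
    using assms(1,3,4) units_inverse[OF assms(3)] units_nonzero[OF assms(3)]
    by (intro exI[of _ \<pi>] exI[of _ u]) (simp add: units_def)
next
  fix m assume "\<exists>\<pi> u. unif \<pi> \<and> u \<noteq> 0 \<and> u \<in> A \<and> inverse u \<in> A \<and> f = \<pi> powi m * u"
  then obtain \<rho> v where r': "unif \<rho>" "v \<noteq> 0" "v \<in> A" "inverse v \<in> A" "f = \<rho> powi m * v"
    by (elim exE conjE)
  have r: "unif \<rho>" "v \<in> units" "f = \<rho> powi m * v" using r' unitsI[OF r'(2-4)] by blast+
  show "m = n"
    by (rule unif_exponent_unique[OF assms(1) r(1) assms(2,3) r(2), symmetric])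
      (rule r(3)[unfolded assms(4)])
qed

text \<open>In an expansion of an element f of \<open>M\<close> the exponent n is positive, since
  otherwise u = \<pi>^(-n) f would be a unit lying in \<open>M\<close>. Hence one factor \<pi>
  splits off.\<close>

lemma unifI:
  assumes p: "\<pi> \<in> M" "\<pi> \<noteq> 0" and s: "\<And>s. s \<in> M \<Longrightarrow> s \<noteq> 0 \<Longrightarrow> \<exists>n. \<exists>u\<in>units. s = \<pi> powi n * u"
  shows "unif \<pi>"
  unfolding unif_def
proof (intro conjI ballI p)
  fix f assume f: "f \<in> M"
  show "\<exists>r\<in>A. f = r * \<pi>"
  proof (cases "f = 0")
    case False
    then obtain n u where u: "u \<in> units" "f = \<pi> powi n * u" using s f by blast
    have "n > 0"
    proof (rule ccontr)
      assume "\<not> n > 0"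
      then have "f = inverse (\<pi> ^ nat (- n)) * u" using u by (auto simp: power_int_def power_inverse)
      then have "u = \<pi> ^ nat (- n) * f" using p by simp
      moreover have "\<pi> ^ k \<in> A" for k using p(1) by (induction k) (auto intro: A_mult M_A)
      ultimately show False using u(1) f by (auto simp: units_def intro: M_mult)
    qed
    then have "f = (\<pi> ^ (nat n - 1) * u) * \<pi>"
      using u power_minus_mult[of "nat n" \<pi>] by (simp add: power_int_def ac_simps)
    moreover have "\<pi> ^ k \<in> A" for k using p(1) by (induction k) (auto intro: A_mult M_A)
    ultimately show ?thesis using u(1) by (auto simp: units_def intro: A_mult)
  qed (auto intro: bexI[of _ 0])
qed

lemma powi_sum:
  assumes "\<pi> \<in> M" "\<pi> \<noteq> 0" "u \<in> units" "v \<in> units" "i < j"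
  shows "\<exists>w\<in>units. \<pi> powi i * u + \<pi> powi j * v = \<pi> powi i * w"
proof
  have "\<pi> powi j = \<pi> powi i * \<pi> ^ nat (j - i)"
    using assms(2,5) power_int_add[of \<pi> i "j - i"] by (simp add: power_int_def)
  then show "\<pi> powi i * u + \<pi> powi j * v = \<pi> powi i * (u + v * \<pi> ^ nat (j - i))"
    by (simp add: algebra_simps)
  show "u + v * \<pi> ^ nat (j - i) \<in> units"
    using assms by (intro units_add_M M_mult M_power) (auto simp: units_def)
qed

text \<open>The common mechanism at points where functions of \<open>x\<close> have even order and \<open>s\<close> has odd
  order, so that there is no cancellation in \<open>A(x) + B(x) s\<close>.\<close>

lemma odd_even_expansion:
  assumes p: "\<pi> \<in> M" "\<pi> \<noteq> 0" and uv: "u \<in> units" "v \<in> units"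
    and eo: "even i" "odd j"
  shows "\<exists>w\<in>units. \<pi> powi i * u + \<pi> powi j * v = \<pi> powi (min i j) * w"
proof (cases "i < j")
  case True
  then show ?thesis using powi_sum[OF p uv] by simp
next
  case False
  then have "j < i" using eo by (metis linorder_neqE)
  then show ?thesis using powi_sum[OF p uv(2,1), of j i] by (simp add: add.commute)
qed

end

section \<open>Weights of the powers of y, and forms at infinity\<close>

lemma field_map_id: "field_map (id :: 'k::field \<Rightarrow> 'k)"
  by unfold_locales auto

lemma map_wcoeffs_id [simp]: "map_wcoeffs id a = a"
  by (simp add: wcoeffs.map_id)

lemma Aff_in_wpoints: "Aff x y \<in> wpoints a \<longleftrightarrow> weq a x y = 0"
proof -
  interpret i: field_map "id :: 'a \<Rightarrow> 'a" by (rule field_map_id)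
  show ?thesis by (simp add: wpoints_def i.meval_wform_affine)
qed

lemma Infty_in_wpoints: "Infty \<in> wpoints a"
proof -
  interpret i: field_map "id :: 'a \<Rightarrow> 'a" by (rule field_map_id)
  show ?thesis by (simp add: wpoints_def i.meval_wform_field)
qed

lemma ypow_Suc: "ypow a (Suc n) = (snd (ypow a n) * wq a, fst (ypow a n) + snd (ypow a n) * wp a)"
  by (cases "ypow a n") (simp add: ypow_def)

lemma degree_wp: "Polynomial.degree (wp a) \<le> 1"
  by (simp add: wp_def)

lemma degree_wq: "Polynomial.degree (wq a) = 3" "Polynomial.lead_coeff (wq a) = 1" "wq a \<noteq> 0"
  for a :: "'k::field wcoeffs"
  by (simp_all add: wq_def)

text \<open>Give x weight 2 and y weight 3. Then y^(2k) has leading term x^(3k) and y^(2k+1) has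
  leading term x^(3k) y, both with coefficient 1, and all other terms have smaller weight. Even and
  odd exponents imply each other alternately, hence the joint statement.\<close>

lemma ypow_bounds:
  fixes a :: "'k::field wcoeffs"
  shows "Polynomial.degree (fst (ypow a (2*k))) \<le> 3*k \<and> coeff (fst (ypow a (2*k))) (3*k) = 1 \<and>
    (snd (ypow a (2*k)) = 0 \<or> Polynomial.degree (snd (ypow a (2*k))) + 2 \<le> 3*k) \<and>
    Polynomial.degree (fst (ypow a (2*k+1))) \<le> 3*k+1 \<and>
    Polynomial.degree (snd (ypow a (2*k+1))) \<le> 3*k \<and> coeff (snd (ypow a (2*k+1))) (3*k) = 1"
    (is "?P k \<and> ?Q k \<and> ?S k \<and> ?T k \<and> ?U k \<and> ?V k")
proof -
  have step: "?T k \<and> ?U k \<and> ?V k" if h: "?P k" "?Q k" "?S k" for k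
  proof -
    let ?A = "fst (ypow a (2*k))" and ?B = "snd (ypow a (2*k))"
    have e: "fst (ypow a (2*k+1)) = ?B * wq a" "snd (ypow a (2*k+1)) = ?A + ?B * wp a"
      using ypow_Suc[of a "2*k"] by simp_all
    have d: "Polynomial.degree (?B * wq a) \<le> 3*k+1"
      using h(3) degree_mult_le[of ?B "wq a"] by (auto simp: degree_wq)
    have 2: "?B * wp a = 0 \<or> Polynomial.degree (?B * wp a) < 3*k"
      using h(3) degree_mult_le[of ?B "wp a"] degree_wp[of a] by auto
    then have "coeff (?B * wp a) (3*k) = 0" by (auto intro: coeff_eq_0)
    then show ?thesis
      unfolding e using d 2 h by (auto intro!: degree_add_le)
  qed
  have "?P k \<and> ?Q k \<and> ?S k"
  proof (induction k)
    case 0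
    then show ?case by (simp add: ypow_def)
  next
    case (Suc k)
    have h: "?T k" "?U k" "?V k" using step Suc by blast+
    let ?A = "fst (ypow a (2*k+1))" and ?B = "snd (ypow a (2*k+1))"
    have e: "fst (ypow a (2 * Suc k)) = ?B * wq a" "snd (ypow a (2 * Suc k)) = ?A + ?B * wp a"
      using ypow_Suc[of a "2*k+1"] by simp_all
    have d: "Polynomial.degree ?B = 3*k" using h(2,3) by (metis le_antisym le_degree zero_neq_one)
    have nz: "?B \<noteq> 0" using h(3) by auto
    have dd: "Polynomial.degree (?B * wq a) = 3 * Suc k" using nz d by (simp add: degree_mult_eq degree_wq)
    have "coeff (?B * wq a) (3 * Suc k) = 1"
      using lead_coeff_mult[of ?B "wq a"] unfolding dd degree_wq(2) d h(3) by (simp only: mult_1_left)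
    moreover have "Polynomial.degree (?A + ?B * wp a) + 2 \<le> 3 * Suc k"
    proof -
      have "Polynomial.degree (?B * wp a) \<le> 3*k+1"
        using degree_mult_le[of ?B "wp a"] degree_wp[of a] d by simp
      then have "Polynomial.degree (?A + ?B * wp a) \<le> 3*k+1" using h(1) by (intro degree_add_le)
      then show ?thesis by simp
    qed
    ultimately show ?case unfolding e using dd by simp
  qed
  then show ?thesis using step by blast
qed

lemma ypow_weight:
  fixes a :: "'k::field wcoeffs"
  shows "coeff (fst (ypow a n)) i \<noteq> 0 \<Longrightarrow> 2*i \<le> 3*n"
    and "coeff (snd (ypow a n)) i \<noteq> 0 \<Longrightarrow> 2*i + 3 \<le> 3*n"
proof -
  obtain k where k: "n = 2*k \<or> n = 2*k+1" by (metis oddE evenE)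
  note b = ypow_bounds[of a k]
  { assume c: "coeff (fst (ypow a n)) i \<noteq> 0"
    then have "i \<le> Polynomial.degree (fst (ypow a n))" by (rule le_degree)
    then show "2*i \<le> 3*n" using k b by auto }
  { assume c: "coeff (snd (ypow a n)) i \<noteq> 0"
    then have "i \<le> Polynomial.degree (snd (ypow a n))" by (rule le_degree)
    then show "2*i + 3 \<le> 3*n" using k b c by auto }
qed

text \<open>Among the monomials of degree d only y^d reaches the weight 3d, so its coefficient in F
  is the top coefficient of the reduced pair: in the first component for even d, in the second for
  odd d.\<close>

lemma form_vanish_Infty:
  fixes a :: "'k::field wcoeffs"
  assumes F: "F \<in> forms UNIV 3 d" and r: "wred a F = (0, 0)"
  shows "meval id (vec3 0 1 0) F = 0"
proof -
  interpret i: field_map "id :: 'k \<Rightarrow> 'k" by (rule field_map_id)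
  let ?L = "Poly_Mapping.lookup" and ?K = "Poly_Mapping.keys F"
  \<comment> \<open>The exponent vector of y^d, the only monomial of degree d that does not vanish
    at (0 : 1 : 0).\<close>
  define t where "t = Poly_Mapping.single (1::nat) d"
  have m3: "Poly_Mapping.keys m \<subseteq> {0,1,2}" "?L m 0 + ?L m 1 + ?L m 2 = d" if "m \<in> ?K" for m
  proof -
    have k: "Poly_Mapping.keys m \<subseteq> {..<3}" "mono_degree m = d" using F that by (auto simp: i.forms_iff)
    moreover have "{..<3::nat} = {0,1,2}" by auto
    ultimately show "Poly_Mapping.keys m \<subseteq> {0,1,2}" by simp
    then show "?L m 0 + ?L m 1 + ?L m 2 = d"
      using k mono_degree_superset[of "{0,1,2}" m] by simp
  qed
  have tI: "m = t" if "m \<in> ?K" "?L m 1 = d" for m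
  proof (rule poly_mapping_eqI)
    fix i
    have "?L m 0 = 0" "?L m 2 = 0" using m3(2)[OF that(1)] that(2) by auto
    then show "?L m i = ?L t i"
      using m3(1)[OF that(1)] that(2) by (cases "i \<in> {0,1,2}") (auto simp: t_def lookup_single in_keys_iff)
  qed
  have v: "mono_eval (vec3 0 1 0) m = (if m = t then 1 else (0::'k))" if m: "m \<in> ?K" for m
  proof -
    have "mono_eval (vec3 0 1 (0::'k)) m = 0 ^ ?L m 0 * 0 ^ ?L m 2"
      using mono_eval_superset[of "{0,1,2}" m "vec3 0 1 0"] m3(1)[OF m] by simp
    moreover have "m = t \<longleftrightarrow> ?L m 0 = 0 \<and> ?L m 2 = 0"
    proof
      assume e: "m = t"
      show "?L m 0 = 0 \<and> ?L m 2 = 0" unfolding e by (simp add: t_def lookup_single)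
    next
      assume "?L m 0 = 0 \<and> ?L m 2 = 0"
      then have "?L m 1 = d" using m3(2)[OF m] by linarith
      then show "m = t" by (rule tI[OF m])
    qed
    ultimately show ?thesis by (simp add: zero_power_eq)
  qed
  have "meval id (vec3 0 1 0) F = (\<Sum>m\<in>?K. if m = t then ?L F m else 0)"
    by (subst i.meval_superset[OF finite_keys subset_refl], intro sum.cong) (simp_all add: v)
  then have ev: "meval id (vec3 0 1 0) F = ?L F t" by (simp add: in_keys_iff)
  obtain k where k: "d = 2*k \<or> d = 2*k+1" by (metis oddE evenE)
  have shift: "coeff (smult c (monom 1 i * A)) n = (if i \<le> n then c * coeff A (n - i) else 0)" for c :: 'k and i A n
    by (simp add: coeff_monom_mult)
  show ?thesis
  proof (cases "d = 2*k")
    case True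
    have "coeff (smult (?L F m) (monom 1 (?L m 0) * fst (ypow a (?L m 1)))) (3*k) = (if m = t then ?L F m else 0)"
      if m: "m \<in> ?K" for m
    proof (cases "m = t")
      case True
      show ?thesis unfolding shift \<open>m = t\<close> using \<open>d = 2*k\<close> ypow_bounds[of a k] by (simp add: t_def lookup_single)
    next
      case False
      then have "?L m 1 \<noteq> d" using tI m by blast
      then have "\<not> 2 * (3*k - ?L m 0) \<le> 3 * ?L m 1" if "?L m 0 \<le> 3*k"
        using m3(2)[OF m] that \<open>d = 2*k\<close> by linarith
      then show ?thesis using False ypow_weight(1)[of a "?L m 1" "3*k - ?L m 0"] unfolding shift by auto
    qed
    then have "coeff (fst (wred a F)) (3*k) = (\<Sum>m\<in>?K. if m = t then ?L F m else 0)"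
      by (simp add: wred_def coeff_sum)
    then show ?thesis using r by (simp add: in_keys_iff ev split: if_splits)
  next
    case False
    then have d: "d = 2*k+1" using k by simp
    have "coeff (smult (?L F m) (monom 1 (?L m 0) * snd (ypow a (?L m 1)))) (3*k) = (if m = t then ?L F m else 0)"
      if m: "m \<in> ?K" for m
    proof (cases "m = t")
      case True
      show ?thesis unfolding shift \<open>m = t\<close> using d ypow_bounds[of a k] by (simp add: t_def lookup_single)
    next
      case False
      then have "?L m 1 \<noteq> d" using tI m by blast
      then have "\<not> 2 * (3*k - ?L m 0) + 3 \<le> 3 * ?L m 1" if "?L m 0 \<le> 3*k"
        using m3(2)[OF m] that d by linarith
      then show ?thesis using False ypow_weight(2)[of a "?L m 1" "3*k - ?L m 0"] unfolding shift by auto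
    qed
    then have "coeff (snd (wred a F)) (3*k) = (\<Sum>m\<in>?K. if m = t then ?L F m else 0)"
      by (simp add: wred_def coeff_sum)
    then show ?thesis using r by (simp add: in_keys_iff ev split: if_splits)
  qed
qed

lemma meval_wgeneric:
  fixes a :: "'k::field wcoeffs"
  assumes "F \<in> mpolys UNIV 3"
  shows "meval ffc_const (wgeneric a) F = pval ffc_const (wred a F) ffc_t (wgeneric a 1)"
proof -
  interpret c: field_map "ffc_const :: 'k \<Rightarrow> 'k ffc" by (rule field_map_ffc_const)
  show ?thesis by (subst wgeneric_vec3) (rule c.meval_affine[OF weq_wgeneric assms])
qed

text \<open>Links values at a point with values at the generic point: a form that is nonzero at P is
  nonzero as a function, so the fractions in \<open>local_ring\<close> have honest
  denominators.\<close>

lemma form_vanish: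
  fixes a :: "'k::field_char_0 wcoeffs"
  assumes F: "F \<in> forms UNIV 3 d" and z: "meval ffc_const (wgeneric a) F = 0" and P: "P \<in> wpoints a"
  shows "meval id (pcoords P) F = 0"
proof -
  interpret i: field_map "id :: 'k \<Rightarrow> 'k" by (rule field_map_id)
  have m: "F \<in> mpolys UNIV 3" using F by (simp add: forms_def)
  have r: "wred a F = (0, 0)"
    using z generic_wgeneric[of a] unfolding meval_wgeneric[OF m] generic_xy_def by blast
  show ?thesis
  proof (cases P)
    case Infty
    then show ?thesis using form_vanish_Infty[OF F r] by simp
  next
    case (Aff x y)
    then show ?thesis using P i.meval_affine[of a x y F] m r by (simp add: Aff_in_wpoints)
  qed
qed

section \<open>The local ring of a point of the curve\<close>

locale curve_point =
  fixes a :: "'k::field_char_0 wcoeffs" and P :: "'k wpoint"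
  assumes P: "P \<in> wpoints a"
begin

sublocale c: field_map "ffc_const :: 'k \<Rightarrow> 'k ffc" by (rule field_map_ffc_const)
sublocale i: field_map "id :: 'k \<Rightarrow> 'k" by (rule field_map_id)

abbreviation gval where "gval F \<equiv> meval ffc_const (wgeneric a) F"
abbreviation at_P where "at_P F \<equiv> meval id (pcoords P) F"

lemma gval_nonzero: "F \<in> forms UNIV 3 d \<Longrightarrow> at_P F \<noteq> 0 \<Longrightarrow> gval F \<noteq> 0"
  using form_vanish P by blast

lemma local_ringI: "F \<in> forms UNIV 3 d \<Longrightarrow> G \<in> forms UNIV 3 d \<Longrightarrow> at_P G \<noteq> 0 \<Longrightarrow>
   gval F / gval G \<in> local_ring a P"
  unfolding local_ring_def ratfun_def by blast

lemma local_max_idealI: "F \<in> forms UNIV 3 d \<Longrightarrow> G \<in> forms UNIV 3 d \<Longrightarrow> at_P F = 0 \<Longrightarrow> at_P G \<noteq> 0 \<Longrightarrow>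
   gval F / gval G \<in> local_max_ideal a P"
  unfolding local_max_ideal_def ratfun_def by blast

lemma local_ringE:
  assumes "f \<in> local_ring a P"
  obtains F G d where "F \<in> forms UNIV 3 d" "G \<in> forms UNIV 3 d" "at_P G \<noteq> 0" "gval G \<noteq> 0" "f = gval F / gval G"
  using assms gval_nonzero unfolding local_ring_def ratfun_def by blast

lemma local_max_idealE:
  assumes "f \<in> local_max_ideal a P"
  obtains F G d where "F \<in> forms UNIV 3 d" "G \<in> forms UNIV 3 d" "at_P F = 0" "at_P G \<noteq> 0" "gval G \<noteq> 0" "f = gval F / gval G"
  using assms gval_nonzero unfolding local_max_ideal_def ratfun_def by blast

sublocale lp: local_pair "local_ring a P" "local_max_ideal a P"
proof
  show "1 \<in> local_ring a P"
    using local_ringI[OF c.forms_1 c.forms_1] by simp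
  show "0 \<in> local_max_ideal a P"
    using local_max_idealI[OF c.forms_0 c.forms_1] by simp
  \<comment> \<open>If 1 = F / G as functions, then G - F vanishes on the curve and hence at P,
    where F is zero and G is not.\<close>
  show "1 \<notin> local_max_ideal a P"
  proof
    assume "1 \<in> local_max_ideal a P"
    then obtain F G d where f: "F \<in> forms UNIV 3 d" "G \<in> forms UNIV 3 d" "at_P F = 0" "at_P G \<noteq> 0"
      "gval G \<noteq> 0" "1 = gval F / gval G" by (rule local_max_idealE)
    then have "gval (G - F) = 0" by (simp add: c.meval_diff)
    then have "at_P (G - F) = 0" using f P form_vanish c.forms_diff by blast
    then show False using f by (simp add: i.meval_diff)
  qed
  fix f assume f0: "f \<in> local_max_ideal a P"
  then obtain F G d where f: "F \<in> forms UNIV 3 d" "G \<in> forms UNIV 3 d" "at_P F = 0" "at_P G \<noteq> 0"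
      "gval G \<noteq> 0" "f = gval F / gval G" by (rule local_max_idealE)
  show "f \<in> local_ring a P" using f local_ringI by blast
  show "- f \<in> local_max_ideal a P"
    using local_max_idealI[of "- F" d G] f by (simp add: i.meval_uminus c.meval_uminus c.forms_uminus)
  { fix g assume "g \<in> local_max_ideal a P"
    then obtain F' G' d' where g: "F' \<in> forms UNIV 3 d'" "G' \<in> forms UNIV 3 d'" "at_P F' = 0" "at_P G' \<noteq> 0"
      "gval G' \<noteq> 0" "g = gval F' / gval G'" by (rule local_max_idealE)
    have "gval (F * G' + G * F') / gval (G * G') \<in> local_max_ideal a P"
      by (rule local_max_idealI[of _ "d + d'"])
        (use f g in \<open>simp_all add: i.meval_add i.meval_mult c.forms_add c.forms_mult\<close>)
    also have "gval (F * G' + G * F') / gval (G * G') = f + g"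
      unfolding f(6) g(6) using f(5) g(5) by (simp add: c.meval_add c.meval_mult add_frac_eq mult.commute)
    finally show "f + g \<in> local_max_ideal a P" . }
  { fix g assume "g \<in> local_ring a P"
    then obtain F' G' d' where g: "F' \<in> forms UNIV 3 d'" "G' \<in> forms UNIV 3 d'" "at_P G' \<noteq> 0"
      "gval G' \<noteq> 0" "g = gval F' / gval G'" by (rule local_ringE)
    have "gval (F' * F) / gval (G' * G) \<in> local_max_ideal a P"
      by (rule local_max_idealI[of _ "d' + d"])
        (use f g in \<open>simp_all add: i.meval_mult c.forms_mult\<close>)
    also have "gval (F' * F) / gval (G' * G) = g * f"
      using f g by (simp add: c.meval_mult)
    finally show "g * f \<in> local_max_ideal a P" . }
next
  fix f assume f0: "f \<in> local_ring a P"
  then obtain F G d where f: "F \<in> forms UNIV 3 d" "G \<in> forms UNIV 3 d" "at_P G \<noteq> 0"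
      "gval G \<noteq> 0" "f = gval F / gval G" by (rule local_ringE)
  { fix g assume "g \<in> local_ring a P"
    then obtain F' G' d' where g: "F' \<in> forms UNIV 3 d'" "G' \<in> forms UNIV 3 d'" "at_P G' \<noteq> 0"
      "gval G' \<noteq> 0" "g = gval F' / gval G'" by (rule local_ringE)
    have "gval (F * G' + G * F') / gval (G * G') \<in> local_ring a P"
      by (rule local_ringI[of _ "d + d'"])
        (use f g in \<open>simp_all add: i.meval_mult c.forms_add c.forms_mult\<close>)
    also have "gval (F * G' + G * F') / gval (G * G') = f + g"
      unfolding f(5) g(5) using f(4) g(4) by (simp add: c.meval_add c.meval_mult add_frac_eq mult.commute)
    finally show "f + g \<in> local_ring a P" .
    have "gval (F * F') / gval (G * G') \<in> local_ring a P"
      by (rule local_ringI[of _ "d + d'"])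
        (use f g in \<open>simp_all add: i.meval_mult c.forms_mult\<close>)
    also have "gval (F * F') / gval (G * G') = f * g"
      using f g by (simp add: c.meval_mult)
    finally show "f * g \<in> local_ring a P" . }
  assume "f \<notin> local_max_ideal a P"
  then have "at_P F \<noteq> 0" using f local_max_idealI by blast
  then show "inverse f \<in> local_ring a P"
    using local_ringI[of G d F] f by simp
qed

lemma ord_at_eqI:
  assumes "lp.unif \<pi>" "\<pi> \<noteq> 0" "u \<in> lp.units" "f = \<pi> powi n * u"
  shows "ord_at a P f = n"
  using lp.ord_eqI[OF assms] unfolding ord_at_def uniformizer_def lp.unif_def .

lemma const_local: "ffc_const c \<in> local_ring a P"
  using local_ringI[of "mconst c" 0 1] by (simp add: c.forms_const c.forms_1 c.meval_const)

lemma const_unit: "c \<noteq> 0 \<Longrightarrow> ffc_const c \<in> lp.units"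
  using const_local[of c] const_local[of "inverse c"] by (intro lp.unitsI) simp_all

end


section \<open>Functions in terms of x and a square root of the discriminant\<close>

definition ev :: "'k::field poly \<Rightarrow> 'k ffc" where
  "ev A = poly (map_poly ffc_const A) ffc_t"

text \<open>This is 2 y + a_1 x + a_3, obtained by completing the square. Its square is
  \<open>wdisc\<close> and the involution negates it, so even and odd parts of a function
  separate.\<close>

definition sgen :: "'k::field wcoeffs \<Rightarrow> 'k ffc" where
  "sgen a = 2 * wgeneric a 1 - ev (wp a)"

context
  fixes A B :: "'k::field poly" and c :: 'k
begin

interpretation c: field_map "ffc_const :: 'k \<Rightarrow> 'k ffc" by (rule field_map_ffc_const)

lemma ev_add [simp]: "ev (A + B) = ev A + ev B"
  and ev_mult [simp]: "ev (A * B) = ev A * ev B"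
  and ev_diff [simp]: "ev (A - B) = ev A - ev B"
  and ev_uminus [simp]: "ev (- A) = - ev A"
  and ev_const: "ev [:c:] = ffc_const c"
  and ev_X: "ev [:0, 1 :: 'k:] = ffc_t"
  and ev_0 [simp]: "ev (0 :: 'k poly) = 0"
  and ev_1 [simp]: "ev (1 :: 'k poly) = 1"
  and ev_power [simp]: "ev (A ^ n) = ev A ^ n"
  and ev_smult: "ev (smult c A) = ffc_const c * ev A"
  and ev_pCons: "ev (pCons c A) = ffc_const c + ffc_t * ev A"
  by (simp_all add: ev_def c.map_poly_h_smult)

end

lemma ev_numeral [simp]: "ev (numeral n) = numeral n"
proof -
  have "ev (of_nat k :: 'a poly) = of_nat k" for k by (induction k) auto
  from this[of "numeral n"] show ?thesis by simp
qed

lemma ev_sgen_eq_0_iff: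
  fixes a :: "'k::field_char_0 wcoeffs"
  shows "ev A + ev B * sgen a = 0 \<longleftrightarrow> A = 0 \<and> B = 0"
proof
  assume "ev A + ev B * sgen a = 0"
  moreover have "ev A + ev B * sgen a = pval ffc_const (A - B * wp a, 2 * B) ffc_t (wgeneric a 1)"
    by (simp add: sgen_def algebra_simps flip: ev_def)
  ultimately have "(A - B * wp a, 2 * B) = (0, 0)"
    using generic_wgeneric[of a] unfolding generic_xy_def by metis
  then show "A = 0 \<and> B = 0" by simp
qed simp

lemma ev_eq_0_iff [simp]: "ev (A :: 'k::field_char_0 poly) = 0 \<longleftrightarrow> A = 0"
  using ev_sgen_eq_0_iff[of A 0] by simp

lemma sgen_square: "sgen a ^ 2 = ev (wdisc a)"
proof -
  interpret c: field_map "ffc_const :: 'a \<Rightarrow> 'a ffc" by (rule field_map_ffc_const)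
  have "wgeneric a 1 ^ 2 = ev (wq a) + ev (wp a) * wgeneric a 1"
    using weq_wgeneric[of a] unfolding weq_pw by (simp add: ev_def c.map_poly_wq c.map_poly_wp)
  then have "4 * wgeneric a 1 ^ 2 = 4 * ev (wq a) + 4 * ev (wp a) * wgeneric a 1" by simp
  then show ?thesis by (simp add: sgen_def wdisc_def power2_eq_square algebra_simps)
qed

definition function_field :: "'k::field wcoeffs \<Rightarrow> 'k ffc set" where
  "function_field a = {(ev A + ev B * sgen a) / ev C | A B C. C \<noteq> 0}"

lemma pair_mult_sgen:
  "(ev A + ev B * sgen a) * (ev C + ev D * sgen a) = ev (A * C + B * D * wdisc a) + ev (A * D + B * C) * sgen a"
  by (simp add: sgen_square[symmetric] algebra_simps power2_eq_square)

lemma conj_mult_sgen: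
  "(ev A + ev B * sgen a) * (ev A - ev B * sgen a) = ev (A ^ 2 - B ^ 2 * wdisc a)"
  by (simp add: sgen_square[symmetric] algebra_simps power2_eq_square)

lemma pval_sgen:
  fixes a :: "'k::field_char_0 wcoeffs"
  shows "pval ffc_const (A, B) ffc_t (wgeneric a 1) = ev (A + smult (1/2) (B * wp a)) + ev (smult (1/2) B) * sgen a"
proof -
  interpret c: field_map "ffc_const :: 'k \<Rightarrow> 'k ffc" by (rule field_map_ffc_const)
  have "(2 :: 'k ffc) \<noteq> 0" using ev_eq_0_iff[of "2 :: 'k poly"] by simp
  then show ?thesis
    by (simp add: sgen_def ev_smult right_diff_distrib diff_divide_distrib flip: ev_def)
qed

text \<open>The denominator is rationalised: multiplying by the conjugate C - D s leaves the
  polynomial \<open>C ^ 2 - D ^ 2 * wdisc a\<close> in x alone.\<close>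

lemma ratfun_in_function_field:
  fixes a :: "'k::field_char_0 wcoeffs"
  assumes F: "F \<in> mpolys UNIV 3" and G: "G \<in> mpolys UNIV 3"
  shows "meval ffc_const (wgeneric a) F / meval ffc_const (wgeneric a) G \<in> function_field a"
proof -
  obtain A B where F': "meval ffc_const (wgeneric a) F = ev A + ev B * sgen a"
    using pval_sgen[of _ _ a] unfolding meval_wgeneric[OF F] by (metis prod.collapse)
  obtain C D where G': "meval ffc_const (wgeneric a) G = ev C + ev D * sgen a"
    using pval_sgen[of _ _ a] unfolding meval_wgeneric[OF G] by (metis prod.collapse)
  show ?thesis
  proof (cases "ev C + ev D * sgen a = 0")
    \<comment> \<open>A denominator that vanishes on the curve makes the quotient 0, by the
      convention for division by 0.\<close>
    case True
    have "0 = (ev 0 + ev 0 * sgen a) / ev 1" by simp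
    then show ?thesis unfolding G' True function_field_def by (simp only: div_by_0) (rule CollectI, rule exI[of _ 0], rule exI[of _ 0], rule exI[of _ 1], simp)
  next
    case False
    then have nz: "C \<noteq> 0 \<or> D \<noteq> 0" by (auto simp: ev_sgen_eq_0_iff)
    have 2: "ev C - ev D * sgen a \<noteq> 0"
      using nz ev_sgen_eq_0_iff[of C "- D" a] by auto
    have "(ev A + ev B * sgen a) / (ev C + ev D * sgen a) =
       ((ev A + ev B * sgen a) * (ev C - ev D * sgen a)) / ((ev C + ev D * sgen a) * (ev C - ev D * sgen a))"
      using 2 by simp
    also have "\<dots> = (ev (A * C + B * (- D) * wdisc a) + ev (A * (- D) + B * C) * sgen a) / ev (C ^ 2 - D ^ 2 * wdisc a)"
      unfolding conj_mult_sgen using pair_mult_sgen[of A B a C "- D"] by simp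
    finally have e: "(ev A + ev B * sgen a) / (ev C + ev D * sgen a) = \<dots>" .
    have "ev (C ^ 2 - D ^ 2 * wdisc a) \<noteq> 0"
      using False 2 conj_mult_sgen[of C D a] by (metis mult_eq_0_iff)
    then have "C ^ 2 - D ^ 2 * wdisc a \<noteq> 0" by (metis ev_0)
    then show ?thesis unfolding F' G' e function_field_def by blast
  qed
qed

lemma (in curve_point) local_ring_function_field:
  assumes "f \<in> local_ring a P"
  shows "f \<in> function_field a"
proof -
  obtain F G d where "F \<in> forms UNIV 3 d" "G \<in> forms UNIV 3 d" "f = gval F / gval G"
    using local_ringE[OF assms] by metis
  then show ?thesis using ratfun_in_function_field[of F G a] by (simp add: forms_def)
qed

text \<open>\<open>expand\<close> says that every nonzero function is a power of \<pi> times a unit,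
  so the local ring is a discrete valuation ring with parameter \<pi>. This is what gives
  \<open>ord_at\<close> a meaning.\<close>

locale uniformized_point = curve_point +
  fixes \<pi>
  assumes pi_M: "\<pi> \<in> local_max_ideal a P" and pi_nz: "\<pi> \<noteq> 0"
    and expand: "\<And>f. f \<in> function_field a \<Longrightarrow> f \<noteq> 0 \<Longrightarrow> \<exists>n. \<exists>u\<in>lp.units. f = \<pi> powi n * u"
begin

lemma unif_pi: "lp.unif \<pi>"
  using pi_M pi_nz expand local_ring_function_field lp.M_A by (intro lp.unifI) blast+

lemma ord_at_expand:
  assumes "f \<in> function_field a" "f \<noteq> 0"
  shows "\<exists>u\<in>lp.units. f = \<pi> powi ord_at a P f * u"
proof -
  obtain n u where u: "u \<in> lp.units" "f = \<pi> powi n * u" using expand assms by blast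
  have "ord_at a P f = n" by (rule ord_at_eqI[OF unif_pi pi_nz u])
  then show ?thesis using u by blast
qed

lemma pi_power_A: "\<pi> ^ n \<in> local_ring a P"
  using pi_M by (induction n) (auto intro: lp.A_mult lp.M_A)

lemma ord_nonneg:
  assumes "f \<in> function_field a" "f \<noteq> 0" "ord_at a P f \<ge> 0"
  shows "f \<in> local_ring a P"
proof -
  obtain u where u: "u \<in> lp.units" "f = \<pi> powi ord_at a P f * u" using ord_at_expand assms by blast
  have "\<pi> powi ord_at a P f * u \<in> local_ring a P" using assms(3) pi_power_A u(1)
    by (auto simp: power_int_def lp.units_def intro: lp.A_mult)
  then show ?thesis by (simp flip: u(2))
qed

lemma ord_pos:
  assumes "f \<in> function_field a" "f \<noteq> 0" "ord_at a P f > 0"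
  shows "f \<in> local_max_ideal a P"
proof -
  obtain u where u: "u \<in> lp.units" "f = \<pi> powi ord_at a P f * u" using ord_at_expand assms by blast
  have "u * \<pi> powi ord_at a P f \<in> local_max_ideal a P" using u(1) lp.M_power[OF pi_M] assms(3)
    by (auto simp: power_int_def lp.units_def intro!: lp.M_mult)
  then show ?thesis by (simp only: mult.commute[of u] u(2)[symmetric])
qed

end

lemma (in local_pair) divide_powi:
  assumes "\<pi> \<noteq> 0" "u \<in> units" "v \<in> units"
  shows "\<exists>w\<in>units. (\<pi> powi i * u) / (\<pi> powi j * v) = \<pi> powi (i - j) * w"
proof
  show "(\<pi> powi i * u) / (\<pi> powi j * v) = \<pi> powi (i - j) * (u / v)"
    using assms(1) by (simp add: power_int_diff)
qed (use assms units_divide in blast)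

text \<open>Applies at the points fixed by the involution of the Weierstrass curve.\<close>

lemma (in curve_point) odd_even_uniformized:
  assumes p: "\<pi> \<in> local_max_ideal a P" "\<pi> \<noteq> 0"
    and x: "\<And>A. A \<noteq> 0 \<Longrightarrow> even (m A) \<and> (\<exists>u\<in>lp.units. ev A = \<pi> powi (m A) * u)"
    and s: "odd k" "v \<in> lp.units" "sgen a = \<pi> powi k * v"
  shows "uniformized_point a P \<pi>"
    and "A \<noteq> 0 \<Longrightarrow> B \<noteq> 0 \<Longrightarrow> \<exists>u\<in>lp.units. ev A + ev B * sgen a = \<pi> powi (min (m A) (m B + k)) * u"
    and "B \<noteq> 0 \<Longrightarrow> \<exists>u\<in>lp.units. ev B * sgen a = \<pi> powi (m B + k) * u"
proof -
  show Bs: "\<exists>u\<in>lp.units. ev B * sgen a = \<pi> powi (m B + k) * u" if B: "B \<noteq> 0" for B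
  proof -
    obtain u where u: "u \<in> lp.units" "ev B = \<pi> powi (m B) * u" using x B by blast
    then have "ev B * sgen a = \<pi> powi (m B + k) * (u * v)"
      using s(3) p(2) by (simp add: power_int_add)
    then show ?thesis using lp.units_mult[OF u(1) s(2)] by blast
  qed
  show AB: "\<exists>u\<in>lp.units. ev A + ev B * sgen a = \<pi> powi (min (m A) (m B + k)) * u"
    if AB: "A \<noteq> 0" "B \<noteq> 0" for A B
  proof -
    obtain u where u: "u \<in> lp.units" "ev A = \<pi> powi (m A) * u" using x AB by blast
    obtain w where w: "w \<in> lp.units" "ev B * sgen a = \<pi> powi (m B + k) * w" using Bs AB by blast
    have "odd (m B + k)" using x[OF AB(2)] s(1) by simp
    then show ?thesis
      using lp.odd_even_expansion[OF p u(1) w(1), of "m A" "m B + k"] x[OF AB(1)] u(2) w(2) by simp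
  qed
  show "uniformized_point a P \<pi>"
  proof (unfold_locales, rule p(1), rule p(2))
    fix f assume "f \<in> function_field a" and nz: "f \<noteq> 0"
    then obtain A B C where f: "C \<noteq> 0" "f = (ev A + ev B * sgen a) / ev C"
      unfolding function_field_def by blast
    obtain c where c: "c \<in> lp.units" "ev C = \<pi> powi (m C) * c" using x f by blast
    have "\<exists>n. \<exists>u\<in>lp.units. ev A + ev B * sgen a = \<pi> powi n * u"
    proof (cases "A = 0 \<or> B = 0")
      case True
      show ?thesis
      proof (cases "B = 0")
        case True
        moreover have "A \<noteq> 0" using True nz f by auto
        ultimately show ?thesis using x[of A] by (simp, blast)
      next
        case B: False
        then have "A = 0" using True by blast
        then show ?thesis using Bs[OF B] by auto
      qed
    next
      case False
      then show ?thesis using AB by blast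
    qed
    then obtain n u where u: "u \<in> lp.units" "ev A + ev B * sgen a = \<pi> powi n * u" by blast
    show "\<exists>n. \<exists>u\<in>lp.units. f = \<pi> powi n * u"
      unfolding f(2) u(2) c(2) using lp.divide_powi[OF p(2) u(1) c(1)] by blast
  qed
qed

subsection \<open>Affine points\<close>

text \<open>Smoothness enters as simplicity of the root \<open>x0\<close> of the discriminant, which
  matters at points fixed by the involution.\<close>

locale affine_point = curve_point a "Aff x0 y0" for a :: "'k::field_char_0 wcoeffs" and x0 y0 +
  assumes nonsing: "poly (wdisc a) x0 = 0 \<Longrightarrow> poly (pderiv (wdisc a)) x0 \<noteq> 0"
begin

abbreviation "AA \<equiv> local_ring a (Aff x0 y0)"
abbreviation "MM \<equiv> local_max_ideal a (Aff x0 y0)"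
definition s0 where "s0 = 2 * y0 - poly (wp a) x0"

lemma var_M:
  shows "ffc_t - ffc_const x0 \<in> MM" and "wgeneric a 1 - ffc_const y0 \<in> MM"
proof -
  have "gval (mvar 0 - mconst x0 * mvar 2) / gval (mvar 2) \<in> MM"
    by (rule local_max_idealI[of _ 1])
      (auto intro!: c.forms_diff c.forms_const_mult c.forms_var simp: i.meval_rules simp del: One_nat_def)
  then show "ffc_t - ffc_const x0 \<in> MM" by (simp add: c.meval_rules wgeneric_simps)
  have "gval (mvar 1 - mconst y0 * mvar 2) / gval (mvar 2) \<in> MM"
    by (rule local_max_idealI[of _ 1])
      (auto intro!: c.forms_diff c.forms_const_mult c.forms_var simp: i.meval_rules simp del: One_nat_def)
  then show "wgeneric a 1 - ffc_const y0 \<in> MM" by (simp add: c.meval_rules wgeneric_simps)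
qed

lemma var_A: "ffc_t \<in> AA" "wgeneric a 1 \<in> AA"
  using lp.A_add[OF lp.M_A[OF var_M(1)] const_local[of x0]]
    lp.A_add[OF lp.M_A[OF var_M(2)] const_local[of y0]] by simp_all

lemma ev_A: "ev A \<in> AA"
proof (induction A)
  case (pCons c A)
  show ?case unfolding ev_pCons by (intro lp.A_add lp.A_mult var_A const_local pCons.IH)
qed simp

lemma ev_M: "ev A - ffc_const (poly A x0) \<in> MM"
proof -
  have "poly (A - [:poly A x0:]) x0 = 0" by simp
  then obtain B where "A - [:poly A x0:] = [:- x0, 1:] * B" unfolding poly_eq_0_iff_dvd by (elim dvdE)
  then have "ev (A - [:poly A x0:]) = ev ([:- x0, 1:] * B)" by simp
  then have "ev A - ffc_const (poly A x0) = ev B * (ffc_t - ffc_const x0)"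
    by (simp add: ev_pCons ev_const ev_smult algebra_simps)
  then show ?thesis using lp.M_mult[OF ev_A var_M(1)] by simp
qed

lemma sgen_A: "sgen a \<in> AA"
proof -
  have "wgeneric a 1 + wgeneric a 1 + ev (- wp a) \<in> AA" (is "?e \<in> _")
    by (intro lp.A_add var_A ev_A)
  also have "?e = sgen a" by (simp add: sgen_def)
  finally show ?thesis .
qed

lemma sgen_M: "sgen a - ffc_const s0 \<in> MM"
proof -
  have "(wgeneric a 1 - ffc_const y0) + (wgeneric a 1 - ffc_const y0) - (ev (wp a) - ffc_const (poly (wp a) x0)) \<in> MM" (is "?e \<in> _")
    by (rule lp.M_diff[OF lp.M_add[OF var_M(2) var_M(2)] ev_M])
  also have "?e = sgen a - ffc_const s0" by (simp add: sgen_def s0_def)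
  finally show ?thesis .
qed

lemma pair_M: "ev A + ev B * sgen a - ffc_const (poly A x0 + poly B x0 * s0) \<in> MM"
proof -
  have "(ev A - ffc_const (poly A x0)) + (sgen a * (ev B - ffc_const (poly B x0))
     + ffc_const (poly B x0) * (sgen a - ffc_const s0)) \<in> MM" (is "?e \<in> _")
    by (rule lp.M_add[OF ev_M lp.M_add[OF lp.M_mult[OF sgen_A ev_M] lp.M_mult[OF const_local sgen_M]]])
  also have "?e = ev A + ev B * sgen a - ffc_const (poly A x0 + poly B x0 * s0)"
    by (simp add: algebra_simps)
  finally show ?thesis .
qed

lemma pair_unit_iff: "ev A + ev B * sgen a \<in> lp.units \<longleftrightarrow> poly A x0 + poly B x0 * s0 \<noteq> 0"
  and pair_M_iff: "ev A + ev B * sgen a \<in> MM \<longleftrightarrow> poly A x0 + poly B x0 * s0 = 0"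
proof -
  have 1: "ev A + ev B * sgen a \<in> MM" if "poly A x0 + poly B x0 * s0 = 0"
    using pair_M[of A B] that by simp
  have 2: "ev A + ev B * sgen a \<in> lp.units" if "poly A x0 + poly B x0 * s0 \<noteq> 0"
    using lp.units_add_M[OF const_unit[OF that] pair_M[of A B]] by simp
  show "ev A + ev B * sgen a \<in> lp.units \<longleftrightarrow> poly A x0 + poly B x0 * s0 \<noteq> 0"
    "ev A + ev B * sgen a \<in> MM \<longleftrightarrow> poly A x0 + poly B x0 * s0 = 0"
    using 1 2 unfolding lp.units_def by blast+
qed

lemma ev_unit_iff: "ev A \<in> lp.units \<longleftrightarrow> poly A x0 \<noteq> 0"
  using pair_unit_iff[of A 0] by simp

lemma s0_square: "s0 ^ 2 = poly (wdisc a) x0"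
proof -
  have "y0 ^ 2 = poly (wq a) x0 + poly (wp a) x0 * y0"
    using P weq_pw[of a x0 y0] by (simp add: Aff_in_wpoints)
  then have "4 * y0 ^ 2 = 4 * poly (wq a) x0 + 4 * poly (wp a) x0 * y0" by simp
  then show ?thesis by (simp add: s0_def wdisc_def power2_eq_square algebra_simps)
qed

lemma ev_order: "A \<noteq> 0 \<Longrightarrow> \<exists>u\<in>lp.units. ev A = (ffc_t - ffc_const x0) ^ order x0 A * u"
proof -
  assume "A \<noteq> 0"
  then obtain B where B: "A = [:- x0, 1:] ^ order x0 A * B" "\<not> [:- x0, 1:] dvd B"
    using order_decomp by blast
  have "ev A = (ffc_t - ffc_const x0) ^ order x0 A * ev B"
    by (subst B(1)) (simp add: ev_pCons)
  moreover have "ev B \<in> lp.units" using B(2) by (simp add: ev_unit_iff poly_eq_0_iff_dvd)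
  ultimately show ?thesis by blast
qed

text \<open>At a fixed point of the involution, x - \<open>x0\<close> equals s^2 times a unit,
  because the root of the discriminant is simple; so s is a uniformizer, functions of x have even
  order, and no cancellation occurs. Elsewhere x - \<open>x0\<close> is a uniformizer: after common
  factors of A and B are divided out, A + B s and A - B s do not both vanish, and their product is a
  polynomial in x.\<close>

lemma uniformized: "\<exists>\<pi>. uniformized_point a (Aff x0 y0) \<pi>"
proof (cases "s0 = 0")
  case True
  then have d0: "poly (wdisc a) x0 = 0" using s0_square by simp
  then obtain D where D: "wdisc a = [:- x0, 1:] * D" unfolding poly_eq_0_iff_dvd by (elim dvdE)
  have "poly D x0 \<noteq> 0" using nonsing[OF d0] unfolding D pderiv_mult by (simp add: pderiv_pCons)
  then have Du: "ev D \<in> lp.units" by (simp add: ev_unit_iff)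
  have "ev (wdisc a) = (ffc_t - ffc_const x0) * ev D" unfolding D ev_mult by (simp add: ev_pCons)
  then have sq: "ffc_t - ffc_const x0 = sgen a ^ 2 * inverse (ev D)"
    using lp.units_nonzero[OF Du] by (simp add: sgen_square)
  have p: "sgen a \<in> MM" "sgen a \<noteq> 0"
    using sgen_M True ev_sgen_eq_0_iff[of 0 1 a] by simp_all
  have "uniformized_point a (Aff x0 y0) (sgen a)"
  proof (rule odd_even_uniformized(1)[OF p, where m = "\<lambda>A. 2 * int (order x0 A)" and k = 1 and v = 1])
    fix A :: "'k poly" assume "A \<noteq> 0"
    then obtain u where u: "u \<in> lp.units" "ev A = (ffc_t - ffc_const x0) ^ order x0 A * u"
      using ev_order by blast
    have "ev A = sgen a powi (2 * int (order x0 A)) * (inverse (ev D) ^ order x0 A * u)"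
    proof -
      have "sgen a powi (2 * int (order x0 A)) = (sgen a ^ 2) ^ order x0 A"
        by (simp add: power_int_def nat_mult_distrib power_mult)
      then show ?thesis unfolding u(2) sq by (simp only: power_mult_distrib mult.assoc)
    qed
    moreover have "inverse (ev D) ^ order x0 A * u \<in> lp.units"
      using u(1) Du by (intro lp.units_mult lp.units_power lp.units_inverse)
    ultimately show "even (2 * int (order x0 A)) \<and> (\<exists>u\<in>lp.units. ev A = sgen a powi (2 * int (order x0 A)) * u)"
      by (intro conjI bexI) (rule even_mult_iff[THEN iffD2], simp)
  qed simp_all
  then show ?thesis ..
next
  case False
  let ?p = "ffc_t - ffc_const x0"
  have p: "?p \<in> MM" "?p \<noteq> 0"
  proof -
    have "ev [:- x0, 1:] \<noteq> 0" by (simp only: ev_eq_0_iff) simp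
    then show "?p \<noteq> 0" by (simp add: ev_pCons)
  qed (rule var_M)
  have ev_p: "ev [:- x0, 1:] = ?p" by (simp add: ev_pCons)
  have pair: "\<exists>n. \<exists>u\<in>lp.units. ev A + ev B * sgen a = ?p powi n * u" if "A \<noteq> 0 \<or> B \<noteq> 0" for A B
    using that
  proof (induction "Polynomial.degree A + Polynomial.degree B" arbitrary: A B rule: less_induct)
    case less
    show ?case
    proof (cases "poly A x0 = 0 \<and> poly B x0 = 0")
      case True
      then obtain A' B' where AB: "A = [:- x0, 1:] * A'" "B = [:- x0, 1:] * B'"
        unfolding poly_eq_0_iff_dvd by (elim conjE dvdE)
      have nz: "A' \<noteq> 0 \<or> B' \<noteq> 0" using AB less.prems by auto
      have d: "Polynomial.degree ([:- x0, 1:] * C) = (if C = 0 then 0 else Suc (Polynomial.degree C))" for C :: "'k poly"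
        by (cases "C = 0") (simp, subst degree_mult_eq, simp_all)
      have "Polynomial.degree A' + Polynomial.degree B' < Polynomial.degree A + Polynomial.degree B"
        unfolding AB d using nz by auto
      from less.hyps[OF this nz] obtain n u where u: "u \<in> lp.units" "ev A' + ev B' * sgen a = ?p powi n * u" by blast
      have "ev A + ev B * sgen a = ?p * (ev A' + ev B' * sgen a)"
        unfolding AB ev_mult ev_p by (simp add: algebra_simps)
      also have "\<dots> = ?p powi (n + 1) * u" unfolding u(2) using p(2) by (simp add: power_int_add)
      finally show ?thesis using u(1) by blast
    next
      case nz: False
      show ?thesis
      proof (cases "poly A x0 + poly B x0 * s0 = 0")
        case False
        then have "ev A + ev B * sgen a \<in> lp.units" by (simp add: pair_unit_iff)
        then show ?thesis by (intro exI[of _ 0]) auto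
      next
        case True
        \<comment> \<open>If both conjugates vanished, then so would A and B \<open>s0\<close> at
          \<open>x0\<close>; as \<open>s0\<close> is nonzero here, this contradicts the previous
          division by common factors.\<close>
        have "poly A x0 + poly (- B) x0 * s0 \<noteq> 0"
        proof
          assume h: "poly A x0 + poly (- B) x0 * s0 = 0"
          have "2 * poly A x0 = 0" using arg_cong2[OF True h, of "(+)"] by simp
          moreover have "2 * (poly B x0 * s0) = 0" using arg_cong2[OF True h, of "(-)"] by simp
          ultimately show False using nz False by simp
        qed
        then have u: "ev A - ev B * sgen a \<in> lp.units" using pair_unit_iff[of A "- B"] by simp
        have "ev A + ev B * sgen a \<noteq> 0" using less.prems by (simp add: ev_sgen_eq_0_iff)
        then have "ev (A ^ 2 - B ^ 2 * wdisc a) \<noteq> 0"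
          unfolding conj_mult_sgen[symmetric] using lp.units_nonzero[OF u] by simp
        then have "A ^ 2 - B ^ 2 * wdisc a \<noteq> 0" by (metis ev_0)
        then obtain w where w: "w \<in> lp.units"
          "ev (A ^ 2 - B ^ 2 * wdisc a) = ?p ^ order x0 (A ^ 2 - B ^ 2 * wdisc a) * w"
          using ev_order by blast
        have "ev A + ev B * sgen a = ev (A ^ 2 - B ^ 2 * wdisc a) / (ev A - ev B * sgen a)"
          unfolding conj_mult_sgen[symmetric] using lp.units_nonzero[OF u] by simp
        also have "\<dots> = ?p powi int (order x0 (A ^ 2 - B ^ 2 * wdisc a)) * (w / (ev A - ev B * sgen a))"
          unfolding w(2) by simp
        finally show ?thesis using lp.units_divide[OF w(1) u] by blast
      qed
    qed
  qed
  have "uniformized_point a (Aff x0 y0) ?p"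
  proof (unfold_locales, rule p(1), rule p(2))
    fix f assume "f \<in> function_field a" and nz: "f \<noteq> 0"
    then obtain A B C where f: "C \<noteq> 0" "f = (ev A + ev B * sgen a) / ev C"
      unfolding function_field_def by blast
    have "A \<noteq> 0 \<or> B \<noteq> 0" using f nz by auto
    then obtain n u where u: "u \<in> lp.units" "ev A + ev B * sgen a = ?p powi n * u" using pair by blast
    obtain m v where v: "v \<in> lp.units" "ev C + ev 0 * sgen a = ?p powi m * v" using pair f(1) by blast
    have v2: "ev C = ?p powi m * v" using v(2) by simp
    show "\<exists>n. \<exists>u\<in>lp.units. f = ?p powi n * u"
      unfolding f(2) u(2) v2 using lp.divide_powi[OF p(2) u(1) v(1)] by blast
  qed
  then show ?thesis ..
qed

end


subsection \<open>The point at infinity\<close>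

locale infinite_point = curve_point a Infty for a :: "'k::field_char_0 wcoeffs"
begin

abbreviation "MM \<equiv> local_max_ideal a Infty"
definition pinf where "pinf = ffc_t / wgeneric a 1"

lemma form_unit:
  assumes "F \<in> forms UNIV 3 d" "at_P F \<noteq> 0" "G \<in> forms UNIV 3 d" "at_P G \<noteq> 0"
  shows "gval F / gval G \<in> lp.units"
  using assms local_ringI[of F d G] local_ringI[of G d F] gval_nonzero by (intro lp.unitsI) auto

lemma Y_nonzero: "wgeneric a 1 \<noteq> 0"
  using gval_nonzero[of "mvar 1" 1] by (simp add: c.forms_var i.meval_var c.meval_var del: One_nat_def)

lemma X_nonzero: "(ffc_t :: 'k ffc) \<noteq> 0"
  using ev_eq_0_iff[of "[:0, 1 :: 'k:]"] by (simp add: ev_X del: ev_eq_0_iff)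

lemma pinf_M: "pinf \<in> MM"
  using local_max_idealI[of "mvar 0" 1 "mvar 1"]
  by (simp add: c.forms_var i.meval_var c.meval_var pinf_def wgeneric_simps del: One_nat_def)

lemma pinf_nonzero: "pinf \<noteq> 0"
  by (simp add: pinf_def Y_nonzero X_nonzero del: One_nat_def)

text \<open>The equation of the curve reads z T = x^3 with a quadratic form T whose value at (0 : 1
  : 0) is 1. So T / y^2 is a unit, and x = (y/x)^2 (T / y^2) on z = 1.\<close>

lemma X_expand: "\<exists>u\<in>lp.units. ffc_t = pinf powi (- 2) * u"
proof -
  let ?x = "mvar 0 :: 'k mpoly" and ?y = "mvar 1 :: 'k mpoly" and ?z = "mvar 2 :: 'k mpoly"
  let ?T = "?y * ?y + mconst (a1 a) * (?x * ?y) + mconst (a3 a) * (?y * ?z)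
    - mconst (a2 a) * (?x * ?x) - mconst (a4 a) * (?x * ?z) - mconst (a6 a) * (?z * ?z)"
  have v: "(mvar j :: 'k mpoly) \<in> forms UNIV 3 1" if "j < 3" for j using that by (rule c.forms_var)
  have vv: "(mvar j * mvar l :: 'k mpoly) \<in> forms UNIV 3 2" if "j < 3" "l < 3" for j l
    using c.forms_mult[OF v v] that by (simp add: numeral_2_eq_2)
  have T: "?T \<in> forms UNIV 3 2"
    by (intro c.forms_add c.forms_diff c.forms_const_mult vv) simp_all
  have u: "gval ?T / gval (?y * ?y) \<in> lp.units"
    by (rule form_unit[OF T _ vv]) (simp_all add: i.meval_rules)
  have "gval ?T = ffc_t ^ 3"
    using weq_wgeneric[of a]
    by (simp add: c.meval_rules weq_def wcoeffs_sel wgeneric_simps power2_eq_square algebra_simps del: One_nat_def)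
  then have "ffc_t = pinf powi (- 2) * (gval ?T / gval (?y * ?y))"
    using X_nonzero Y_nonzero
    by (simp add: c.meval_rules pinf_def power_int_minus power2_eq_square power3_eq_cube field_simps del: One_nat_def)
  then show ?thesis using u by blast
qed

lemma Y_expand: "\<exists>u\<in>lp.units. wgeneric a 1 = pinf powi (- 3) * u"
proof -
  obtain u where u: "u \<in> lp.units" "ffc_t = pinf powi (- 2) * u" using X_expand by blast
  have "wgeneric a 1 = pinf powi (- 1) * ffc_t"
    using X_nonzero Y_nonzero by (simp add: pinf_def power_int_minus)
  also have "\<dots> = (pinf powi (- 1) * pinf powi (- 2)) * u" by (subst u(2)) (simp only: mult.assoc)
  also have "\<dots> = pinf powi (- 3) * u" using power_int_add[of pinf "- 1" "- 2"] pinf_nonzero by simp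
  finally show ?thesis using u(1) by blast
qed

lemma sgen_expand: "\<exists>u\<in>lp.units. sgen a = pinf powi (- 3) * u"
proof -
  obtain u where u: "u \<in> lp.units" "wgeneric a 1 = pinf powi (- 3) * u" using Y_expand by blast
  let ?S = "mconst 2 * mvar 1 + mconst (a1 a) * mvar 0 + mconst (a3 a) * mvar 2 :: 'k mpoly"
  have S: "gval ?S / gval (mvar 1) \<in> lp.units"
    by (rule form_unit[of _ 1])
      (auto intro!: c.forms_add c.forms_const_mult c.forms_var simp: i.meval_rules simp del: One_nat_def)
  have "gval ?S = sgen a"
    by (simp add: c.meval_rules sgen_def wp_def ev_pCons wgeneric_simps algebra_simps del: One_nat_def)
  then have "sgen a = wgeneric a 1 * (gval ?S / gval (mvar 1))"
    using Y_nonzero by (simp add: c.meval_var del: One_nat_def)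
  also have "\<dots> = pinf powi (- 3) * (u * (gval ?S / gval (mvar 1)))"
    unfolding u(2) by (rule mult.assoc)
  finally show ?thesis using lp.units_mult[OF u(1) S] by blast
qed

lemma inv_X_M: "inverse ffc_t \<in> MM"
proof -
  obtain u where u: "u \<in> lp.units" "ffc_t = pinf powi (- 2) * u" using X_expand by blast
  have "inverse ffc_t = inverse u * pinf ^ 2"
    by (subst u(2)) (simp add: power_int_minus mult.commute)
  then show ?thesis
    using lp.units_inverse[OF u(1)] lp.M_power[OF pinf_M, of 2] lp.M_mult by (simp add: lp.units_def)
qed

text \<open>Dividing by the top power of x leaves the leading coefficient plus multiples of 1/x, and
  1/x lies in the maximal ideal at infinity.\<close>

lemma ev_leading:
  "\<exists>m\<in>MM. ev A = ffc_t ^ Polynomial.degree A * (ffc_const (Polynomial.lead_coeff A) + m)"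
proof (induction A)
  case 0
  show ?case by (intro bexI[of _ 0]) auto
next
  case (pCons c A)
  show ?case
  proof (cases "A = 0")
    case True
    then show ?thesis by (intro bexI[of _ 0]) (auto simp: ev_const)
  next
    case False
    obtain m where m: "m \<in> MM" "ev A = ffc_t ^ Polynomial.degree A * (ffc_const (Polynomial.lead_coeff A) + m)"
      using pCons.IH by blast
    let ?n = "Suc (Polynomial.degree A)"
    let ?m = "m + ffc_const c * inverse ffc_t ^ ?n"
    have "?m \<in> MM"
      by (intro lp.M_add lp.M_mult lp.M_power m const_local inv_X_M) simp
    moreover have "ffc_t ^ ?n * inverse ffc_t ^ ?n = (1 :: 'k ffc)"
      using X_nonzero by (simp add: power_mult_distrib[symmetric] del: power_Suc)
    then have "ffc_t ^ ?n * (ffc_const c * inverse ffc_t ^ ?n) = ffc_const c" by (metis mult.left_commute mult.right_neutral)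
    then have "ev (pCons c A) = ffc_t ^ ?n * (ffc_const (Polynomial.lead_coeff A) + ?m)"
      unfolding ev_pCons m(2) by (simp only: distrib_left power_Suc mult.assoc) (simp add: algebra_simps)
    ultimately show ?thesis using False by auto
  qed
qed

lemma ev_expand:
  assumes "A \<noteq> 0"
  shows "\<exists>u\<in>lp.units. ev A = pinf powi (- 2 * int (Polynomial.degree A)) * u"
proof -
  obtain u where u: "u \<in> lp.units" "ffc_t = pinf powi (- 2) * u" using X_expand by blast
  obtain m where m: "m \<in> MM" "ev A = ffc_t ^ Polynomial.degree A * (ffc_const (Polynomial.lead_coeff A) + m)"
    using ev_leading by blast
  have "ev A = pinf powi (- 2 * int (Polynomial.degree A)) * (u ^ Polynomial.degree A * (ffc_const (Polynomial.lead_coeff A) + m))"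
    unfolding m(2) by (subst u(2)) (simp only: power_mult_distrib power_int_mult power_int_of_nat mult.assoc)
  moreover have "u ^ Polynomial.degree A * (ffc_const (Polynomial.lead_coeff A) + m) \<in> lp.units"
    using u(1) m(1) assms by (intro lp.units_mult lp.units_power lp.units_add_M const_unit) auto
  ultimately show ?thesis by blast
qed

lemma uniformized: "uniformized_point a Infty pinf"
  and pair_expand: "A \<noteq> 0 \<Longrightarrow> B \<noteq> 0 \<Longrightarrow> \<exists>u\<in>lp.units. ev A + ev B * sgen a =
    pinf powi (min (- 2 * int (Polynomial.degree A)) (- 2 * int (Polynomial.degree B) - 3)) * u"
  and sgen_part_expand: "B \<noteq> 0 \<Longrightarrow> \<exists>u\<in>lp.units. ev B * sgen a =
    pinf powi (- 2 * int (Polynomial.degree B) - 3) * u"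
proof -
  obtain v where v: "v \<in> lp.units" "sgen a = pinf powi (- 3) * v" using sgen_expand by blast
  have e: "even (- 2 * int (Polynomial.degree A)) \<and> (\<exists>u\<in>lp.units. ev A = pinf powi (- 2 * int (Polynomial.degree A)) * u)"
    if "A \<noteq> 0" for A using ev_expand[OF that] by simp
  note * = odd_even_uniformized[OF pinf_M pinf_nonzero, where m = "\<lambda>A. - 2 * int (Polynomial.degree A)", OF e _ v(1) v(2), simplified]
  show "uniformized_point a Infty pinf" by (rule *(1))
  show "A \<noteq> 0 \<Longrightarrow> B \<noteq> 0 \<Longrightarrow> \<exists>u\<in>lp.units. ev A + ev B * sgen a =
    pinf powi (min (- 2 * int (Polynomial.degree A)) (- 2 * int (Polynomial.degree B) - 3)) * u"
    using *(2)[of A B] by simp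
  show "B \<noteq> 0 \<Longrightarrow> \<exists>u\<in>lp.units. ev B * sgen a = pinf powi (- 2 * int (Polynomial.degree B) - 3) * u"
    using *(3)[of B] by simp
qed

text \<open>The orders -2 deg A and -2 deg B - 3 have different parity, so the smaller one is the
  order of the sum. It is -3 only if B is a nonzero constant and deg A is at most 1: the space of
  functions with at most a triple pole at infinity is spanned by 1, x, y.\<close>

lemma ord_pair:
  assumes "ord_at a Infty (ev A + ev B * sgen a) = - 3" "A \<noteq> 0 \<or> B \<noteq> 0"
  shows "B \<noteq> 0 \<and> Polynomial.degree B = 0 \<and> Polynomial.degree A \<le> 1"
proof -
  interpret u: uniformized_point a Infty pinf by (rule uniformized)
  have o: "n = - 3" if "u \<in> lp.units" "ev A + ev B * sgen a = pinf powi n * u" for n u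
    using ord_at_eqI[OF u.unif_pi pinf_nonzero that] assms(1) by simp
  consider "B = 0" "A \<noteq> 0" | "A = 0" "B \<noteq> 0" | "A \<noteq> 0" "B \<noteq> 0" using assms(2) by blast
  then show ?thesis
  proof cases
    case 1
    then obtain u where "u \<in> lp.units" "ev A + ev B * sgen a = pinf powi (- 2 * int (Polynomial.degree A)) * u"
      using ev_expand by auto
    from o[OF this] show ?thesis by presburger
  next
    case 2
    then obtain u where "u \<in> lp.units" "ev A + ev B * sgen a = pinf powi (- 2 * int (Polynomial.degree B) - 3) * u"
      using sgen_part_expand by auto
    from o[OF this] 2 show ?thesis by simp
  next
    case 3
    then obtain u where "u \<in> lp.units" "ev A + ev B * sgen a =
       pinf powi (min (- 2 * int (Polynomial.degree A)) (- 2 * int (Polynomial.degree B) - 3)) * u"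
      using pair_expand by blast
    from o[OF this] 3 show ?thesis by (auto simp: min_def split: if_splits)
  qed
qed

end

subsection \<open>Functions with a pole of order three at infinity\<close>

text \<open>In effect, the affine coordinate ring is integrally closed. At a root \<open>x0\<close>
  of C, regularity of f at both points above \<open>x0\<close> forces A and B s to vanish there;
  coprimality keeps B nonzero, so the point is fixed by the involution. Cancelling x -
  \<open>x0\<close> = s^2 / D then gives B D = s (C' f - A'), which vanishes at the point although B
  and D do not.\<close>

lemma regular_denominator:
  fixes a :: "'k::{field_char_0, alg_closed_field} wcoeffs"
  assumes nonsing: "\<And>x. poly (wdisc a) x = 0 \<Longrightarrow> poly (pderiv (wdisc a)) x \<noteq> 0"
    and coprime: "\<And>x. poly C x = 0 \<Longrightarrow> poly A x \<noteq> 0 \<or> poly B x \<noteq> 0"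
    and C: "C \<noteq> 0" and f: "f = (ev A + ev B * sgen a) / ev C" and f0: "f \<noteq> 0"
    and reg: "\<And>x y. weq a x y = 0 \<Longrightarrow> ord_at a (Aff x y) f \<ge> 0"
  shows "Polynomial.degree C = 0"
proof (rule ccontr)
  assume "Polynomial.degree C \<noteq> 0"
  then obtain x0 where x0: "poly C x0 = 0" using alg_closed_imp_poly_has_root by blast
  obtain y0 where y0: "weq a x0 y0 = 0" using weq_root_exists by blast
  define y1 where "y1 = poly (wp a) x0 - y0"
  have y1: "weq a x0 y1 = 0"
    using y0 by (simp add: y1_def weq_def wp_def power2_eq_square algebra_simps)
  have fe: "(ev A + ev B * sgen a) = ev C * f" using C f by simp
  have loc: "affine_point a x y" "f \<in> local_ring a (Aff x y)" if "weq a x y = 0" for x y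
  proof -
    show a: "affine_point a x y"
      using that nonsing by unfold_locales (simp_all add: Aff_in_wpoints)
    then interpret affine_point a x y .
    obtain \<pi> where "uniformized_point a (Aff x y) \<pi>" using uniformized by blast
    then interpret u: uniformized_point a "Aff x y" \<pi> .
    have "f \<in> function_field a" using C f unfolding function_field_def by blast
    then show "f \<in> local_ring a (Aff x y)" using u.ord_nonneg f0 reg[OF that] by blast
  qed
  have val: "poly A x0 + poly B x0 * affine_point.s0 a x0 y = 0" if y: "weq a x0 y = 0" for y
  proof -
    interpret affine_point a x0 y by (rule loc(1)[OF y])
    have "ev C \<in> MM" using pair_M_iff[of C 0] x0 by simp
    then have "ev C * f \<in> MM" using lp.M_mult[OF loc(2)[OF y], of "ev C"] by (simp add: mult.commute)
    then show ?thesis by (simp only: fe[symmetric] pair_M_iff)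
  qed
  interpret p0: affine_point a x0 y0 by (rule loc(1)[OF y0])
  interpret p1: affine_point a x0 y1 by (rule loc(1)[OF y1])
  have s: "p1.s0 = - p0.s0" unfolding p0.s0_def p1.s0_def by (simp add: y1_def)
  have v: "poly A x0 + poly B x0 * p0.s0 = 0" "poly A x0 - poly B x0 * p0.s0 = 0"
    using val[OF y0] val[OF y1] s by simp_all
  have "2 * poly A x0 = 0" using arg_cong2[OF v, of "(+)"] by simp
  then have A0: "poly A x0 = 0" by simp
  then have B0: "poly B x0 \<noteq> 0" using coprime[OF x0] by simp
  then have s0: "p0.s0 = 0" using v(1) A0 by simp
  then have d0: "poly (wdisc a) x0 = 0" using p0.s0_square by simp
  obtain A' where A': "A = [:- x0, 1:] * A'" using A0 unfolding poly_eq_0_iff_dvd by (elim dvdE)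
  obtain C' where C': "C = [:- x0, 1:] * C'" using x0 unfolding poly_eq_0_iff_dvd by (elim dvdE)
  obtain D where D: "wdisc a = [:- x0, 1:] * D" using d0 unfolding poly_eq_0_iff_dvd by (elim dvdE)
  have D0: "poly D x0 \<noteq> 0" using nonsing[OF d0] unfolding D pderiv_mult by (simp add: pderiv_pCons)
  let ?p = "ev [:- x0, 1:]"
  have s_nz: "sgen a \<noteq> 0" using ev_sgen_eq_0_iff[of 0 1 a] by simp
  have "ev B * sgen a = ?p * (ev C' * f - ev A')"
    using fe unfolding A' C' ev_mult by (simp add: algebra_simps)
  then have "ev B * sgen a * ev D = (?p * ev D) * (ev C' * f - ev A')" by simp
  also have "?p * ev D = sgen a * sgen a"
    using sgen_square[of a] D by (metis ev_mult power2_eq_square)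
  finally have "ev (B * D) = sgen a * (ev C' * f - ev A')"
    using s_nz by simp
  moreover have "sgen a \<in> local_max_ideal a (Aff x0 y0)"
    using p0.sgen_M s0 by simp
  moreover have "ev C' * f - ev A' \<in> local_ring a (Aff x0 y0)"
    using p0.lp.A_add[OF p0.lp.A_mult[OF p0.ev_A loc(2)[OF y0]] p0.ev_A[of "- A'"]] by simp
  ultimately have "ev (B * D) \<in> local_max_ideal a (Aff x0 y0)"
    using p0.lp.M_mult by (metis mult.commute)
  then have "poly (B * D) x0 = 0" using p0.pair_M_iff[of "B * D" 0] by simp
  then show False using B0 D0 by simp
qed

lemma zero_of_positive_order:
  fixes a :: "'k::field_char_0 wcoeffs"
  assumes nonsing: "poly (wdisc a) x = 0 \<Longrightarrow> poly (pderiv (wdisc a)) x \<noteq> 0"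
    and w: "weq a x y = 0" and AB: "A \<noteq> 0 \<or> B \<noteq> 0"
    and pos: "ord_at a (Aff x y) (ev A + ev B * sgen a) > 0"
  shows "poly A x + poly B x * (2 * y - poly (wp a) x) = 0"
proof -
  interpret affine_point a x y
    using w nonsing by unfold_locales (simp_all add: Aff_in_wpoints)
  obtain \<pi> where "uniformized_point a (Aff x y) \<pi>" using uniformized by blast
  then interpret u: uniformized_point a "Aff x y" \<pi> .
  have "ev A + ev B * sgen a = (ev A + ev B * sgen a) / ev 1" by simp
  then have "ev A + ev B * sgen a \<in> function_field a"
    unfolding function_field_def by (metis (mono_tags, lifting) CollectI one_neq_zero)
  then have "ev A + ev B * sgen a \<in> MM"
    using u.ord_pos pos AB by (simp add: ev_sgen_eq_0_iff)
  then show ?thesis by (simp add: pair_M_iff s0_def)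
qed


subsection \<open>Smoothness\<close>

definition weq_x :: "'k::comm_ring_1 wcoeffs \<Rightarrow> 'k \<Rightarrow> 'k \<Rightarrow> 'k" where
  "weq_x a x y = a1 a * y - (3 * x^2 + 2 * a2 a * x + a4 a)"

definition weq_y :: "'k::comm_ring_1 wcoeffs \<Rightarrow> 'k \<Rightarrow> 'k \<Rightarrow> 'k" where
  "weq_y a x y = 2 * y + a1 a * x + a3 a"

text \<open>By Euler's relation the derivative in z vanishes on the curve at z = 1 once the two
  affine derivatives do. This holds in every characteristic, in particular in characteristic
  2.\<close>

lemma smooth_weierstrass_affine:
  assumes s: "smooth_weierstrass a" and w: "weq (map_wcoeffs to_ac a) x y = 0"
  shows "weq_x (map_wcoeffs to_ac a) x y \<noteq> 0 \<or> weq_y (map_wcoeffs to_ac a) x y \<noteq> 0"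
proof (rule ccontr)
  assume n: "\<not> ?thesis"
  interpret t: field_map "to_ac :: 'a \<Rightarrow> 'a alg_closure" by (rule field_map_to_ac)
  let ?p = "vec3 x y 1"
  note d = t.meval_mderiv_wform[OF subset_UNIV, of ?p a]
  have "meval to_ac ?p (wform a) = 0" using w by (simp add: t.meval_wform_affine)
  moreover have "\<exists>i<3. ?p i \<noteq> 0" by (intro exI[of _ 2]) simp
  ultimately obtain i where i: "i < 3" "meval to_ac ?p (mderiv i (wform a)) \<noteq> 0"
    using s unfolding smooth_weierstrass_def by blast
  have x: "meval to_ac ?p (mderiv 0 (wform a)) = 0" and y: "meval to_ac ?p (mderiv 1 (wform a)) = 0"
    using n by (simp_all only: d) (simp_all add: weq_x_def weq_y_def wcoeffs_sel)
  have "meval to_ac ?p (mderiv 2 (wform a)) = 3 * weq (map_wcoeffs to_ac a) x y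
     - x * meval to_ac ?p (mderiv 0 (wform a)) - y * meval to_ac ?p (mderiv 1 (wform a))"
    unfolding d by (simp add: weq_def wcoeffs_sel power2_eq_square power3_eq_cube algebra_simps)
  then have z: "meval to_ac ?p (mderiv 2 (wform a)) = 0" using x y w by simp
  have "i = 0 \<or> i = 1 \<or> i = 2" using i by linarith
  then show False using i x y z by auto
qed

lemma weq_wdisc: "4 * weq a x y = weq_y a x y ^ 2 - poly (wdisc a) x"
  by (simp add: weq_def weq_y_def wdisc_def wp_def wq_def power2_eq_square power3_eq_cube algebra_simps)

lemma weq_x_wdisc: "4 * weq_x a x y = 2 * a1 a * weq_y a x y - poly (pderiv (wdisc a)) x"
  by (simp add: weq_x_def weq_y_def wdisc_def wp_def wq_def power2_eq_square pderiv_pCons pderiv_add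
      pderiv_mult numeral_poly algebra_simps)

text \<open>Above a double root of the discriminant lies a singular point: y is chosen with
  \<open>weq_y\<close> equal to 0, and completing the square makes the equation and the other
  derivative vanish as well.\<close>

lemma smooth_weierstrass_wdisc:
  fixes a :: "'k::field_char_0 wcoeffs"
  assumes s: "smooth_weierstrass a" and d: "poly (wdisc (map_wcoeffs to_ac a)) x = 0"
  shows "poly (pderiv (wdisc (map_wcoeffs to_ac a))) x \<noteq> 0"
proof
  assume d': "poly (pderiv (wdisc (map_wcoeffs to_ac a))) x = 0"
  let ?a = "map_wcoeffs to_ac a"
  define y where "y = - (a1 ?a * x + a3 ?a) / 2"
  have y: "weq_y ?a x y = 0" by (simp add: y_def weq_y_def)
  have "4 * weq ?a x y = 0" using weq_wdisc[of ?a x y] y d by simp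
  moreover have "4 * weq_x ?a x y = 0" using weq_x_wdisc[of ?a x y] y d' by simp
  ultimately show False using smooth_weierstrass_affine[OF s, of x y] y by simp
qed

section \<open>Separability of the discriminant in extension fields\<close>

lemma bezout_of_no_common_root:
  fixes A B :: "'k::field_gcd poly"
  assumes "\<And>x. poly (map_poly to_ac A) x = 0 \<Longrightarrow> poly (map_poly to_ac B) x \<noteq> 0"
  shows "\<exists>r s. r * A + s * B = 1"
proof -
  interpret t: field_map "to_ac :: 'k \<Rightarrow> 'k alg_closure" by (rule field_map_to_ac)
  obtain r s where rs: "r * A + s * B = gcd A B" using bezout_coefficients_fst_snd[of A B] by metis
  let ?g = "gcd A B"
  have "Polynomial.degree (map_poly to_ac ?g) = 0"
  proof (rule ccontr)
    assume "Polynomial.degree (map_poly to_ac ?g) \<noteq> 0"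
    then obtain x where x: "poly (map_poly to_ac ?g) x = 0" using alg_closed_imp_poly_has_root by blast
    obtain A' B' where "A = ?g * A'" "B = ?g * B'" by (meson dvdE gcd_dvd1 gcd_dvd2)
    then have "map_poly to_ac A = map_poly to_ac ?g * map_poly to_ac A'"
      "map_poly to_ac B = map_poly to_ac ?g * map_poly to_ac B'"
      by (metis t.map_poly_h_mult)+
    then show False using assms[of x] x by simp
  qed
  then obtain c where c: "?g = [:c:]" by (metis t.degree_map_poly_h degree_eq_zeroE)
  have "c \<noteq> 0"
  proof
    assume "c = 0"
    then have "A = 0" "B = 0" using c by simp_all
    then show False using assms[of 0] by simp
  qed
  then have "(smult (1/c) r) * A + (smult (1/c) s) * B = 1"
    using rs c by (simp flip: smult_add_right)
  then show ?thesis by blast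
qed

context field_map
begin

lemma map_poly_wdisc: "map_poly h (wdisc a) = wdisc (map_wcoeffs h a)"
  by (simp add: wdisc_def map_poly_wp map_poly_wq numeral_poly map_poly_h_smult)

lemma map_poly_pderiv_wdisc: "map_poly h (pderiv (wdisc a)) = pderiv (wdisc (map_wcoeffs h a))"
  by (intro poly_eqI) (simp add: coeff_map_poly coeff_pderiv flip: map_poly_wdisc)

end

text \<open>Smoothness is known over the closure of the rationals only. A Bezout identity between
  the discriminant and its derivative has rational coefficients and can be mapped to any
  field.\<close>

lemma wdisc_separable:
  fixes a :: "rat wcoeffs" and h :: "rat \<Rightarrow> 'b::field"
  assumes s: "smooth_weierstrass a" and h: "field_map h"
    and d: "poly (wdisc (map_wcoeffs h a)) x = 0"
  shows "poly (pderiv (wdisc (map_wcoeffs h a))) x \<noteq> 0"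
proof -
  obtain r t where rt: "r * wdisc a + t * pderiv (wdisc a) = 1"
    using bezout_of_no_common_root[of "wdisc a" "pderiv (wdisc a)"] smooth_weierstrass_wdisc[OF s]
    unfolding field_map.map_poly_wdisc[OF field_map_to_ac] field_map.map_poly_pderiv_wdisc[OF field_map_to_ac]
    by blast
  interpret h: field_map h by fact
  have "map_poly h (r * wdisc a + t * pderiv (wdisc a)) = 1" unfolding rt by simp
  then have "map_poly h r * wdisc (map_wcoeffs h a) + map_poly h t * pderiv (wdisc (map_wcoeffs h a)) = 1"
    by (simp only: h.map_poly_h_add h.map_poly_h_mult h.map_poly_wdisc h.map_poly_pderiv_wdisc)
  then have "poly (map_poly h r) x * poly (wdisc (map_wcoeffs h a)) x
     + poly (map_poly h t) x * poly (pderiv (wdisc (map_wcoeffs h a))) x = 1"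
    by (metis poly_add poly_mult poly_1)
  then show ?thesis using d by auto
qed

subsection \<open>The function of the double cover\<close>

lemma pmul_assoc: "pmul a (pmul a P Q) R = pmul a P (pmul a Q R)"
  by (cases P; cases Q; cases R) (simp add: algebra_simps)

lemma pmul_commute: "pmul a P Q = pmul a Q P"
  by (cases P; cases Q) (simp add: algebra_simps)

lemma pmul_scalar: "pmul a (C, 0) (A, B) = (C * A, C * B)"
  by simp

lemma pval_map_poly:
  assumes "field_map h" "field_map g"
  shows "pval (\<lambda>c. g (h c)) (A, B) x y = pval g (map_poly h A, map_poly h B) x y"
proof -
  interpret h: field_map h by fact
  interpret g: field_map g by fact
  have "map_poly (\<lambda>c. g (h c)) C = map_poly g (map_poly h C)" for C
    by (rule poly_eqI) (simp add: coeff_map_poly)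
  then show ?thesis by simp
qed

text \<open>Reduction to lowest terms with a certificate: the identity among the cofactors persists
  under field extension and there excludes common roots.\<close>

lemma bezout3:
  fixes A B C :: "rat poly"
  assumes "C \<noteq> 0"
  obtains d A' B' C' r s t where "A = d * A'" "B = d * B'" "C = d * C'" "d \<noteq> 0"
    "r * A' + s * B' + t * C' = 1"
proof -
  define d where "d = gcd (gcd A B) C"
  have d0: "d \<noteq> 0" using assms by (simp add: d_def)
  have "d dvd A" "d dvd B" "d dvd C" unfolding d_def by (meson dvd_trans gcd_dvd1 gcd_dvd2)+
  then obtain A' B' C' where d: "A = d * A'" "B = d * B'" "C = d * C'" by (elim dvdE)
  obtain r s where rs: "r * A + s * B = gcd A B" using bezout_coefficients_fst_snd[of A B] by metis
  obtain u t where ut: "u * gcd A B + t * C = d"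
    using bezout_coefficients_fst_snd[of "gcd A B" C] unfolding d_def by metis
  have "d * (u * r * A' + u * s * B' + t * C') = u * (r * A + s * B) + t * C"
    unfolding d by (simp add: algebra_simps)
  also have "\<dots> = d * 1" unfolding rs ut by simp
  finally have "u * r * A' + u * s * B' + t * C' = 1" using d0 by (simp only: mult_cancel_left simp_thms)
  then show ?thesis using that d d0 by blast
qed

lemma degree_le_1_pCons: "Polynomial.degree A \<le> 1 \<Longrightarrow> \<exists>c0 c1. A = [:c0, c1:]"
  by (metis One_nat_def degree_eq_zeroE degree_pCons_eq_if le_0_eq le_Suc_eq nat.inject pCons_cases pCons_0_0 zero_le_one le_zero_eq)

text \<open>This replaces Riemann-Roch. F / G is brought to the form (A' + B' s) / C' over the
  rationals; regularity at affine points, tested over the closure, makes C' constant, and the triple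
  pole bounds the degrees. The result is an identity of rational pairs, ready for evaluation over
  the 2-adic numbers.\<close>

lemma function_with_triple_pole:
  fixes a :: "rat wcoeffs"
  assumes smooth: "smooth_weierstrass a"
    and F: "F \<in> forms UNIV 3 d" and G: "G \<in> forms UNIV 3 d"
    and Fnz: "meval ffc_const (wgeneric a) F \<noteq> 0" and Gnz: "meval ffc_const (wgeneric a) G \<noteq> 0"
    and pole: "div_of a F G Infty = - 3"
    and reg: "\<And>x y. div_of a F G (Aff x y) \<ge> 0"
  obtains c0 c1 c2 where "c2 \<noteq> 0" "wred a F = pmul a (wred a G) ([:c0, c1:], [:c2:])"
    "\<And>x y. weq (geom a) x y = 0 \<Longrightarrow> div_of a F G (Aff x y) > 0 \<Longrightarrow>
       to_ac c0 + to_ac c1 * x + to_ac c2 * y = 0"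
proof -
  interpret t: field_map "to_ac :: rat \<Rightarrow> rat alg_closure" by (rule field_map_to_ac)
  interpret c: field_map "ffc_const :: rat alg_closure \<Rightarrow> rat alg_closure ffc" by (rule field_map_ffc_const)
  let ?K = "geom a"
  let ?h = "\<lambda>q. ffc_const (to_ac q) :: rat alg_closure ffc"
  let ?X = "ffc_t :: rat alg_closure ffc" and ?Y = "wgeneric ?K 1"
  let ?m = "map_poly (to_ac :: rat \<Rightarrow> rat alg_closure)"
  have ht: "field_map ?h" by (rule field_map_comp[OF field_map_ffc_const field_map_to_ac])
  interpret h: field_map ?h by (rule ht)
  have Km: "map_wcoeffs ffc_const ?K = map_wcoeffs ?h a" by (cases a) (simp add: geom_def)
  have wK: "weq (map_wcoeffs ?h a) ?X ?Y = 0" using weq_wgeneric[of ?K] unfolding Km .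
  have FG3: "F \<in> mpolys UNIV 3" "G \<in> mpolys UNIV 3" using F G by (simp_all add: forms_def)
  have Fp: "wred a F \<noteq> (0, 0)" and Gp: "wred a G \<noteq> (0, 0)"
    using Fnz Gnz unfolding meval_wgeneric[OF FG3(1)] meval_wgeneric[OF FG3(2)] by auto
  obtain G0 G1 where G01: "wred a G = (G0, G1)" by force
  define N where "N = pnorm a (wred a G)"
  have N0: "N \<noteq> 0" using pnorm_eq_0[of a "wred a G"] Gp unfolding N_def by blast
  let ?conj = "(G0 + G1 * wp a, - G1)"
  have GN: "pmul a (wred a G) ?conj = (N, 0)"
    unfolding N_def G01 by (simp add: power2_eq_square algebra_simps)
  obtain H0 H1 where H: "pmul a (wred a F) ?conj = (H0, H1)" by force
  \<comment> \<open>With H = F conj(G) and N = G conj(G), the quotient F / G equals H / N, whose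
    denominator is a polynomial in x.\<close>
  have key: "pmul a (wred a G) (H0, H1) = pmul a (N, 0) (wred a F)"
    unfolding H[symmetric] GN[symmetric] by (metis pmul_assoc pmul_commute)
  \<comment> \<open>Passage from y to s by y = (s + \<open>wp\<close>) / 2, so that A + B s = H0 +
    H1 y.\<close>
  define A where "A = H0 + smult (1/2) (H1 * wp a)"
  define B where "B = smult (1/2) H1"
  obtain g A' B' C' r s t where b: "A = g * A'" "B = g * B'" "N = g * C'" "g \<noteq> 0"
    "r * A' + s * B' + t * C' = 1" by (rule bezout3[OF N0, of A B])
  have H1: "H1 = g * (2 * B')"
  proof -
    have "H1 = 2 * B" by (simp add: B_def numeral_poly)
    then show ?thesis unfolding b(2) by (simp only: mult.left_commute)
  qed
  have H0: "H0 = g * (A' - B' * wp a)"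
    using b(1) unfolding A_def H1 by (simp add: algebra_simps smult_add_right numeral_poly)
  have key2: "pmul a (wred a G) (A' - B' * wp a, 2 * B') = pmul a (C', 0) (wred a F)"
  proof -
    have "pmul a (g, 0) (pmul a (wred a G) (A' - B' * wp a, 2 * B')) = pmul a (g, 0) (pmul a (C', 0) (wred a F))"
    proof -
      have "pmul a (g, 0) (pmul a (wred a G) (A' - B' * wp a, 2 * B'))
          = pmul a (wred a G) (pmul a (g, 0) (A' - B' * wp a, 2 * B'))"
        by (metis pmul_assoc pmul_commute)
      also have "pmul a (g, 0) (A' - B' * wp a, 2 * B') = (H0, H1)" unfolding pmul_scalar H0 H1 ..
      also have "pmul a (wred a G) (H0, H1) = pmul a (pmul a (g, 0) (C', 0)) (wred a F)"
        unfolding key b(3) by simp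
      finally show ?thesis by (simp only: pmul_assoc)
    qed
    then show ?thesis using b(4)
      by (cases "pmul a (wred a G) (A' - B' * wp a, 2 * B')"; cases "pmul a (C', 0) (wred a F)")
        (simp only: pmul_scalar prod.inject mult_cancel_left simp_thms)
  qed
  have C0: "C' \<noteq> 0" using b(3) N0 by auto
  define f where "f = ratfun ?K (Poly_Mapping.map to_ac F) (Poly_Mapping.map to_ac G)"
  have val: "meval ffc_const (wgeneric ?K) (Poly_Mapping.map to_ac M) = pval ?h (wred a M) ?X ?Y"
    if "M \<in> mpolys UNIV 3" for M
    unfolding t.meval_map[OF field_map_ffc_const]
    by (subst wgeneric_vec3) (rule h.meval_affine[OF wK that])
  have pvm: "pval ?h (U, V) ?X ?Y = pval ffc_const (?m U, ?m V) ?X ?Y" for U V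
    by (rule pval_map_poly[OF field_map_to_ac field_map_ffc_const])
  have nz: "pval ?h U ?X ?Y \<noteq> 0" if U: "U \<noteq> (0, 0)" for U
  proof
    assume z: "pval ?h U ?X ?Y = 0"
    obtain V W where UV: "U = (V, W)" by force
    have "(?m V, ?m W) = (0, 0)"
      using z generic_wgeneric[of ?K] unfolding generic_xy_def UV pvm by blast
    then show False using U UV by simp
  qed
  have fG: "f * pval ?h (wred a G) ?X ?Y = pval ?h (wred a F) ?X ?Y"
    using nz[OF Gp] by (simp add: f_def ratfun_def val FG3)
  have f0: "f \<noteq> 0" using fG nz[OF Fp] by auto
  have m2: "?m 2 = 2" by (simp add: numeral_poly)
  have pv: "pval ?h (A' - B' * wp a, 2 * B') ?X ?Y = ev (?m A') + ev (?m B') * sgen ?K"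
    unfolding pvm by (simp add: sgen_def t.map_poly_wp m2 flip: ev_def geom_def) (simp add: algebra_simps)
  have pvC: "pval ?h (C', 0) ?X ?Y = ev (?m C')"
    unfolding pvm by (simp flip: ev_def)
  have evC: "ev (?m C') \<noteq> 0" using C0 by simp
  have "pval ?h (wred a G) ?X ?Y * (ev (?m A') + ev (?m B') * sgen ?K)
      = ev (?m C') * (f * pval ?h (wred a G) ?X ?Y)"
    using arg_cong[OF key2, of "\<lambda>P. pval ?h P ?X ?Y"]
    unfolding h.pval_pmul[OF wK] pv pvC fG .
  then have "ev (?m A') + ev (?m B') * sgen ?K = ev (?m C') * f" using nz[OF Gp] by (simp add: mult.left_commute)
  then have fe: "f = (ev (?m A') + ev (?m B') * sgen ?K) / ev (?m C')" using evC by (simp add: field_simps)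
  have ns: "poly (pderiv (wdisc ?K)) x \<noteq> 0" if "poly (wdisc ?K) x = 0" for x
    using smooth_weierstrass_wdisc[OF smooth] that by (simp add: geom_def)
  have divf: "div_of a F G Q = ord_at ?K Q f" if "Q \<in> wpoints ?K" for Q
    using that by (simp add: div_of_def f_def)
  \<comment> \<open>A common root in the closure would contradict the mapped Bezout identity, whose
    value is 1 everywhere.\<close>
  have "Polynomial.degree (?m C') = 0"
  proof (rule regular_denominator[OF ns _ _ fe f0])
    fix x assume "poly (?m C') x = 0"
    moreover have "poly (?m (r * A' + s * B' + t * C')) x = 1" unfolding b(5) by simp
    ultimately show "poly (?m A') x \<noteq> 0 \<or> poly (?m B') x \<noteq> 0" by auto
  next
    show "?m C' \<noteq> 0" using C0 by simp
  next
    fix x y assume "weq ?K x y = 0"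
    then show "ord_at ?K (Aff x y) f \<ge> 0" using reg[of x y] divf[of "Aff x y"] by (simp add: Aff_in_wpoints)
  qed simp_all
  then obtain c where c: "C' = [:c:]" by (metis t.degree_map_poly_h degree_eq_zeroE)
  then have cz: "c \<noteq> 0" using C0 by auto
  define A1 where "A1 = smult (1/c) A'"
  define B1 where "B1 = smult (1/c) B'"
  have AB1: "A' = smult c A1" "B' = smult c B1" using cz by (simp_all add: A1_def B1_def)
  have fe1: "f = ev (?m A1) + ev (?m B1) * sgen ?K"
    unfolding fe AB1 c by (simp add: t.map_poly_h_smult ev_smult ev_const cz add_divide_distrib)
  have AB1z: "?m A1 \<noteq> 0 \<or> ?m B1 \<noteq> 0" using f0 unfolding fe1 by (auto simp: ev_sgen_eq_0_iff)
  interpret I: infinite_point ?K by unfold_locales (rule Infty_in_wpoints)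
  have deg: "B1 \<noteq> 0 \<and> Polynomial.degree B1 = 0 \<and> Polynomial.degree A1 \<le> 1"
    using I.ord_pair[of "?m A1" "?m B1"] pole divf[OF Infty_in_wpoints] fe1 AB1z by simp
  obtain e where e: "B1 = [:e:]" using deg by (metis degree_eq_zeroE)
  have ez: "e \<noteq> 0" using deg e by auto
  have "Polynomial.degree (A1 - B1 * wp a) \<le> 1"
    unfolding e using deg degree_wp[of a] by (intro degree_diff_le) (auto intro: order_trans[OF degree_smult_le])
  then obtain c0 c1 where c01: "A1 - B1 * wp a = [:c0, c1:]" using degree_le_1_pCons by blast
  show ?thesis
  proof (rule that[of "2 * e" c0 c1])
    show "2 * e \<noteq> 0" using ez by simp
    have "pmul a (c1', 0) (pmul a (wred a G) ([:c0, c1:], [:2 * e:])) = pmul a (wred a G) (pmul a (c1', 0) ([:c0, c1:], [:2 * e:]))" for c1'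
      by (metis pmul_assoc pmul_commute)
    moreover have "pmul a (C', 0) ([:c0, c1:], [:2 * e:]) = (A' - B' * wp a, 2 * B')"
      unfolding pmul_scalar c01[symmetric] unfolding c AB1 e by (simp add: smult_diff_right numeral_poly)
    ultimately have "pmul a (C', 0) (pmul a (wred a G) ([:c0, c1:], [:2 * e:])) = pmul a (C', 0) (wred a F)"
      unfolding key2[symmetric] by simp
    then show "wred a F = pmul a (wred a G) ([:c0, c1:], [:2 * e:])"
      using C0 by (cases "wred a F"; cases "pmul a (wred a G) ([:c0, c1:], [:2 * e:])") (simp add: pmul_scalar)
  next
    fix x y assume xy: "weq ?K x y = 0" and pos: "div_of a F G (Aff x y) > 0"
    have "ord_at ?K (Aff x y) (ev (?m A1) + ev (?m B1) * sgen ?K) > 0"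
      using pos divf[of "Aff x y"] xy fe1 by (simp add: Aff_in_wpoints)
    from zero_of_positive_order[OF ns xy AB1z this]
    have z: "poly (?m A1) x + poly (?m B1) x * (2 * y - poly (wp ?K) x) = 0" by blast
    have "poly (?m (A1 - B1 * wp a)) x = poly (?m [:c0, c1:]) x" unfolding c01 ..
    then have "poly (?m A1) x - poly (?m B1) x * poly (wp ?K) x = to_ac c0 + to_ac c1 * x"
      by (simp add: t.map_poly_wp geom_def algebra_simps)
    moreover have "poly (?m B1) x = to_ac e" by (simp add: e)
    ultimately show "to_ac c0 + to_ac c1 * x + to_ac (2 * e) * y = 0"
      using z by (simp add: algebra_simps)
  qed
qed


section \<open>Arithmetic of the 2-adic numbers\<close>

lemma norm_q2_approx:
  assumes "e > 0"
  shows "\<exists>r. norm_q2 (x - of_rat r) < e"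
proof (induction x rule: q2.abs_induct)
  case (1 U)
  then have U: "cauchy2 U" by (simp add: q2rel_def)
  have e2: "e / 2 > 0" using assms by simp
  then obtain N where N: "\<forall>m\<ge>N. \<forall>n\<ge>N. abs2_rat (U m - U n) < e / 2" using U unfolding cauchy2_def by blast
  let ?V = "\<lambda>n. U n + - U N"
  have V: "cauchy2 ?V" using cauchy2_add[OF U cauchy2_const] .
  have "abs_q2 U - of_rat (U N) = abs_q2 ?V"
    using 1 by (simp add: minus_q2_def of_rat_q2 uminus_q2.abs_eq plus_q2.abs_eq)
  then have n: "norm_q2 (abs_q2 U - of_rat (U N)) = lim (\<lambda>n. abs2_rat (?V n))"
    using V by (simp add: norm_q2.abs_eq q2rel_def)
  have "lim (\<lambda>n. abs2_rat (?V n)) \<le> e / 2"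
    by (rule LIMSEQ_le_const2[OF cauchy2_LIMSEQ_abs[OF V]]) (use N in \<open>auto intro!: exI[of _ N] less_imp_le\<close>)
  then show ?case using n assms by (intro exI[of _ "U N"]) simp
qed

lemma norm_q2_0 [simp]: "norm_q2 0 = 0"
  by (simp add: norm_q2_eq_0_iff)

lemma norm_q2_1 [simp]: "norm_q2 1 = 1"
  using norm_q2_of_rat[of 1] by simp

lemma norm_q2_uminus [simp]: "norm_q2 (- x) = norm_q2 x"
  using norm_q2_mult[of "- 1" x] norm_q2_of_rat[of "- 1"] by (simp add: of_rat_minus)

lemma norm_q2_diff_ultra: "norm_q2 (x - y) \<le> max (norm_q2 x) (norm_q2 y)"
  using norm_q2_ultra[of x "- y"] by simp

lemma norm_q2_nonneg [simp]: "norm_q2 x \<ge> 0"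
  using norm_q2_ultra[of x "- x"] by simp

lemma norm_q2_add_eq:
  assumes "norm_q2 y < norm_q2 x"
  shows "norm_q2 (x + y) = norm_q2 x"
  using norm_q2_ultra[of x y] norm_q2_diff_ultra[of "x + y" y] assms by (simp add: max_def split: if_splits)

lemma norm_q2_pos: "x \<noteq> 0 \<Longrightarrow> norm_q2 x > 0"
  using norm_q2_nonneg[of x] norm_q2_eq_0_iff[of x] by linarith

lemma norm_q2_approx_eq:
  assumes "x \<noteq> 0" "norm_q2 (x - of_rat r) < norm_q2 x"
  shows "norm_q2 x = abs2_rat r"
proof -
  have "of_rat r = x + - (x - of_rat r)" by simp
  then have "norm_q2 (of_rat r) = norm_q2 x"
    using norm_q2_add_eq[of "- (x - of_rat r)" x] assms(2) by (simp only: norm_q2_uminus)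
  then show ?thesis by (simp add: norm_q2_of_rat)
qed

lemma norm_q2_discrete:
  assumes "x \<noteq> 0"
  shows "\<exists>n::int. norm_q2 x = 2 powi n"
proof -
  obtain r where "norm_q2 (x - of_rat r) < norm_q2 x" using norm_q2_approx[OF norm_q2_pos[OF assms]] by blast
  then have n: "norm_q2 x = abs2_rat r" by (rule norm_q2_approx_eq[OF assms])
  then have "r \<noteq> 0" using assms by (auto simp: norm_q2_eq_0_iff)
  then show ?thesis unfolding n by (auto simp: abs2_rat_def)
qed

lemma val_q2_int:
  assumes "x \<noteq> 0"
  shows "\<exists>n::int. val_q2 x = ereal (of_int n)"
proof -
  obtain n :: int where "norm_q2 x = 2 powi n" using norm_q2_discrete assms by blast
  then have "val_q2 x = ereal (of_int (- n))"
    using assms by (simp add: val_q2_def powr_real_of_int'[symmetric])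
  then show ?thesis by blast
qed

lemma Z2_iff: "x \<in> Z2 \<longleftrightarrow> norm_q2 x \<le> 1"
proof (cases "x = 0")
  case False
  then show ?thesis using norm_q2_pos[of x] by (simp add: Z2_def val_q2_def)
qed (simp add: Z2_def val_q2_def)

lemma val_q2_pos_iff: "val_q2 x > 0 \<longleftrightarrow> norm_q2 x < 1"
proof (cases "x = 0")
  case False
  then show ?thesis using norm_q2_pos[of x] by (simp add: val_q2_def)
qed (simp add: val_q2_def)

lemma reduce2_iff: "reduce2 x = (if norm_q2 x < 1 then 0 else 1)"
  by (simp add: reduce2_def val_q2_pos_iff)

lemma abs2_rat_of_int_le: "abs2_rat (of_int n) \<le> 1"
proof (cases "n = 0")
  case False
  have "val2_rat (of_int n) \<ge> 0" using val2_rat_divide[of n 1] False by simp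
  then have "(2::real) powi (- val2_rat (of_int n)) \<le> 2 powi 0" by (intro power_int_increasing) auto
  then show ?thesis using False by (simp add: abs2_rat_def)
qed simp

lemma abs2_rat_odd: "odd n \<Longrightarrow> abs2_rat (of_int n) = 1"
proof -
  assume n: "odd n"
  then have "multiplicity 2 n = 0" by (simp add: not_dvd_imp_multiplicity_0)
  moreover have "n \<noteq> 0" using n by auto
  ultimately show ?thesis using val2_rat_divide[of n 1] by (simp add: abs2_rat_def)
qed

lemma val2_rat_2: "val2_rat 2 = 1"
  using val2_rat_divide[of 2 1] by simp

lemma abs2_rat_2: "abs2_rat 2 = 1/2"
  by (simp add: abs2_rat_def val2_rat_2)

lemma abs2_rat_4: "abs2_rat 4 = 1/4"
  using abs2_rat_mult[of 2 2] by (simp add: abs2_rat_2)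

lemma abs2_rat_eq_1:
  assumes "abs2_rat r = 1"
  obtains m n where "odd m" "odd n" "r = of_int m / of_int n"
proof -
  obtain m n where mn: "quotient_of r = (m, n)" by force
  have n: "n > 0" and r: "r = of_int m / of_int n" and cop: "coprime m n"
    using quotient_of_denom_pos[OF mn] quotient_of_div[OF mn] quotient_of_coprime[OF mn] by auto
  have "r \<noteq> 0" using assms by auto
  then have m: "m \<noteq> 0" using r by auto
  have "(2::real) powi (- val2_rat r) = 1" using assms \<open>r \<noteq> 0\<close> by (simp add: abs2_rat_def)
  then have "(2::real) powr of_int (- val2_rat r) = 1" by (subst powr_real_of_int') auto
  then have "val2_rat r = 0" by (simp add: powr_eq_one_iff)
  then have e: "multiplicity 2 m = multiplicity 2 n" using val2_rat_divide[OF m, of n] n r by simp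
  have "\<not> (even m \<and> even n)" using cop by (metis coprime_common_divisor odd_one)
  moreover have "even m \<longleftrightarrow> even n"
    using e m n multiplicity_gt_zero_iff[of m 2] multiplicity_gt_zero_iff[of n 2] by simp
  ultimately show ?thesis using that r by blast
qed

text \<open>A unit is close to a rational m / n with m and n odd, and then 4 divides m - n or m + n.
  The second claim follows because x - 1 and x + 1 differ by 2.\<close>

lemma unit_mod_4:
  assumes "norm_q2 x = 1"
  shows "norm_q2 (x - 1) \<le> 1/4 \<or> norm_q2 (x + 1) \<le> 1/4" and "norm_q2 (x - 1) < 1"
proof -
  have x0: "x \<noteq> 0" using assms by auto
  obtain r where r: "norm_q2 (x - of_rat r) < 1/4" using norm_q2_approx[of "1/4"] by auto
  then have "abs2_rat r = 1" using norm_q2_approx_eq[OF x0, of r] assms by simp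
  then obtain m n where mn: "odd m" "odd n" "r = of_int m / of_int n" by (rule abs2_rat_eq_1)
  have n: "of_int n \<noteq> (0::rat)" using mn(2) by auto
  have le: "abs2_rat (of_int (4 * k) / of_int n) \<le> 1/4" for k
  proof -
    have "abs2_rat (of_int (4 * k) / of_int n) = abs2_rat 4 * abs2_rat (of_int k) * inverse (abs2_rat (of_int n))"
      by (simp add: divide_inverse abs2_rat_mult abs2_rat_inverse)
    also have "\<dots> = 1/4 * abs2_rat (of_int k)" by (simp add: abs2_rat_4 abs2_rat_odd[OF mn(2)])
    finally show ?thesis using abs2_rat_of_int_le[of k] by simp
  qed
  have "4 dvd m - n \<or> 4 dvd m + n" using mn(1,2) by presburger
  then have rr: "abs2_rat (r - 1) \<le> 1/4 \<or> abs2_rat (r + 1) \<le> 1/4"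
  proof
    assume "4 dvd m - n"
    then obtain k where "m - n = 4 * k" by blast
    then have "r - 1 = of_int (4 * k) / of_int n" using mn(3) n by (simp flip: \<open>m - n = 4 * k\<close> add: diff_divide_distrib)
    then show ?thesis using le by metis
  next
    assume "4 dvd m + n"
    then obtain k where "m + n = 4 * k" by blast
    then have "r + 1 = of_int (4 * k) / of_int n" using mn(3) n by (simp flip: \<open>m + n = 4 * k\<close> add: add_divide_distrib)
    then show ?thesis using le by metis
  qed
  have 1: "x - 1 = (x - of_rat r) + of_rat (r - 1)" "x + 1 = (x - of_rat r) + of_rat (r + 1)"
    by (simp_all add: of_rat_diff of_rat_add)
  have "norm_q2 (x - 1) \<le> max (norm_q2 (x - of_rat r)) (abs2_rat (r - 1))"
    "norm_q2 (x + 1) \<le> max (norm_q2 (x - of_rat r)) (abs2_rat (r + 1))"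
    unfolding 1 by (metis norm_q2_ultra norm_q2_of_rat)+
  then show d: "norm_q2 (x - 1) \<le> 1/4 \<or> norm_q2 (x + 1) \<le> 1/4" using rr r by linarith
  have "norm_q2 2 = 1/2" using norm_q2_of_rat[of 2] by (simp add: abs2_rat_2)
  then have "norm_q2 (x - 1) \<le> max (norm_q2 (x + 1)) (1/2)" using norm_q2_diff_ultra[of "x + 1" 2] by simp
  then show "norm_q2 (x - 1) < 1" using d by linarith
qed

text \<open>Both x and -y are congruent to 1, the only nonzero class modulo 2. This is the case of
  two units in the additivity of \<open>reduce2\<close>.\<close>

lemma norm_q2_unit_sum:
  assumes "norm_q2 x = 1" "norm_q2 y = 1"
  shows "norm_q2 (x + y) < 1"
proof -
  have "x + y = (x - 1) - (- y - 1)" by simp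
  then have "norm_q2 (x + y) \<le> max (norm_q2 (x - 1)) (norm_q2 (- y - 1))" by (metis norm_q2_diff_ultra)
  then show ?thesis using unit_mod_4(2)[of x] unit_mod_4(2)[of "- y"] assms by simp
qed

interpretation Z2: coeff_ring Z2
proof
  fix a b assume "a \<in> Z2" "b \<in> Z2"
  then show "a + b \<in> Z2" "a * b \<in> Z2"
    using norm_q2_ultra[of a b] by (auto simp: Z2_iff norm_q2_mult mult_le_one)
qed (auto simp: Z2_iff)

interpretation reduce2: coeff_hom Z2 reduce2
proof
  fix a b assume ab: "a \<in> Z2" "b \<in> Z2"
  then have n: "norm_q2 a \<le> 1" "norm_q2 b \<le> 1" by (simp_all add: Z2_iff)
  show "reduce2 (a * b) = reduce2 a * reduce2 b"
  proof -
    have "norm_q2 a * norm_q2 b < 1 \<longleftrightarrow> norm_q2 a < 1 \<or> norm_q2 b < 1"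
    proof (cases "norm_q2 a = 1")
      case False
      then have "norm_q2 a * norm_q2 b \<le> norm_q2 a" "norm_q2 a < 1"
        using n mult_left_mono[of "norm_q2 b" 1 "norm_q2 a"] by auto
      then show ?thesis by auto
    qed simp
    then show ?thesis by (auto simp: reduce2_iff norm_q2_mult)
  qed
  show "reduce2 (a + b) = reduce2 a + reduce2 b"
  proof -
    have "norm_q2 (a + b) < 1" if "norm_q2 a < 1" "norm_q2 b < 1" using norm_q2_ultra[of a b] that by simp
    moreover have "norm_q2 (a + b) = 1" if "norm_q2 a < 1" "norm_q2 b = 1"
      using norm_q2_add_eq[of a b] that by (simp add: add.commute)
    moreover have "norm_q2 (a + b) = 1" if "norm_q2 a = 1" "norm_q2 b < 1"
      using norm_q2_add_eq[of b a] that by simp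
    moreover have "norm_q2 (a + b) < 1" if "norm_q2 a = 1" "norm_q2 b = 1"
      using norm_q2_unit_sum that by blast
    moreover have "norm_q2 a < 1 \<or> norm_q2 a = 1" "norm_q2 b < 1 \<or> norm_q2 b = 1" using n by linarith+
    ultimately show ?thesis by (auto simp: reduce2_iff)
  qed
qed (auto simp: reduce2_iff)

lemma coeff_hom_reduce2: "coeff_hom Z2 (\<lambda>c. to_ac (reduce2 c))"
  by unfold_locales (simp_all only: reduce2.h_add reduce2.h_mult reduce2.h0 reduce2.h1 to_ac_add to_ac_mult to_ac_0 to_ac_1)

lemma coeff_hom_Z2_field_map:
  assumes "field_map (h :: q2 \<Rightarrow> 'b::field)"
  shows "coeff_hom Z2 h"
proof -
  interpret field_map h by fact
  show ?thesis by unfold_locales simp_all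
qed

text \<open>Twisting by signs and powers of 2 makes every 2-adic number congruent to 1 modulo 4, which is
  enough to remove the ramification; no square roots in the 2-adic numbers are needed.\<close>

lemma twist_to_1_mod_4:
  assumes "c \<noteq> 0"
  shows "\<exists>d::rat. d \<noteq> 0 \<and> (\<exists>m\<in>Z2. of_rat d * c = 1 + 4 * m)"
proof -
  obtain n :: int where n: "norm_q2 c = 2 powi n" using norm_q2_discrete assms by blast
  have p: "abs2_rat (2 powi n) = 2 powi (- n)"
  proof (cases "n \<ge> 0")
    case True
    have "abs2_rat (2 ^ k) = (1/2) ^ k" for k by (induction k) (auto simp: abs2_rat_mult abs2_rat_2)
    then show ?thesis using True by (simp add: power_int_def power_one_over)
  next
    case False
    have "abs2_rat (2 ^ k) = (1/2) ^ k" for k by (induction k) (auto simp: abs2_rat_mult abs2_rat_2)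
    moreover have "(2::rat) powi n = inverse (2 ^ nat (- n))"
      using False by (simp add: power_int_def power_one_over inverse_eq_divide)
    ultimately show ?thesis using False by (simp only: abs2_rat_inverse) (simp add: power_int_def power_one_over)
  qed
  \<comment> \<open>The norm of 2^n is 2^(-n), so this product is a unit; its sign is chosen below
    to make it 1 modulo 4.\<close>
  let ?x = "of_rat (2 powi n) * c"
  have "norm_q2 ?x = 1"
    unfolding norm_q2_mult norm_q2_of_rat n p by (simp add: power_int_minus)
  then consider "norm_q2 (?x - 1) \<le> 1/4" | "norm_q2 (- ?x - 1) \<le> 1/4"
    using unit_mod_4(1)[of ?x] norm_q2_uminus[of "?x + 1"] by (metis minus_add_distrib uminus_add_conv_diff add.commute)
  then obtain s :: rat where s: "s \<noteq> 0" "norm_q2 (of_rat s * c - 1) \<le> 1/4"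
  proof cases
    case 1
    then show ?thesis using that[of "2 powi n"] by simp
  next
    case 2
    then show ?thesis using that[of "- (2 powi n)"] by (simp add: of_rat_minus)
  qed
  let ?m = "(of_rat s * c - 1) / 4"
  have n4: "norm_q2 4 = 1/4" using norm_q2_of_rat[of 4] by (simp add: abs2_rat_4)
  have "norm_q2 (4 * inverse 4) = 1" by (subst right_inverse) simp_all
  then have "1/4 * norm_q2 (inverse 4) = 1" unfolding norm_q2_mult n4 .
  then have "norm_q2 (inverse 4) = 4" by linarith
  then have "norm_q2 ?m = norm_q2 (of_rat s * c - 1) * 4"
    by (simp only: divide_inverse norm_q2_mult)
  then have "?m \<in> Z2" using s(2) by (simp add: Z2_iff)
  moreover have "4 * ?m = of_rat s * c - 1"
    unfolding times_divide_eq_right by (rule nonzero_mult_div_cancel_left) simp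
  then have "of_rat s * c = 1 + 4 * ?m" by (simp only: add_diff_cancel_left' diff_add_cancel add.commute[of 1])
  ultimately show ?thesis using s(1) by blast
qed

section \<open>The valuation on the algebraic closure\<close>

locale ext_val =
  fixes v :: "q2 alg_closure \<Rightarrow> ereal"
  assumes v: "extends_val2 v"
begin

lemma v_0 [simp]: "v 0 = \<infinity>" and v_fin: "c \<noteq> 0 \<Longrightarrow> \<bar>v c\<bar> \<noteq> \<infinity>" and v_mult: "v (c * d) = v c + v d"
  and v_add: "min (v c) (v d) \<le> v (c + d)" and v_to_ac: "v (to_ac e) = val_q2 e"
  using v unfolding extends_val2_def by auto

lemma v_1 [simp]: "v 1 = 0"
  using v_to_ac[of 1] by (simp add: val_q2_def)

lemma v_uminus [simp]: "v (- c) = v c"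
proof -
  have "v (- 1) = 0" using v_to_ac[of "- 1"] by (simp add: val_q2_def)
  then show ?thesis using v_mult[of "- 1" c] by simp
qed

lemma v_real: "c \<noteq> 0 \<Longrightarrow> \<exists>r. v c = ereal r"
  using v_fin[of c] by (cases "v c") auto

lemma v_add_gt: "t < v c \<Longrightarrow> t < v d \<Longrightarrow> t < v (c + d)"
  using v_add[of c d] by (simp add: min_def split: if_splits)

lemma v_diff_gt: "t < v c \<Longrightarrow> t < v d \<Longrightarrow> t < v (c - d)"
  using v_add_gt[of t c "- d"] by simp

lemma v_add_eq: "v c < v d \<Longrightarrow> v (c + d) = v c"
  using v_add[of c d] v_add[of "c + d" "- d"] by (auto simp: min_def split: if_splits)

lemma v_power: "c \<noteq> 0 \<Longrightarrow> v c = ereal r \<Longrightarrow> v (c ^ n) = ereal (of_nat n * r)"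
  by (induction n) (auto simp: v_mult algebra_simps)

lemma v_Z2: "e \<in> Z2 \<Longrightarrow> v (to_ac e) \<ge> 0"
  by (simp add: v_to_ac Z2_def)

lemma v_2: "v 2 = 1"
proof -
  have "(2::q2) \<noteq> 0" by simp
  then have "val_q2 2 = 1" using val_q2_of_rat[of 2] by (simp add: val2_rat_2)
  then show ?thesis using v_to_ac[of 2] by simp
qed

lemma v_3: "v 3 = 0"
proof -
  have "abs2_rat 3 = 1" using abs2_rat_odd[of 3] by simp
  then have "val_q2 3 = 0" using norm_q2_of_rat[of 3] by (simp add: val_q2_def)
  then show ?thesis using v_to_ac[of 3] by simp
qed

end


section \<open>A plane quartic\<close>

text \<open>Eliminating \<open>y = e (v\<^sup>2 + v) - al x - be\<close> from the Weierstrass equation gives a plane quartic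
  in \<open>x\<close> and \<open>v\<close>; the variables are \<open>x = mvar 0\<close>, \<open>v = mvar 1\<close>, \<open>z = mvar 2\<close>.\<close>

definition quartic_y :: "'k::comm_ring_1 \<Rightarrow> 'k \<Rightarrow> 'k \<Rightarrow> 'k mpoly" where
  "quartic_y e al be = mconst e * (mvar 1 ^ 2 + mvar 1 * mvar 2) - mconst al * (mvar 0 * mvar 2) - mconst be * mvar 2 ^ 2"

definition quartic :: "'k::comm_ring_1 wcoeffs \<Rightarrow> 'k \<Rightarrow> 'k \<Rightarrow> 'k \<Rightarrow> 'k mpoly" where
  "quartic b e al be = (let y = quartic_y e al be; x = mvar 0; z = mvar 2 in
     y ^ 2 + mconst (a1 b) * (x * z * y) + mconst (a3 b) * (z ^ 2 * y)
     - (x ^ 3 * z + mconst (a2 b) * (x ^ 2 * z ^ 2) + mconst (a4 b) * (x * z ^ 3) + mconst (a6 b) * z ^ 4))"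

lemma mderiv_power4: "mderiv i (F ^ 4) = 4 * F ^ 3 * mderiv i (F :: 'a::comm_ring_1 mpoly)"
proof -
  have "mderiv i (F ^ 4) = mderiv i (F ^ 3 * F)" by (simp add: power3_eq_cube power4_eq_xxxx mult.assoc)
  also have "\<dots> = 4 * F ^ 3 * mderiv i F"
    unfolding mderiv_mult mderiv_power3 by (simp add: power3_eq_cube power2_eq_square algebra_simps)
  finally show ?thesis .
qed

context
  fixes R :: "'k::field set" and b :: "'k wcoeffs" and e al be :: 'k
  assumes R: "coeff_ring R" and coeffs: "set_wcoeffs b \<subseteq> R" "e \<in> R" "al \<in> R" "be \<in> R"
begin

interpretation coeff_ring R by (rule R)

lemma b_coeffs: "a1 b \<in> R" "a2 b \<in> R" "a3 b \<in> R" "a4 b \<in> R" "a6 b \<in> R"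
  using coeffs(1) by (cases b; simp)+

lemma quartic_y_forms: "quartic_y e al be \<in> forms R 3 2"
proof -
  have v: "(mvar j :: 'k mpoly) \<in> forms R 3 1" if "j < 3" for j using that by (rule forms_var)
  have vv: "(mvar j * mvar l :: 'k mpoly) \<in> forms R 3 2" if "j < 3" "l < 3" for j l
    using forms_mult[OF v v] that by (simp add: numeral_2_eq_2)
  show ?thesis unfolding quartic_y_def power2_eq_square
    by (intro forms_diff forms_const_mult forms_add vv coeffs) simp_all
qed

lemma quartic_forms: "quartic b e al be \<in> forms R 3 4"
proof -
  have v: "(mvar j :: 'k mpoly) \<in> forms R 3 1" if "j < 3" for j using that by (rule forms_var)
  have vp: "(mvar j ^ n :: 'k mpoly) \<in> forms R 3 n" if "j < 3" for j n
    using forms_power[OF v[OF that], of n] by simp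
  have m: "F * G \<in> forms R 3 4" if "F \<in> forms R 3 i" "G \<in> forms R 3 j" "i + j = 4" for F G i j
    using forms_mult[OF that(1,2)] that(3) by simp
  have y2: "quartic_y e al be ^ 2 \<in> forms R 3 4"
    unfolding power2_eq_square by (rule m[OF quartic_y_forms quartic_y_forms]) simp
  have xz: "(mvar 0 * mvar 2 :: 'k mpoly) \<in> forms R 3 2" using forms_mult[OF v[of 0] v[of 2]] by (simp add: numeral_2_eq_2)
  have t: "mvar 0 * mvar 2 * quartic_y e al be \<in> forms R 3 4" "mvar 2 ^ 2 * quartic_y e al be \<in> forms R 3 4"
    "(mvar 0 ^ 3 * mvar 2 :: 'k mpoly) \<in> forms R 3 4" "(mvar 0 ^ 2 * mvar 2 ^ 2 :: 'k mpoly) \<in> forms R 3 4"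
    "(mvar 0 * mvar 2 ^ 3 :: 'k mpoly) \<in> forms R 3 4" "(mvar 2 ^ 4 :: 'k mpoly) \<in> forms R 3 4"
    by (rule m[OF xz quartic_y_forms] m[OF vp quartic_y_forms] m[OF vp v] m[OF vp vp] m[OF v vp] vp; simp)+
  show ?thesis unfolding quartic_def Let_def
    by (intro forms_add forms_diff forms_const_mult y2 t b_coeffs)
qed

end

context coeff_hom
begin

text \<open>Chain rule for the substitution of y, in terms of the value \<open>Y\<close> of that
  quadratic form. The derivative in z is computed only at (x : 0 : 0), the one point with z = 0 that
  a zero of the quartic can have.\<close>

lemma meval_quartic:
  assumes c: "set_wcoeffs b \<subseteq> R" "e \<in> R" "al \<in> R" "be \<in> R"
    and Y: "Y = h e * (p 1 ^ 2 + p 1 * p 2) - h al * (p 0 * p 2) - h be * p 2 ^ 2"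
  shows "meval h p (quartic b e al be) = Y ^ 2 + h (a1 b) * (p 0 * p 2 * Y) + h (a3 b) * (p 2 ^ 2 * Y)
     - (p 0 ^ 3 * p 2 + h (a2 b) * (p 0 ^ 2 * p 2 ^ 2) + h (a4 b) * (p 0 * p 2 ^ 3) + h (a6 b) * p 2 ^ 4)"
    and "meval h p (mderiv 0 (quartic b e al be)) = - (2 * Y + h (a1 b) * (p 0 * p 2) + h (a3 b) * p 2 ^ 2) * h al * p 2
     + h (a1 b) * p 2 * Y - (3 * p 0 ^ 2 * p 2 + 2 * h (a2 b) * (p 0 * p 2 ^ 2) + h (a4 b) * p 2 ^ 3)"
    and "meval h p (mderiv 1 (quartic b e al be)) =
      (2 * Y + h (a1 b) * (p 0 * p 2) + h (a3 b) * p 2 ^ 2) * h e * (2 * p 1 + p 2)"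
    and "p 2 = 0 \<Longrightarrow> p 1 = 0 \<Longrightarrow> meval h p (mderiv 2 (quartic b e al be)) = - (p 0 ^ 3)"
proof -
  let ?y = "quartic_y e al be"
  have cs: "a1 b \<in> R" "a2 b \<in> R" "a3 b \<in> R" "a4 b \<in> R" "a6 b \<in> R" using c(1) by (cases b; simp)+
  note [simp] = cs c(2-4)
  have yc [simp]: "?y \<in> mcoeffs R"
    unfolding quartic_y_def by (intro mcoeffs_intros c)
  have yv: "meval h p ?y = Y"
    unfolding quartic_y_def Y by (simp add: meval_rules mcoeffs_intros)
  have yd: "mderiv 0 ?y = - mconst al * mvar 2" "mderiv 1 ?y = mconst e * (2 * mvar 1 + mvar 2)"
    "mderiv 2 ?y = mconst e * mvar 1 - mconst al * mvar 0 - mconst be * (2 * mvar 2)"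
    unfolding quartic_y_def by (simp_all add: mderiv_rules)
  note yd = yd yd(2)[unfolded One_nat_def]
  note rules = meval_rules mcoeffs_intros meval_numeral mcoeffs_numeral
  show "meval h p (quartic b e al be) = Y ^ 2 + h (a1 b) * (p 0 * p 2 * Y) + h (a3 b) * (p 2 ^ 2 * Y)
     - (p 0 ^ 3 * p 2 + h (a2 b) * (p 0 ^ 2 * p 2 ^ 2) + h (a4 b) * (p 0 * p 2 ^ 3) + h (a6 b) * p 2 ^ 4)"
    unfolding quartic_def Let_def by (simp add: rules yv)
  show "meval h p (mderiv 0 (quartic b e al be)) = - (2 * Y + h (a1 b) * (p 0 * p 2) + h (a3 b) * p 2 ^ 2) * h al * p 2
     + h (a1 b) * p 2 * Y - (3 * p 0 ^ 2 * p 2 + 2 * h (a2 b) * (p 0 * p 2 ^ 2) + h (a4 b) * p 2 ^ 3)"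
    unfolding quartic_def Let_def
    by (simp add: mderiv_rules mderiv_power4 yd rules yv) (simp add: algebra_simps power2_eq_square power3_eq_cube)
  show "meval h p (mderiv 1 (quartic b e al be)) =
      (2 * Y + h (a1 b) * (p 0 * p 2) + h (a3 b) * p 2 ^ 2) * h e * (2 * p 1 + p 2)"
    unfolding quartic_def Let_def
    by (simp add: mderiv_rules mderiv_power4 yd rules yv) (simp add: algebra_simps power2_eq_square power3_eq_cube)
  show "meval h p (mderiv 2 (quartic b e al be)) = - (p 0 ^ 3)" if z: "p 2 = 0" "p 1 = 0"
  proof -
    have p1: "p (Suc 0) = 0" using z(2) by simp
    have "Y = 0" unfolding Y by (simp add: z p1)
    then show ?thesis
      unfolding quartic_def Let_def
      by (simp add: mderiv_rules mderiv_power4 yd rules yv z p1)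
  qed
qed

lemma meval_quartic_affine:
  assumes c: "set_wcoeffs b \<subseteq> R" "e \<in> R" "al \<in> R" "be \<in> R"
    and Y: "Y = h e * (v ^ 2 + v) - h al * x - h be"
  shows "meval h (vec3 x v 1) (quartic b e al be) = weq (map_wcoeffs h b) x Y"
  by (subst meval_quartic(1)[OF c refl]) (simp add: Y weq_def wcoeffs_sel algebra_simps)

end

text \<open>At z = 1 the derivatives are \<open>weq_x\<close> - al \<open>weq_y\<close> and
  \<open>weq_y\<close> e (2 v + 1). If both vanish, then either 2 v + 1 = 0, which
  \<open>ram\<close> excludes, or \<open>weq_x\<close> and \<open>weq_y\<close> both vanish, so that
  the point of the Weierstrass curve below is singular. At z = 0 the quartic is (e v^2)^2, which
  leaves (1 : 0 : 0), where the derivative in z is not 0. Both fibres are instances of this.\<close>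

lemma quartic_smooth:
  fixes h :: "'k::field \<Rightarrow> 'b::field" and p :: "nat \<Rightarrow> 'b"
  assumes h: "coeff_hom R h" and c: "set_wcoeffs b \<subseteq> R" "e \<in> R" "al \<in> R" "be \<in> R"
    and e: "h e \<noteq> 0"
    and smooth: "\<And>x y. weq (map_wcoeffs h b) x y = 0 \<Longrightarrow> weq_x (map_wcoeffs h b) x y \<noteq> 0 \<or> weq_y (map_wcoeffs h b) x y \<noteq> 0"
    and ram: "\<And>x v y. 2 * v + 1 = 0 \<Longrightarrow> y = h e * (v ^ 2 + v) - h al * x - h be \<Longrightarrow>
      weq (map_wcoeffs h b) x y = 0 \<Longrightarrow> weq_x (map_wcoeffs h b) x y \<noteq> h al * weq_y (map_wcoeffs h b) x y"
    and p: "\<exists>i\<le>2. p i \<noteq> 0" and Q: "meval h p (quartic b e al be) = 0"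
  shows "\<exists>j\<le>2. meval h p (mderiv j (quartic b e al be)) \<noteq> 0"
proof -
  interpret coeff_hom R h by (rule h)
  define Y where "Y = h e * (p 1 ^ 2 + p 1 * p 2) - h al * (p 0 * p 2) - h be * p 2 ^ 2"
  note m = meval_quartic[OF c Y_def]
  show ?thesis
  proof (cases "p 2 = 0")
    case True
    have "Y ^ 2 = 0" using Q unfolding m(1) True by simp
    then have "Y = 0" by simp
    then have p1: "p 1 = 0" using e unfolding Y_def True by simp
    have "p 0 \<noteq> 0"
    proof
      assume p0: "p 0 = 0"
      obtain i where "i \<le> 2" "p i \<noteq> 0" using p by blast
      moreover from this have "i = 0 \<or> i = 1 \<or> i = 2" by linarith
      ultimately show False using p0 p1 True by auto
    qed
    then have "meval h p (mderiv 2 (quartic b e al be)) \<noteq> 0" using m(4)[OF True p1] by simp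
    then show ?thesis by blast
  next
    case z: False
    define x where "x = p 0 / p 2"
    define v where "v = p 1 / p 2"
    define y where "y = h e * (v ^ 2 + v) - h al * x - h be"
    let ?b = "map_wcoeffs h b"
    have p0: "p 0 = x * p 2" and p1: "p 1 = v * p 2" using z by (simp_all add: x_def v_def)
    have Yy: "Y = p 2 ^ 2 * y"
      unfolding Y_def p0 p1 y_def by (simp add: algebra_simps power2_eq_square)
    have "meval h p (quartic b e al be) = p 2 ^ 4 * weq ?b x y"
      unfolding m(1) Yy p0 by (simp add: weq_def wcoeffs_sel algebra_simps power2_eq_square power3_eq_cube power4_eq_xxxx)
    then have w: "weq ?b x y = 0" using Q z by simp
    have d0: "meval h p (mderiv 0 (quartic b e al be)) = p 2 ^ 3 * (weq_x ?b x y - h al * weq_y ?b x y)"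
      unfolding m(2) Yy p0 by (simp add: weq_x_def weq_y_def wcoeffs_sel algebra_simps power2_eq_square power3_eq_cube)
    have d1: "meval h p (mderiv 1 (quartic b e al be)) = p 2 ^ 3 * (weq_y ?b x y * h e * (2 * v + 1))"
      unfolding m(3) Yy p0 p1 by (simp add: weq_y_def wcoeffs_sel algebra_simps power2_eq_square power3_eq_cube)
    show ?thesis
    proof (cases "2 * v + 1 = 0")
      case True
      then have "meval h p (mderiv 0 (quartic b e al be)) \<noteq> 0" using ram[OF True y_def w] d0 z by simp
      then show ?thesis by blast
    next
      case False
      show ?thesis
      proof (cases "weq_y ?b x y = 0")
        case True
        then have "meval h p (mderiv 0 (quartic b e al be)) \<noteq> 0" using smooth[OF w] d0 z by simp
        then show ?thesis by blast
      next
        case y: False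
        then have "meval h p (mderiv 1 (quartic b e al be)) \<noteq> 0" using d1 z e False by simp
        then show ?thesis using one_le_numeral by blast
      qed
    qed
  qed
qed

lemma mideal_generator: "coeff_ring R \<Longrightarrow> s \<in> mideal R N {s}"
proof -
  assume "coeff_ring R"
  then interpret coeff_ring R .
  have "s = (\<Sum>t\<in>{s}. 1 * t)" by simp
  moreover have "1 \<in> mpolys R N" using forms_1[of N] by (rule forms_mpolys)
  ultimately show ?thesis unfolding mideal_def
    by (intro CollectI exI[of _ "{s}"] exI[of _ "\<lambda>_. 1"]) auto
qed

text \<open>For a plane curve \<open>n - 1\<close> is 1: the equation itself is the local generator,
  with \<open>q = 1\<close>, and independence of a single differential means that one partial
  derivative is nonzero.\<close>

lemma smooth_curve_at_plane:
  fixes p :: "nat \<Rightarrow> 'b::field"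
  assumes F: "F \<in> forms Z2 3 d" and j: "\<exists>j\<le>2. meval h p (mderiv j F) \<noteq> 0" and h1: "meval h p 1 \<noteq> 0"
  shows "smooth_curve_at 2 {F} h p"
  unfolding smooth_curve_at_def
proof (intro exI[of _ "\<lambda>_. F"] conjI allI impI ballI)
  fix i show "F \<in> mideal Z2 (2 + 1) {F}" by (rule mideal_generator) unfold_locales
  show "\<exists>d. F \<in> forms Z2 (2 + 1) d" using F by auto
next
  fix c :: "nat \<Rightarrow> 'b" and i assume "\<forall>j\<le>2. (\<Sum>i<2 - 1. c i * meval h p (mderiv j F)) = 0" "i < (2::nat) - 1"
  then show "c i = 0" using j by auto
next
  fix s assume s: "s \<in> {F}"
  have im: "(\<lambda>_. F) ` {..<2 - 1 :: nat} = {F}" by auto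
  show "\<exists>q d. q \<in> forms Z2 (2 + 1) d \<and> meval h p q \<noteq> 0 \<and> q * s \<in> mideal Z2 (2 + 1) ((\<lambda>_. F) ` {..<2 - 1 :: nat})"
    unfolding im using s h1 Z2.forms_1 mideal_generator[OF Z2.coeff_ring_axioms, of F]
    by (intro exI[of _ "1 :: q2 mpoly"] exI[of _ "0 :: nat"]) auto
qed

section \<open>The generic point of the quartic\<close>

text \<open>Forms of degree at most \<open>B\<close> in v, for division with remainder by the
  quartic, whose leading coefficient in v is a constant.\<close>

definition vforms :: "nat \<Rightarrow> nat \<Rightarrow> 'k::field mpoly set" where
  "vforms B d = {F \<in> forms UNIV 3 d. \<forall>m\<in>Poly_Mapping.keys F. Poly_Mapping.lookup m 1 \<le> B}"

interpretation U: coeff_ring "UNIV :: 'k::field set" by (rule coeff_ring_UNIV)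

lemma vforms_mono: "F \<in> vforms B d \<Longrightarrow> B \<le> B' \<Longrightarrow> F \<in> vforms B' d"
  by (fastforce simp: vforms_def)

lemma vforms_add: "F \<in> vforms B d \<Longrightarrow> G \<in> vforms B d \<Longrightarrow> F + G \<in> vforms B d"
  unfolding vforms_def using Poly_Mapping.keys_add[of F G] by (auto intro: U.forms_add)

lemma vforms_uminus: "F \<in> vforms B d \<Longrightarrow> - F \<in> vforms B d"
  unfolding vforms_def by (auto intro: U.forms_uminus simp: in_keys_iff)

lemma vforms_diff: "F \<in> vforms B d \<Longrightarrow> G \<in> vforms B d \<Longrightarrow> F - G \<in> vforms B d"
  using vforms_add[of F B d "- G"] vforms_uminus[of G B d] by simp

lemma vforms_0: "0 \<in> vforms B d"
  by (simp add: vforms_def U.forms_0)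

lemma vforms_sum: "(\<And>i. i \<in> I \<Longrightarrow> f i \<in> vforms B d) \<Longrightarrow> sum f I \<in> vforms B d"
  by (induction I rule: infinite_finite_induct) (auto intro: vforms_add vforms_0)

lemma vforms_mult:
  assumes "F \<in> vforms B d" "G \<in> vforms C e"
  shows "F * G \<in> vforms (B + C) (d + e)"
proof -
  have "Poly_Mapping.lookup m 1 \<le> B + C" if m: "m \<in> Poly_Mapping.keys (F * G)" for m
  proof -
    obtain k l where "m = k + l" "k \<in> Poly_Mapping.keys F" "l \<in> Poly_Mapping.keys G"
      using m Poly_Mapping.keys_mult[of F G] by blast
    then show ?thesis using assms by (auto simp: vforms_def lookup_add intro: add_mono)
  qed
  then show ?thesis using assms by (auto simp: vforms_def U.forms_mult)
qed

lemma vforms_const: "mconst c \<in> vforms 0 0"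
  by (simp add: vforms_def U.forms_const) (simp add: mconst_def)

lemma vforms_const_mult: "F \<in> vforms B d \<Longrightarrow> mconst c * F \<in> vforms B d"
  using vforms_mult[OF vforms_const] by fastforce

lemma vforms_var: "j < 3 \<Longrightarrow> mvar j \<in> vforms (if j = 1 then 1 else 0) 1"
  unfolding vforms_def by (intro CollectI conjI U.forms_var) (simp_all add: mvar_def lookup_single)

lemma vforms_single:
  assumes "Poly_Mapping.keys m \<subseteq> {..<3}" "mono_degree m = d" "Poly_Mapping.lookup m 1 \<le> B"
  shows "Poly_Mapping.single m c \<in> vforms B d"
  using assms by (simp add: vforms_def U.forms_iff)

text \<open>The power v^4 arises only from y^2, as the square of e v^2; its coefficient e^2 is
  invertible.\<close>

lemma quartic_leading:
  fixes b :: "'k::field wcoeffs"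
  assumes e: "e \<noteq> 0"
  shows "mvar 1 ^ 4 - mconst (inverse e ^ 2) * quartic b e al be \<in> vforms 3 4"
proof -
  let ?x = "mvar 0 :: 'k mpoly" and ?v = "mvar 1 :: 'k mpoly" and ?z = "mvar 2 :: 'k mpoly"
  have x: "?x \<in> vforms 0 1" and v: "?v \<in> vforms 1 1" and z: "?z \<in> vforms 0 1"
    using vforms_var[of 0] vforms_var[of 1] vforms_var[of 2] by simp_all
  have two: "F * G \<in> vforms k 2" if "F \<in> vforms i 1" "G \<in> vforms j 1" "i + j = k" for F G :: "'k mpoly" and i j k
    using vforms_mult[OF that(1,2)] that(3) by (simp add: numeral_2_eq_2)
  have four: "F * G \<in> vforms 3 4" if "F \<in> vforms i 2" "G \<in> vforms j 2" "i + j \<le> 3" for F G :: "'k mpoly" and i j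
    using vforms_mono[OF vforms_mult[OF that(1,2)] that(3)] by simp
  define M where "M = mconst e * (?v * ?z) - mconst al * (?x * ?z) - mconst be * (?z * ?z)"
  define Y where "Y = quartic_y e al be"
  have vv: "?v * ?v \<in> vforms 2 2" by (rule two[OF v v]) simp
  have xz: "?x * ?z \<in> vforms 0 2" by (rule two[OF x z]) simp
  have zz: "?z * ?z \<in> vforms 0 2" by (rule two[OF z z]) simp
  have xx: "?x * ?x \<in> vforms 0 2" by (rule two[OF x x]) simp
  have vz: "?v * ?z \<in> vforms 1 2" by (rule two[OF v z]) simp
  have M: "M \<in> vforms 1 2"
    unfolding M_def by (intro vforms_diff vforms_const_mult vz vforms_mono[OF xz] vforms_mono[OF zz]) simp_all
  have YM: "Y = mconst e * (?v * ?v) + M"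
    by (simp add: Y_def quartic_y_def M_def power2_eq_square algebra_simps)
  have Y: "Y \<in> vforms 2 2"
    unfolding YM by (intro vforms_add vforms_const_mult vv vforms_mono[OF M]) simp
  define N where "N = (mconst e * (?v * ?v) * M + mconst e * (?v * ?v) * M + M * M + mconst (a1 b) * (?x * ?z * Y) + mconst (a3 b) * (?z * ?z * Y))
     - (?x * ?x * (?x * ?z) + mconst (a2 b) * (?x * ?x * (?z * ?z)) + mconst (a4 b) * (?x * ?z * (?z * ?z)) + mconst (a6 b) * (?z * ?z * (?z * ?z)))"
  have N: "N \<in> vforms 3 4"
    unfolding N_def
    by (intro vforms_add vforms_diff vforms_const_mult four[OF vforms_const_mult[OF vv] M] four[OF M M] four[OF xz Y] four[OF zz Y]
        four[OF xx xz] four[OF xx zz] four[OF xz zz] four[OF zz zz]) simp_all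
  have Q: "quartic b e al be = mconst e * mconst e * (?v * ?v * ?v * ?v) + N"
    unfolding quartic_def Let_def Y_def[symmetric] N_def
    by (subst (1) YM) (simp add: power2_eq_square power3_eq_cube power4_eq_xxxx algebra_simps)
  have inv: "mconst (inverse e ^ 2) * (mconst e * mconst e) = 1"
  proof -
    have "inverse e ^ 2 * (e * e) = 1" using e by (simp add: power2_eq_square field_simps)
    then show ?thesis by (simp add: mconst_def mult_single)
  qed
  have "mconst (inverse e ^ 2) * quartic b e al be = ?v * ?v * ?v * ?v + mconst (inverse e ^ 2) * N"
    unfolding Q distrib_left mult.assoc[symmetric] inv[unfolded mult.assoc[symmetric]] by simp
  then have "?v ^ 4 - mconst (inverse e ^ 2) * quartic b e al be = - (mconst (inverse e ^ 2) * N)"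
    by (simp add: power4_eq_xxxx)
  then show ?thesis using vforms_uminus[OF vforms_const_mult[OF N]] by simp
qed

text \<open>Division by a polynomial monic in v up to a constant, kept homogeneous. One round
  replaces v^4 in all monomials of top degree in v at once and so lowers the bound
  \<open>B\<close>.\<close>

lemma quartic_division:
  fixes b :: "'k::field wcoeffs"
  assumes e: "e \<noteq> 0" and F: "F \<in> vforms B d"
  shows "\<exists>c. \<exists>R\<in>vforms 3 d. c \<in> mpolys UNIV 3 \<and> F = c * quartic b e al be + R"
  using F
proof (induction B arbitrary: F)
  case 0
  then show ?case using vforms_mono[of F 0 d 3]
    by (intro exI[of _ 0] bexI[of _ F]) (auto intro: U.forms_mpolys U.forms_0)
next
  case (Suc B)
  show ?case
  proof (cases "Suc B \<le> 3")
    case True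
    then show ?thesis using Suc.prems vforms_mono[of F "Suc B" d 3]
      by (intro exI[of _ 0] bexI[of _ F]) (auto intro: U.forms_mpolys U.forms_0)
  next
    case False
    let ?L = "Poly_Mapping.lookup" and ?K = "Poly_Mapping.keys F" and ?Q = "quartic b e al be"
    define T where "T = {m \<in> ?K. ?L m 1 = Suc B}"
    define u :: "nat \<Rightarrow>\<^sub>0 nat" where "u = Poly_Mapping.single 1 4"
    have u: "Poly_Mapping.keys u = {1}" "mono_degree u = 4" "?L u 1 = 4"
      by (simp_all add: u_def mono_degree_def)
    have mk: "Poly_Mapping.keys m \<subseteq> {..<3}" "mono_degree m = d" "?L m 1 \<le> Suc B" if "m \<in> ?K" for m
      using Suc.prems that by (auto simp: vforms_def U.forms_iff)
    \<comment> \<open>Subtraction of exponents is truncated; here it is exact because the exponent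
      of v is at least 4.\<close>
    have dec: "m = (m - u) + u" if "m \<in> T" for m
      by (rule poly_mapping_eqI) (use that False in \<open>auto simp: T_def u_def lookup_add lookup_minus lookup_single when_def\<close>)
    have v4: "(mvar 1 :: 'k mpoly) ^ 4 = Poly_Mapping.single u 1"
    proof -
      have "(mvar 1 :: 'k mpoly) ^ k = Poly_Mapping.single (Poly_Mapping.single 1 k) 1" for k
        by (induction k) (simp_all add: mvar_def mult_single flip: single_add)
      then show ?thesis by (simp add: u_def)
    qed
    define Lr where "Lr = mvar 1 ^ 4 - mconst (inverse e ^ 2) * ?Q"
    have Lr: "Lr \<in> vforms 3 4" unfolding Lr_def by (rule quartic_leading[OF e])
    let ?s = "\<lambda>m. Poly_Mapping.single (m - u) (?L F m)"
    have top: "Poly_Mapping.single m (?L F m) = (?s m * mconst (inverse e ^ 2)) * ?Q + ?s m * Lr" if "m \<in> T" for m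
    proof -
      have "Poly_Mapping.single m (?L F m) = ?s m * mvar 1 ^ 4"
        unfolding v4 mult_single using dec[OF that] by simp
      then show ?thesis by (simp add: Lr_def algebra_simps)
    qed
    have msub: "Poly_Mapping.keys (m - u) \<subseteq> {..<3}" "mono_degree (m - u) + 4 = d" "?L (m - u) 1 + 4 = Suc B" if m: "m \<in> T" for m
    proof -
      have mK: "m \<in> ?K" using m by (simp add: T_def)
      have "Poly_Mapping.keys (m - u) \<subseteq> Poly_Mapping.keys m"
        by (auto simp: in_keys_iff lookup_minus)
      then show "Poly_Mapping.keys (m - u) \<subseteq> {..<3}" using mk(1)[OF mK] by blast
      show "mono_degree (m - u) + 4 = d"
        using mono_degree_add[of "m - u" u] dec[OF m] mk(2)[OF mK] u(2) by simp
      have "?L m 1 = ?L (m - u) 1 + ?L u 1" by (subst dec[OF m]) (rule lookup_add)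
      then show "?L (m - u) 1 + 4 = Suc B" using m u(3) by (simp add: T_def)
    qed
    have sv: "?s m \<in> vforms (B - 3) (d - 4)" if m: "m \<in> T" for m
      by (rule vforms_single) (use msub[OF m] in auto)
    define c where "c = (\<Sum>m\<in>T. ?s m * mconst (inverse e ^ 2))"
    define G where "G = (\<Sum>m\<in>T. ?s m * Lr) + (\<Sum>m\<in>?K - T. Poly_Mapping.single m (?L F m))"
    have fin: "finite T" "T \<subseteq> ?K" by (auto simp: T_def)
    have "F = (\<Sum>m\<in>T. Poly_Mapping.single m (?L F m)) + (\<Sum>m\<in>?K - T. Poly_Mapping.single m (?L F m))"
      by (subst mpoly_expand[of F]) (simp add: sum.subset_diff[OF fin(2)] add.commute)
    also have "(\<Sum>m\<in>T. Poly_Mapping.single m (?L F m)) = (\<Sum>m\<in>T. (?s m * mconst (inverse e ^ 2)) * ?Q + ?s m * Lr)"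
      by (rule sum.cong[OF refl top])
    finally have F: "F = c * ?Q + G"
      by (simp add: c_def G_def sum.distrib sum_distrib_right add.assoc)
    have "?s m * Lr \<in> vforms B d" if m: "m \<in> T" for m
    proof -
      have "B - 3 + 3 = B" "d - 4 + 4 = d" using False msub(2)[OF m] by linarith+
      then show ?thesis using vforms_mult[OF sv[OF m] Lr] by simp
    qed
    moreover have "Poly_Mapping.single m (?L F m) \<in> vforms B d" if m: "m \<in> ?K - T" for m
    proof (rule vforms_single)
      show "?L m 1 \<le> B" using mk(3)[of m] m by (auto simp: T_def le_Suc_eq)
    qed (use mk m in auto)
    ultimately have "G \<in> vforms B d" unfolding G_def by (intro vforms_add vforms_sum)
    then obtain c' R where R: "R \<in> vforms 3 d" "c' \<in> mpolys UNIV 3" "G = c' * ?Q + R" using Suc.IH by blast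
    have "?s m * mconst (inverse e ^ 2) \<in> vforms (B - 3 + 0) (d - 4 + 0)" if "m \<in> T" for m
      by (rule vforms_mult[OF sv[OF that] vforms_const])
    then have "c \<in> vforms (B - 3) (d - 4)" unfolding c_def by (intro vforms_sum) simp
    then have c: "c \<in> mpolys UNIV 3" by (simp add: vforms_def forms_def)
    have "c + c' \<in> mpolys UNIV 3"
      using c R(2) Poly_Mapping.keys_add[of c c'] by (fastforce simp: mpolys_def)
    moreover have "F = (c + c') * ?Q + R" using F R(3) by (simp add: distrib_right)
    ultimately show ?thesis using R(1) by blast
  qed
qed


lemma generic_pair_unique:
  assumes g: "generic_xy b x y" and e: "pval ffc_const P x y = pval ffc_const Q x y"
  shows "P = Q"
proof -
  interpret c: field_map "ffc_const :: 'a \<Rightarrow> 'a ffc" by (rule field_map_ffc_const)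
  obtain A B C D where PQ: "P = (A, B)" "Q = (C, D)" by (cases P; cases Q)
  have "pval ffc_const (A - C, B - D) x y = 0"
    using e by (simp add: PQ algebra_simps)
  then have "(A - C, B - D) = (0, 0)" using g unfolding generic_xy_def by blast
  then show ?thesis by (simp add: PQ)
qed

lemma degree_pnorm_linear:
  fixes b :: "'k::field wcoeffs"
  assumes "k \<noteq> 0"
  shows "Polynomial.degree (pnorm b ([:i, j:], [:k:])) = 3"
proof -
  have "pnorm b ([:i, j:], [:k:]) = [:i, j:] ^ 2 + [:i, j:] * [:k:] * wp b - smult (k ^ 2) (wq b)"
    by (simp add: power2_eq_square)
  also have "Polynomial.degree \<dots> = 3"
    using assms by (simp add: wq_def wp_def power2_eq_square)
  finally show ?thesis .
qed

text \<open>The quadratic extension generated by \<open>v\<close> is proper, since the norm of \<open>(2 v + 1)\<^sup>2\<close> to the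
  field of rational functions in \<open>x\<close> is a cubic polynomial, hence not a square.\<close>

lemma quadratic_independent:
  fixes b :: "'k::field_char_0 wcoeffs"
  assumes g: "generic_xy b x y" and e: "e \<noteq> 0"
    and y: "y = ffc_const e * (v ^ 2 + v) - ffc_const al * x - ffc_const be"
    and z: "pval ffc_const U x y + v * pval ffc_const V x y = 0"
  shows "U = (0, 0) \<and> V = (0, 0)"
proof -
  interpret c: field_map "ffc_const :: 'k \<Rightarrow> 'k ffc" by (rule field_map_ffc_const)
  have w: "weq (map_wcoeffs ffc_const b) x y = 0" using g by (simp add: generic_xy_def)
  have "V = (0, 0)"
  proof (rule ccontr)
    assume V: "V \<noteq> (0, 0)"
    obtain A B C D where UV: "U = (A, B)" "V = (C, D)" by (cases U; cases V)
    \<comment> \<open>U + v V = 0 gives V - 2 U = (1 + 2 v) V, which is \<open>?T\<close>; and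
      \<open>?E\<close> is (1 + 2 v)^2 as a function on the Weierstrass curve. So \<open>?E\<close>
      V^2 = \<open>?T\<close>^2, and norms have degrees of different parity.\<close>
    let ?T = "(C - smult 2 A, D - smult 2 B)"
    let ?E = "([:1 + 4 * be / e, 4 * al / e:], [:4 / e:])"
    have vs: "v ^ 2 + v = (y + ffc_const al * x + ffc_const be) / ffc_const e"
      using e by (simp add: y)
    have E: "pval ffc_const ?E x y = (1 + 2 * v) ^ 2"
    proof -
      have "(1 + 2 * v) ^ 2 = 1 + 4 * (v ^ 2 + v)" by (simp add: power2_eq_square algebra_simps)
      also have "\<dots> = pval ffc_const ?E x y"
        unfolding vs by (simp add: add_divide_distrib algebra_simps)
      finally show ?thesis by simp
    qed
    have "pval ffc_const ?T x y = pval ffc_const V x y - 2 * pval ffc_const U x y"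
      by (simp add: UV c.map_poly_h_smult algebra_simps)
    also have "\<dots> = (1 + 2 * v) * pval ffc_const V x y"
    proof -
      have "pval ffc_const U x y = - (v * pval ffc_const V x y)" using z by (simp add: eq_neg_iff_add_eq_0)
      then show ?thesis by (simp add: algebra_simps)
    qed
    finally have T: "pval ffc_const ?T x y = (1 + 2 * v) * pval ffc_const V x y" .
    have "pval ffc_const (pmul b ?E (pmul b V V)) x y = pval ffc_const (pmul b ?T ?T) x y"
      unfolding c.pval_pmul[OF w] E T by (simp only: power2_eq_square ac_simps)
    then have "pmul b ?E (pmul b V V) = pmul b ?T ?T" by (rule generic_pair_unique[OF g])
    then have "pnorm b ?E * (pnorm b V * pnorm b V) = pnorm b ?T * pnorm b ?T"
      by (simp only: pnorm_mult[symmetric])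
    moreover have dE: "Polynomial.degree (pnorm b ?E) = 3" using e by (intro degree_pnorm_linear) simp
    moreover have nE: "pnorm b ?E \<noteq> 0" using dE by auto
    moreover have nV: "pnorm b V \<noteq> 0" using V pnorm_eq_0 by blast
    ultimately have T0: "pnorm b ?T \<noteq> 0" and d: "3 + 2 * Polynomial.degree (pnorm b V) = Polynomial.degree (pnorm b ?T * pnorm b ?T)"
      by (metis mult_eq_0_iff, metis degree_mult_eq mult_2 mult_eq_0_iff)
    then have "3 + 2 * Polynomial.degree (pnorm b V) = 2 * Polynomial.degree (pnorm b ?T)"
      using degree_mult_eq[OF T0 T0] by (simp only: mult_2)
    then show False by presburger
  qed
  moreover from this have "pval ffc_const U x y = 0" using z by simp
  then have "U = (0, 0)" using g unfolding generic_xy_def by blast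
  ultimately show ?thesis by blast
qed

text \<open>The element v has degree 4 over the rational functions of x. With v^2 = - v + L + k y,
  the four powers are rewritten in the basis 1, y, v, v y, and the change of coefficients is
  triangular.\<close>

lemma powers_independent:
  fixes b :: "'k::field_char_0 wcoeffs"
  assumes g: "generic_xy b x y" and e: "e \<noteq> 0"
    and y: "y = ffc_const e * (v ^ 2 + v) - ffc_const al * x - ffc_const be"
    and z: "(\<Sum>j<4. poly (map_poly ffc_const (A j)) x * v ^ j) = 0"
    and j: "j < 4"
  shows "A j = 0"
proof -
  interpret c: field_map "ffc_const :: 'k \<Rightarrow> 'k ffc" by (rule field_map_ffc_const)
  let ?m = "\<lambda>P. poly (map_poly ffc_const P) x"
  define L :: "'k poly" where "L = [:be / e, al / e:]"
  define k :: 'k where "k = 1 / e"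
  have k: "k \<noteq> 0" using e by (simp add: k_def)
  have v2: "v ^ 2 = - v + (?m L + ffc_const k * y)"
  proof -
    have "?m L + ffc_const k * y = (y + ffc_const al * x + ffc_const be) / ffc_const e"
      by (simp add: L_def k_def add_divide_distrib mult.commute)
    also have "\<dots> = v ^ 2 + v" using e by (simp add: y)
    finally have h: "?m L + ffc_const k * y = v ^ 2 + v" .
    show ?thesis unfolding h by simp
  qed
  have v3: "v ^ 3 = v - (?m L + ffc_const k * y) + v * (?m L + ffc_const k * y)"
  proof -
    have "v ^ 3 = v * v ^ 2" by (simp add: power3_eq_cube power2_eq_square)
    also have "\<dots> = v * (- v + (?m L + ffc_const k * y))" by (simp only: v2)
    also have "\<dots> = - (v ^ 2) + v * (?m L + ffc_const k * y)" by (simp add: algebra_simps power2_eq_square)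
    finally show ?thesis unfolding v2 by simp
  qed
  let ?U = "(A 0 + A 2 * L - A 3 * L, smult k (A 2 - A 3))"
  let ?V = "(A 1 - A 2 + A 3 + A 3 * L, smult k (A 3))"
  have "(\<Sum>j<4. ?m (A j) * v ^ j) = ?m (A 0) + ?m (A 1) * v + ?m (A 2) * v ^ 2 + ?m (A 3) * v ^ 3"
    by (simp add: eval_nat_numeral)
  also have "\<dots> = pval ffc_const ?U x y + v * pval ffc_const ?V x y"
    unfolding v2 v3 by (simp add: c.map_poly_h_smult algebra_simps)
  finally have "pval ffc_const ?U x y + v * pval ffc_const ?V x y = 0" using z by simp
  then have "?U = (0, 0) \<and> ?V = (0, 0)" by (rule quadratic_independent[OF g e y])
  then have "A 3 = 0" "A 2 = 0" "A 1 = 0" "A 0 = 0" using k by auto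
  moreover have "j = 0 \<or> j = 1 \<or> j = 2 \<or> j = 3" using j by linarith
  ultimately show ?thesis by auto
qed

text \<open>Grouping by powers of v leaves polynomials in x. As the degree is fixed, a monomial is
  determined by its exponents of x and v, so no two of them merge.\<close>

lemma vforms_vanish:
  fixes b :: "'k::field_char_0 wcoeffs"
  assumes g: "generic_xy b x y" and e: "e \<noteq> 0"
    and y: "y = ffc_const e * (v ^ 2 + v) - ffc_const al * x - ffc_const be"
    and R: "R \<in> vforms 3 d" and z: "meval ffc_const (vec3 x v 1) R = 0"
  shows "R = 0"
proof -
  interpret c: field_map "ffc_const :: 'k \<Rightarrow> 'k ffc" by (rule field_map_ffc_const)
  let ?L = "Poly_Mapping.lookup" and ?K = "Poly_Mapping.keys R"
  have i3: "{..<3::nat} = {0,1,2}" by auto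
  have mk: "Poly_Mapping.keys m \<subseteq> {0,1,2}" "?L m 0 + ?L m 1 + ?L m 2 = d" "?L m 1 < 4" if "m \<in> ?K" for m
  proof -
    have k: "Poly_Mapping.keys m \<subseteq> {..<3}" "mono_degree m = d" "?L m 1 \<le> 3"
      using R that by (auto simp: vforms_def U.forms_iff)
    then show "Poly_Mapping.keys m \<subseteq> {0,1,2}" "?L m 1 < 4" using i3 by auto
    then show "?L m 0 + ?L m 1 + ?L m 2 = d"
      using k mono_degree_superset[of "{0,1,2}" m] by simp
  qed
  define A where "A = (\<lambda>j. \<Sum>m\<in>{m\<in>?K. ?L m 1 = j}. monom (?L R m) (?L m 0))"
  have "meval ffc_const (vec3 x v 1) R = (\<Sum>m\<in>?K. ffc_const (?L R m) * (x ^ ?L m 0 * v ^ ?L m 1))"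
  proof (subst c.meval_superset[OF finite_keys subset_refl], intro sum.cong refl)
    fix m assume "m \<in> ?K"
    then show "ffc_const (?L R m) * mono_eval (vec3 x v 1) m = ffc_const (?L R m) * (x ^ ?L m 0 * v ^ ?L m 1)"
      using mono_eval_superset[of "{0,1,2}" m "vec3 x v 1"] mk(1) by simp
  qed
  also have "\<dots> = (\<Sum>j<4. \<Sum>m\<in>{m\<in>?K. ?L m 1 = j}. ffc_const (?L R m) * (x ^ ?L m 0 * v ^ ?L m 1))"
    by (rule sum.group[symmetric]) (use mk(3) in auto)
  also have "\<dots> = (\<Sum>j<4. poly (map_poly ffc_const (A j)) x * v ^ j)"
    by (intro sum.cong refl)
      (simp add: A_def c.map_poly_h_sum poly_sum sum_distrib_right c.map_poly_h_monom poly_monom mult.assoc)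
  finally have "(\<Sum>j<4. poly (map_poly ffc_const (A j)) x * v ^ j) = 0" using z by simp
  then have A0: "A j = 0" if "j < 4" for j using powers_independent[OF g e y] that by blast
  have "?L R m = 0" for m
  proof (rule ccontr)
    assume "?L R m \<noteq> 0"
    then have m: "m \<in> ?K" by (simp add: in_keys_iff)
    have un: "m' = m" if m': "m' \<in> ?K" "?L m' 1 = ?L m 1" "?L m' 0 = ?L m 0" for m'
    proof (rule poly_mapping_eqI)
      fix i
      have "?L m' 2 = ?L m 2" using mk(2)[OF m] mk(2)[OF m'(1)] m'(2,3) by linarith
      moreover have "?L m' i = 0 \<and> ?L m i = 0" if "i \<notin> {0,1,2}"
        using mk(1)[OF m] mk(1)[OF m'(1)] that by (auto simp: in_keys_iff)
      ultimately show "?L m' i = ?L m i" using m'(2,3) by (cases "i \<in> {0,1,2}") auto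
    qed
    have "coeff (A (?L m 1)) (?L m 0) = (\<Sum>m'\<in>{m'\<in>?K. ?L m' 1 = ?L m 1}. if m' = m then ?L R m else 0)"
      unfolding A_def coeff_sum using un by (intro sum.cong refl) auto
    also have "\<dots> = ?L R m" using m by simp
    finally show False using A0[OF mk(3)[OF m]] \<open>?L R m \<noteq> 0\<close> by simp
  qed
  then show ?thesis by (intro poly_mapping_eqI) simp
qed

lemma mideal_singleton_vanish:
  fixes p :: "nat \<Rightarrow> 'k::field ffc"
  assumes "F \<in> mideal UNIV N {Q}" "meval ffc_const p Q = 0"
  shows "meval ffc_const p F = 0"
proof -
  interpret c: field_map "ffc_const :: 'k \<Rightarrow> 'k ffc" by (rule field_map_ffc_const)
  obtain T c where "F = (\<Sum>s\<in>T. c s * s)" "T \<subseteq> {Q}" using assms(1) unfolding mideal_def by blast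
  then show ?thesis using assms(2) by (auto simp: c.meval_sum c.meval_mult intro!: sum.neutral)
qed

text \<open>A form vanishing at the point is a multiple of the quartic plus a remainder of degree at
  most 3 in v, and that remainder is 0. So the ideal is already saturated and the exponent 0 works;
  conversely the coordinate z = 1 can be cancelled.\<close>

lemma quartic_generic_point:
  fixes b :: "q2 wcoeffs"
  assumes g: "generic_xy b x y" and e: "e \<noteq> 0"
    and y: "y = ffc_const e * (v ^ 2 + v) - ffc_const al * x - ffc_const be"
  shows "generic_point 2 {quartic b e al be} (vec3 x v 1)"
  unfolding generic_point_def
proof (intro conjI allI ballI)
  interpret c: field_map "ffc_const :: q2 \<Rightarrow> q2 ffc" by (rule field_map_ffc_const)
  let ?p = "vec3 x v 1" and ?Q = "quartic b e al be"
  show "\<exists>i\<le>2. ?p i \<noteq> 0" by (intro exI[of _ 2]) simp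
  have Q: "meval ffc_const ?p ?Q = 0"
    using g c.meval_quartic_affine[OF _ _ _ _ y, of b] by (simp add: generic_xy_def)
  fix d F assume F: "F \<in> forms (UNIV :: q2 set) (2 + 1) d"
  show "meval ffc_const ?p F = 0 \<longleftrightarrow> (\<exists>e. \<forall>i\<le>2. mvar i ^ e * F \<in> mideal UNIV (2 + 1) {?Q})"
  proof
    assume z: "meval ffc_const ?p F = 0"
    have "Poly_Mapping.lookup m 1 \<le> d" if m: "m \<in> Poly_Mapping.keys F" for m
    proof -
      have k: "Poly_Mapping.keys m \<subseteq> {..<3}" "mono_degree m = d" using F m by (auto simp: U.forms_iff)
      have "Poly_Mapping.lookup m 1 \<le> (\<Sum>i<3. Poly_Mapping.lookup m i)" by (intro member_le_sum) auto
      then show ?thesis using k mono_degree_superset[of "{..<3}" m] by simp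
    qed
    then have "F \<in> vforms d d" using F by (simp add: vforms_def)
    then obtain c R where cR: "R \<in> vforms 3 d" "c \<in> mpolys UNIV 3" "F = c * ?Q + R"
      using quartic_division[OF e] by blast
    have "meval ffc_const ?p R = 0" using z Q unfolding cR(3) by (simp add: c.meval_add c.meval_mult)
    then have "R = 0" by (rule vforms_vanish[OF g e y cR(1)])
    then have "F = (\<Sum>s\<in>{?Q}. c * s)" using cR(3) by simp
    then have "F \<in> mideal UNIV (2 + 1) {?Q}"
      unfolding mideal_def using cR(2) by (intro CollectI exI[of _ "{?Q}"] exI[of _ "\<lambda>_. c"]) auto
    then show "\<exists>e. \<forall>i\<le>2. mvar i ^ e * F \<in> mideal UNIV (2 + 1) {?Q}" by (intro exI[of _ 0]) simp
  next
    assume "\<exists>e. \<forall>i\<le>2. mvar i ^ e * F \<in> mideal UNIV (2 + 1) {?Q}"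
    then obtain n where "mvar 2 ^ n * F \<in> mideal UNIV (2 + 1) {?Q}" by blast
    from mideal_singleton_vanish[OF this Q] show "meval ffc_const ?p F = 0"
      by (simp add: c.meval_mult c.meval_power c.meval_var)
  qed
qed

section \<open>Function fields generated by coordinates\<close>

locale const_field =
  fixes S :: "'k::field ffc set"
  assumes S_const: "ffc_const c \<in> S" and S_add: "f \<in> S \<Longrightarrow> g \<in> S \<Longrightarrow> f + g \<in> S"
    and S_mult: "f \<in> S \<Longrightarrow> g \<in> S \<Longrightarrow> f * g \<in> S" and S_inverse: "f \<in> S \<Longrightarrow> inverse f \<in> S"
begin

sublocale c: field_map "ffc_const :: 'k \<Rightarrow> 'k ffc" by (rule field_map_ffc_const)

lemma S_0: "0 \<in> S" and S_1: "1 \<in> S"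
  using S_const[of 0] S_const[of 1] by simp_all

lemma S_sum: "(\<And>i. i \<in> I \<Longrightarrow> f i \<in> S) \<Longrightarrow> sum f I \<in> S"
  by (induction I rule: infinite_finite_induct) (auto intro: S_0 S_add)

lemma S_prod: "(\<And>i. i \<in> I \<Longrightarrow> f i \<in> S) \<Longrightarrow> prod f I \<in> S"
  by (induction I rule: infinite_finite_induct) (auto intro: S_1 S_mult)

lemma S_power: "f \<in> S \<Longrightarrow> f ^ n \<in> S"
  by (induction n) (auto intro: S_1 S_mult)

lemma S_numeral: "numeral n \<in> S"
  using S_const[of "numeral n"] by simp

lemma S_uminus: "f \<in> S \<Longrightarrow> - f \<in> S"
  using S_mult[OF S_const[of "- 1"], of f] by simp

lemma S_diff: "f \<in> S \<Longrightarrow> g \<in> S \<Longrightarrow> f - g \<in> S"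
  using S_add[of f "- g"] S_uminus by simp

lemma S_divide: "f \<in> S \<Longrightarrow> g \<in> S \<Longrightarrow> f / g \<in> S"
  by (simp add: divide_inverse S_mult S_inverse)

lemma fun_field_subset:
  assumes "\<And>i. i < N \<Longrightarrow> p i \<in> S"
  shows "fun_field N p \<subseteq> S"
proof -
  have m: "meval ffc_const p F \<in> S" if "F \<in> forms UNIV N d" for F d
  proof -
    have "Poly_Mapping.keys m \<subseteq> {..<N}" if "m \<in> Poly_Mapping.keys F" for m
      using \<open>F \<in> forms UNIV N d\<close> that by (auto simp: U.forms_iff)
    then show ?thesis unfolding meval_def
      by (intro S_sum S_mult S_prod S_power S_const assms) blast
  qed
  then show ?thesis unfolding fun_field_def by (auto intro: S_divide)
qed

end

lemma fun_field_const_field: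
  fixes p :: "nat \<Rightarrow> 'k::field ffc"
  shows "const_field (fun_field N p)"
proof
  interpret c: field_map "ffc_const :: 'k \<Rightarrow> 'k ffc" by (rule field_map_ffc_const)
  let ?g = "meval ffc_const p"
  have I: "?g F / ?g G \<in> fun_field N p" if "F \<in> forms UNIV N d" "G \<in> forms UNIV N d" "?g G \<noteq> 0" for F G d
    using that unfolding fun_field_def by blast
  show "ffc_const c \<in> fun_field N p" for c
    using I[of "mconst c" 0 1] by (simp add: U.forms_const U.forms_1 c.meval_const)
  fix f assume "f \<in> fun_field N p"
  then obtain F G d where f: "F \<in> forms UNIV N d" "G \<in> forms UNIV N d" "?g G \<noteq> 0" "f = ?g F / ?g G"
    unfolding fun_field_def by blast
  show "inverse f \<in> fun_field N p"
  proof (cases "?g F = 0")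
    case True
    then show ?thesis using I[OF U.forms_0 U.forms_1] f by simp
  next
    case False
    then show ?thesis using I[OF f(2,1)] f(4) by simp
  qed
  fix g assume "g \<in> fun_field N p"
  then obtain F' G' d' where g: "F' \<in> forms UNIV N d'" "G' \<in> forms UNIV N d'" "?g G' \<noteq> 0" "g = ?g F' / ?g G'"
    unfolding fun_field_def by blast
  have "?g (F * F') / ?g (G * G') \<in> fun_field N p"
    by (rule I[of _ "d + d'"]) (use f g in \<open>simp_all add: U.forms_mult c.meval_mult\<close>)
  then show "f * g \<in> fun_field N p" using f g by (simp add: c.meval_mult)
  have "?g (F * G' + G * F') / ?g (G * G') \<in> fun_field N p"
    by (rule I[of _ "d + d'"]) (use f g in \<open>simp_all add: U.forms_mult U.forms_add c.meval_mult\<close>)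
  also have "?g (F * G' + G * F') / ?g (G * G') = f + g"
    unfolding f(4) g(4) using f(3) g(3) by (simp add: c.meval_add c.meval_mult add_frac_eq mult.commute)
  finally show "f + g \<in> fun_field N p" .
qed

lemma fun_field_coord:
  assumes "i < N" "j < N" "p j = 1"
  shows "p i \<in> fun_field N (p :: nat \<Rightarrow> 'k::field ffc)"
proof -
  interpret c: field_map "ffc_const :: 'k \<Rightarrow> 'k ffc" by (rule field_map_ffc_const)
  have "p i = meval ffc_const p (mvar i) / meval ffc_const p (mvar j)" "meval ffc_const p (mvar j) \<noteq> 0"
    using assms by (simp_all add: c.meval_var)
  then show ?thesis unfolding fun_field_def using assms U.forms_var by blast
qed


section \<open>Change of Weierstrass coordinates\<close>

lemma wchange_identity:
  fixes A b :: "'k::field wcoeffs"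
  shows "weq A (u^2 * x + r) (u^3 * y + u^2 * s * x + t) - u^6 * weq b x y =
      (2 * u^5 * s + a1 A * u^5 - u^6 * a1 b) * x * y
    + (2 * u^3 * t + a1 A * r * u^3 + a3 A * u^3 - u^6 * a3 b) * y
    + (u^4 * s^2 + a1 A * u^4 * s - 3 * u^4 * r - a2 A * u^4 + u^6 * a2 b) * x^2
    + (2 * u^2 * s * t + a1 A * (u^2 * t + r * u^2 * s) + a3 A * u^2 * s - 3 * u^2 * r^2 - 2 * a2 A * u^2 * r - a4 A * u^2 + u^6 * a4 b) * x
    + (t^2 + a1 A * r * t + a3 A * t - r^3 - a2 A * r^2 - a4 A * r - a6 A + u^6 * a6 b)"
  by (simp add: weq_def algebra_simps eval_nat_numeral)

locale wchange_curves =
  fixes A b :: "q2 wcoeffs" and u r s t :: q2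
  assumes u: "u \<noteq> 0"
    and change: "\<And>x y. weq A (u^2 * x + r) (u^3 * y + u^2 * s * x + t) = u^6 * weq b x y"
begin

text \<open>The difference of the two sides of \<open>change\<close> is a polynomial in x and y with
  these five coefficients. Its values at (0,0), (0,1), (1,0), (-1,0) and (1,1) show that they
  vanish, after which the relation passes to every extension field.\<close>

lemma coeffs:
  "2 * u^5 * s + a1 A * u^5 - u^6 * a1 b = 0" (is "?c1 = 0")
  "2 * u^3 * t + a1 A * r * u^3 + a3 A * u^3 - u^6 * a3 b = 0" (is "?c3 = 0")
  "u^4 * s^2 + a1 A * u^4 * s - 3 * u^4 * r - a2 A * u^4 + u^6 * a2 b = 0" (is "?c2 = 0")
  "2 * u^2 * s * t + a1 A * (u^2 * t + r * u^2 * s) + a3 A * u^2 * s - 3 * u^2 * r^2 - 2 * a2 A * u^2 * r - a4 A * u^2 + u^6 * a4 b = 0" (is "?c4 = 0")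
  "t^2 + a1 A * r * t + a3 A * t - r^3 - a2 A * r^2 - a4 A * r - a6 A + u^6 * a6 b = 0" (is "?c6 = 0")
proof -
  obtain c1 c2 c3 c4 c6 where c: "?c1 = c1" "?c2 = c2" "?c3 = c3" "?c4 = c4" "?c6 = c6" by blast
  have z: "c1 * x * y + c3 * y + c2 * x^2 + c4 * x + c6 = 0" for x y
    using wchange_identity[of A u x r y s t b] unfolding change c by simp
  have 6: "c6 = 0" using z[of 0 0] by simp
  have 3: "c3 = 0" using z[of 0 1] 6 by simp
  have p: "c2 + c4 = 0" using z[of 1 0] 6 by simp
  have m: "c2 - c4 = 0" using z[of "- 1" 0] 6 by simp
  have "2 * c2 = (c2 + c4) + (c2 - c4)" by simp
  then have 2: "c2 = 0" unfolding p m by simp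
  then have 4: "c4 = 0" using p by simp
  have 1: "c1 = 0" using z[of 1 1] 2 3 4 6 by simp
  show "?c1 = 0" "?c3 = 0" "?c2 = 0" "?c4 = 0" "?c6 = 0" unfolding c using 1 2 3 4 6 by simp_all
qed

context
  fixes h :: "q2 \<Rightarrow> 'b::field"
  assumes h: "field_map h"
begin

interpretation h: field_map h by (rule h)

lemma coeffs_ext:
  "2 * h u^5 * h s + h (a1 A) * h u^5 - h u^6 * h (a1 b) = 0"
  "2 * h u^3 * h t + h (a1 A) * h r * h u^3 + h (a3 A) * h u^3 - h u^6 * h (a3 b) = 0"
  "h u^4 * h s^2 + h (a1 A) * h u^4 * h s - 3 * h u^4 * h r - h (a2 A) * h u^4 + h u^6 * h (a2 b) = 0"
  "2 * h u^2 * h s * h t + h (a1 A) * (h u^2 * h t + h r * h u^2 * h s) + h (a3 A) * h u^2 * h s - 3 * h u^2 * h r^2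
     - 2 * h (a2 A) * h u^2 * h r - h (a4 A) * h u^2 + h u^6 * h (a4 b) = 0"
  "h t^2 + h (a1 A) * h r * h t + h (a3 A) * h t - h r^3 - h (a2 A) * h r^2 - h (a4 A) * h r - h (a6 A) + h u^6 * h (a6 b) = 0"
  using coeffs[THEN arg_cong[of _ _ h]] by simp_all

lemma change_ext:
  "weq (map_wcoeffs h A) (h u^2 * x + h r) (h u^3 * y + h u^2 * h s * x + h t) = h u^6 * weq (map_wcoeffs h b) x y"
proof -
  have "weq (map_wcoeffs h A) (h u^2 * x + h r) (h u^3 * y + h u^2 * h s * x + h t) - h u^6 * weq (map_wcoeffs h b) x y = 0"
    unfolding wchange_identity wcoeffs_sel coeffs_ext by simp
  then show ?thesis by simp
qed

lemma change_ext_y: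
  "weq_y (map_wcoeffs h A) (h u^2 * x + h r) (h u^3 * y + h u^2 * h s * x + h t) * h u^3 = h u^6 * weq_y (map_wcoeffs h b) x y"
proof -
  have "weq_y (map_wcoeffs h A) (h u^2 * x + h r) (h u^3 * y + h u^2 * h s * x + h t) * h u^3 - h u^6 * weq_y (map_wcoeffs h b) x y
    = (2 * h u^5 * h s + h (a1 A) * h u^5 - h u^6 * h (a1 b)) * x
    + (2 * h u^3 * h t + h (a1 A) * h r * h u^3 + h (a3 A) * h u^3 - h u^6 * h (a3 b))"
    by (simp add: weq_y_def wcoeffs_sel algebra_simps eval_nat_numeral)
  then show ?thesis unfolding coeffs_ext by simp
qed

text \<open>Chain rule: x enters the new first coordinate with factor u^2 and the new second one
  with factor u^2 s.\<close>

lemma change_ext_x: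
  "h u^2 * (weq_x (map_wcoeffs h A) (h u^2 * x + h r) (h u^3 * y + h u^2 * h s * x + h t)
     + h s * weq_y (map_wcoeffs h A) (h u^2 * x + h r) (h u^3 * y + h u^2 * h s * x + h t)) = h u^6 * weq_x (map_wcoeffs h b) x y"
proof -
  have "h u^2 * (weq_x (map_wcoeffs h A) (h u^2 * x + h r) (h u^3 * y + h u^2 * h s * x + h t)
     + h s * weq_y (map_wcoeffs h A) (h u^2 * x + h r) (h u^3 * y + h u^2 * h s * x + h t)) - h u^6 * weq_x (map_wcoeffs h b) x y
    = (2 * h u^5 * h s + h (a1 A) * h u^5 - h u^6 * h (a1 b)) * y
    + 2 * (h u^4 * h s^2 + h (a1 A) * h u^4 * h s - 3 * h u^4 * h r - h (a2 A) * h u^4 + h u^6 * h (a2 b)) * x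
    + (2 * h u^2 * h s * h t + h (a1 A) * (h u^2 * h t + h r * h u^2 * h s) + h (a3 A) * h u^2 * h s - 3 * h u^2 * h r^2
     - 2 * h (a2 A) * h u^2 * h r - h (a4 A) * h u^2 + h u^6 * h (a4 b))"
    by (simp add: weq_x_def weq_y_def wcoeffs_sel algebra_simps eval_nat_numeral)
  then show ?thesis unfolding coeffs_ext by simp
qed

text \<open>The good model provides smoothness modulo 2. In characteristic 0 smoothness comes from
  the rational curve: a singular point of \<open>b\<close> is carried to a double root of the
  discriminant of \<open>A\<close>.\<close>

lemma change_smooth:
  assumes sep: "\<And>x. poly (wdisc (map_wcoeffs h A)) x = 0 \<Longrightarrow> poly (pderiv (wdisc (map_wcoeffs h A))) x \<noteq> 0"
    and w: "weq (map_wcoeffs h b) x y = 0"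
  shows "weq_x (map_wcoeffs h b) x y \<noteq> 0 \<or> weq_y (map_wcoeffs h b) x y \<noteq> 0"
proof (rule ccontr)
  let ?X = "h u^2 * x + h r" and ?Y = "h u^3 * y + h u^2 * h s * x + h t"
  assume n: "\<not> ?thesis"
  have 0: "weq (map_wcoeffs h A) ?X ?Y = 0" using change_ext[of x y] w by simp
  have y: "weq_y (map_wcoeffs h A) ?X ?Y = 0" using change_ext_y[of x y] n u by simp
  have x: "weq_x (map_wcoeffs h A) ?X ?Y = 0" using change_ext_x[of x y] n u y by simp
  have "poly (wdisc (map_wcoeffs h A)) ?X = 0" using weq_wdisc[of "map_wcoeffs h A" ?X ?Y] 0 y by simp
  moreover have "poly (pderiv (wdisc (map_wcoeffs h A))) ?X = 0" using weq_x_wdisc[of "map_wcoeffs h A" ?X ?Y] x y by simp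
  ultimately show False using sep by blast
qed

end

text \<open>The coordinate change is inverted, so that a pair in x and y becomes a pair in x' and
  y', to which genericity applies.\<close>

lemma change_generic:
  assumes g: "generic_xy A x' y'"
    and x'_eq: "x' = ffc_const u^2 * x + ffc_const r" and y'_eq: "y' = ffc_const u^3 * y + ffc_const u^2 * ffc_const s * x + ffc_const t"
  shows "generic_xy b x y"
  unfolding generic_xy_def
proof (intro conjI allI impI)
  interpret c: field_map "ffc_const :: q2 \<Rightarrow> q2 ffc" by (rule field_map_ffc_const)
  show "weq (map_wcoeffs ffc_const b) x y = 0"
    using change_ext[OF field_map_ffc_const, of x y] g u unfolding generic_xy_def x'_eq y'_eq by simp
  fix P assume z: "pval ffc_const P x y = 0"
  obtain M N where P: "P = (M, N)" by force
  let ?m = "\<lambda>P z. poly (map_poly ffc_const P) z"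
  \<comment> \<open>The inverse substitution x = (x' - r) / u^2.\<close>
  define L where "L = [:- r / u^2, 1 / u^2:]"
  have dL: "Polynomial.degree L > 0" using u by (simp add: L_def)
  have u0: "ffc_const u \<noteq> 0" using u by simp
  have "?m L x' = (x' - ffc_const r) / ffc_const u ^ 2"
    by (simp add: L_def diff_divide_distrib)
  then have xL: "?m L x' = x" unfolding x'_eq using u0 by simp
  have comp: "?m (pcompose M L) x' = ?m M x" for M
    by (induction M) (simp_all add: pcompose_pCons xL)
  \<comment> \<open>From u^3 y = y' - s (x' - r) - t.\<close>
  define K where "K = [:s * r - t, - s:]"
  have "?m K x' + y' = ffc_const u ^ 3 * y"
    by (simp add: K_def x'_eq y'_eq algebra_simps)
  then have yK: "ffc_const (1 / u^3) * (?m K x' + y') = y" using u0 by simp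
  let ?N = "pcompose N L"
  have "pval ffc_const (pcompose M L + smult (1 / u^3) (?N * K), smult (1 / u^3) ?N) x' y'
     = ?m M x + ?m N x * (ffc_const (1 / u^3) * (?m K x' + y'))"
    by (simp only: pval.simps c.map_poly_h_add c.map_poly_h_smult c.map_poly_h_mult poly_add poly_smult poly_mult comp)
      (simp add: algebra_simps add_divide_distrib)
  also have "\<dots> = 0" unfolding yK using z by (simp add: P)
  finally have MN: "(pcompose M L + smult (1 / u^3) (?N * K), smult (1 / u^3) ?N) = (0, 0)"
    using g unfolding generic_xy_def by blast
  then have N0: "?N = 0" using u by simp
  have "pcompose M L = 0" using MN unfolding N0 by simp
  then have "M = 0" "N = 0" using pcompose_eq_0[OF _ dL] N0 by blast+
  then show "P = (0, 0)" by (simp add: P)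
qed

end

section \<open>Valuations\<close>

context ext_val
begin

lemma v_pos_ge: "0 < v c \<Longrightarrow> 0 < v d \<or> 0 \<le> v d \<Longrightarrow> 0 < v (c * d)"
  by (cases "v c"; cases "v d") (auto simp: v_mult zero_ereal_def)

lemma v_Z2_mult_pos: "e \<in> Z2 \<Longrightarrow> 0 < v c \<Longrightarrow> 0 < v (to_ac e * c)"
  using v_pos_ge[of c "to_ac e"] v_Z2[of e] by (simp add: mult.commute)

text \<open>In the formal group, \<open>z\<close> is \<open>x\<^sup>3\<close> times a unit.\<close>

lemma formal_group_valuation:
  assumes b: "set_wcoeffs b \<subseteq> Z2" and z: "z \<noteq> 0"
    and w: "weq (map_wcoeffs to_ac b) (x / z) (1 / z) = 0"
    and pos: "0 < v x" "0 < v z" and m: "min (v x) (v z) = ereal (2/3)"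
  shows "v x = ereal (2/3)" and "v z = ereal 2"
proof -
  have c: "a1 b \<in> Z2" "a2 b \<in> Z2" "a3 b \<in> Z2" "a4 b \<in> Z2" "a6 b \<in> Z2" using b by (cases b; simp)+
  let ?d = "to_ac (a1 b) * x + to_ac (a3 b) * z - to_ac (a2 b) * (x * x) - to_ac (a4 b) * (x * z) - to_ac (a6 b) * (z * z)"
  \<comment> \<open>The homogeneous equation at (x : 1 : z): every term except x^3 is divisible by
    z, and the terms of \<open>?d\<close> have integral coefficients times x or z.\<close>
  have "z ^ 3 * weq (map_wcoeffs to_ac b) (x / z) (1 / z) = z * (1 + ?d) - x ^ 3"
    using z by (simp add: weq_def wcoeffs_sel field_simps power2_eq_square power3_eq_cube)
  then have eq: "z * (1 + ?d) = x ^ 3" using w by simp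
  have "0 < v ?d"
    by (intro v_add_gt v_diff_gt v_Z2_mult_pos c pos v_pos_ge disjI1)
  then have "v (1 + ?d) = v 1" by (intro v_add_eq) simp
  then have vz: "v z = v (x ^ 3)" using eq v_mult[of z "1 + ?d"] by simp
  have x: "x \<noteq> 0" using eq z vz v_fin[OF z] by auto
  then obtain \<rho> where \<rho>: "v x = ereal \<rho>" using v_real by blast
  have z3: "v z = ereal (3 * \<rho>)" using v_power[OF x \<rho>, of 3] vz by simp
  have "\<rho> > 0" using pos(1) \<rho> by simp
  then have "\<rho> = 2/3" using m unfolding \<rho> z3 by (simp add: min_def split: if_splits)
  then show "v x = ereal (2/3)" "v z = ereal 2" using \<rho> z3 by simp_all
qed

text \<open>The valuation of \<alpha> x lies in 2/3 + Z and that of \<gamma> z in Z. They differ, so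
  the smaller one is the valuation of the sum -1, namely 0, and it must be the integral one. Thus
  \<gamma> has valuation -2, and \<alpha> has an integral valuation above -2/3, hence a nonnegative
  one.\<close>

lemma line_valuation:
  assumes x: "v x = ereal (2/3)" and z: "v z = ereal 2"
    and l: "1 + to_ac \<alpha> * x + to_ac \<gamma> * z = 0"
  shows "\<alpha> \<in> Z2" and "\<gamma> \<noteq> 0" and "norm_q2 \<gamma> = 4"
proof -
  have ax: "v (to_ac \<alpha> * x) = val_q2 \<alpha> + ereal (2/3)" and gz: "v (to_ac \<gamma> * z) = val_q2 \<gamma> + ereal 2"
    by (simp_all add: v_mult v_to_ac x z)
  have sum: "to_ac \<alpha> * x + to_ac \<gamma> * z = - 1" using l by (simp add: eq_neg_iff_add_eq_0 add.commute add.left_commute)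
  have vs: "v (to_ac \<alpha> * x + to_ac \<gamma> * z) = 0" unfolding sum by simp
  have alpha: "\<alpha> = 0 \<or> (\<exists>m::int. val_q2 \<alpha> = ereal m)" and gamma: "\<gamma> = 0 \<or> (\<exists>n::int. val_q2 \<gamma> = ereal n)"
    using val_q2_int by blast+
  have g0: "\<gamma> \<noteq> 0"
  proof
    assume "\<gamma> = 0"
    then have s: "v (to_ac \<alpha> * x) = 0" using vs by simp
    then have "\<alpha> \<noteq> 0" by auto
    then obtain m :: int where "val_q2 \<alpha> = ereal m" using alpha by blast
    then have "real_of_int m + 2/3 = 0" using s unfolding ax by (simp add: zero_ereal_def)
    then have "real_of_int (3 * m + 2) = 0" by simp
    then have "3 * m + 2 = 0" by (simp only: of_int_eq_0_iff)
    then show False by presburger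
  qed
  then obtain n :: int where n: "val_q2 \<gamma> = ereal n" using gamma by blast
  have "n = - 2 \<and> \<alpha> \<in> Z2"
  proof (cases "\<alpha> = 0")
    case True
    then have "v (to_ac \<gamma> * z) = 0" using vs by simp
    then have "real_of_int n + 2 = 0" unfolding gz n by (simp add: zero_ereal_def)
    then show ?thesis using True by simp
  next
    case False
    then obtain m :: int where m: "val_q2 \<alpha> = ereal m" using alpha by blast
    have ne: "real_of_int m + 2/3 \<noteq> real_of_int n + 2"
    proof
      assume "real_of_int m + 2/3 = real_of_int n + 2"
      then have "real_of_int (3 * m + 2) = real_of_int (3 * n + 6)" by simp
      then have "3 * m + 2 = 3 * n + 6" by (simp only: of_int_eq_iff)
      then show False by presburger
    qed
    show ?thesis
    proof (cases "real_of_int m + 2/3 < real_of_int n + 2")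
      case True
      then have "v (to_ac \<alpha> * x) < v (to_ac \<gamma> * z)" unfolding ax gz m n by simp
      then have "v (to_ac \<alpha> * x) = 0" using v_add_eq vs by metis
      then have "real_of_int m + 2/3 = 0" unfolding ax m by (simp add: zero_ereal_def)
      then have "real_of_int (3 * m + 2) = 0" by simp
      then have "3 * m + 2 = 0" by (simp only: of_int_eq_0_iff)
      then show ?thesis by presburger
    next
      case False
      then have lt: "real_of_int n + 2 < real_of_int m + 2/3" using ne by simp
      then have "v (to_ac \<gamma> * z) < v (to_ac \<alpha> * x)" unfolding ax gz m n by simp
      then have "v (to_ac \<gamma> * z) = 0" using v_add_eq vs by (metis add.commute)
      then have n2: "real_of_int n + 2 = 0" unfolding gz n by (simp add: zero_ereal_def)
      then have "real_of_int m + 2/3 > 0" using lt by simp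
      then have "real_of_int (3 * m + 2) > 0" by simp
      then have "3 * m + 2 > 0" by (simp only: of_int_0_less_iff)
      then have "m \<ge> 0" by presburger
      then show ?thesis using n2 m by (simp add: Z2_def)
    qed
  qed
  then show "\<alpha> \<in> Z2" "\<gamma> \<noteq> 0" using g0 by simp_all
  have "- log 2 (norm_q2 \<gamma>) = - 2" using n \<open>n = - 2 \<and> \<alpha> \<in> Z2\<close> g0 by (simp add: val_q2_def)
  then have l2: "log 2 (norm_q2 \<gamma>) = 2" by simp
  have "norm_q2 \<gamma> = 2 powr (log 2 (norm_q2 \<gamma>))" using norm_q2_pos[OF g0] by simp
  then show "norm_q2 \<gamma> = 4" unfolding l2 by simp
qed

text \<open>The line \<open>y + \<alpha> x + \<gamma> = 0\<close> meets the curve transversally: the abscissas of the intersection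
  points would have valuation \<open>-4/3\<close>, and then \<open>3 x\<^sup>2\<close> dominates the derivative of the cubic that
  defines them.\<close>

lemma line_transversal:
  assumes b: "set_wcoeffs b \<subseteq> Z2" and al: "\<alpha> \<in> Z2" and ga: "norm_q2 \<gamma> = 4"
    and y: "y = - (to_ac \<alpha> * x + to_ac \<gamma>)"
    and w: "weq (map_wcoeffs to_ac b) x y = 0"
    and d: "weq_x (map_wcoeffs to_ac b) x y = to_ac \<alpha> * weq_y (map_wcoeffs to_ac b) x y"
  shows False
proof -
  have c: "a1 b \<in> Z2" "a2 b \<in> Z2" "a3 b \<in> Z2" "a4 b \<in> Z2" "a6 b \<in> Z2" using b by (cases b; simp)+
  \<comment> \<open>The unit 4 \<gamma> clears the denominators of the cubic for x.\<close>
  define g where "g = 4 * \<gamma>"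
  have n4: "norm_q2 4 = 1/4" using norm_q2_of_rat[of 4] by (simp add: abs2_rat_4)
  have ng: "norm_q2 g = 1" by (simp add: g_def norm_q2_mult n4 ga)
  then have gZ: "g \<in> Z2" by (simp add: Z2_iff)
  have num: "numeral k \<in> Z2" for k
  proof -
    have "of_nat n \<in> Z2" for n by (induction n) (auto intro: Z2.R_add)
    from this[of "numeral k"] show ?thesis by simp
  qed
  \<comment> \<open>With y eliminated, 16 times the cubic is 16 x^3 + 16 c x^2 + 4 d x + k, where c
    and d are integral and k is a unit because of the term - g^2.\<close>
  let ?c = "a2 b - \<alpha>^2 + a1 b * \<alpha>"
  let ?d = "4 * a4 b - 2 * (\<alpha> * g) + a1 b * g + 4 * (a3 b * \<alpha>)"
  let ?k = "16 * a6 b - g^2 + 4 * (a3 b * g)"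
  have cZ: "?c \<in> Z2" by (intro Z2.R_add Z2.R_diff Z2.R_mult Z2.R_power c al)
  have dZ: "?d \<in> Z2" by (intro Z2.R_add Z2.R_diff Z2.R_mult num c al gZ)
  have gg: "to_ac g = 4 * to_ac \<gamma>" by (simp add: g_def)
  have e1: "16 * x^3 + 16 * to_ac ?c * x^2 + 4 * to_ac ?d * x + to_ac ?k = - 16 * weq (map_wcoeffs to_ac b) x y"
    unfolding y by (simp add: weq_def wcoeffs_sel gg algebra_simps power2_eq_square power3_eq_cube)
  have e2: "4 * (3 * x^2) + 8 * to_ac ?c * x + to_ac ?d
      = - 4 * (weq_x (map_wcoeffs to_ac b) x y - to_ac \<alpha> * weq_y (map_wcoeffs to_ac b) x y)"
    unfolding y by (simp add: weq_x_def weq_y_def wcoeffs_sel gg algebra_simps power2_eq_square)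
  have v4: "v 4 = ereal 2" using v_mult[of 2 2] v_2 by (simp add: one_ereal_def)
  have v8: "v 8 = ereal 3" using v_mult[of 4 2] v_2 v4 by (simp add: one_ereal_def)
  have v16: "v 16 = ereal 4" using v_mult[of 4 4] v4 by simp
  have vc: "ereal 0 \<le> v (to_ac ?c)" and vd: "ereal 0 \<le> v (to_ac ?d)"
    using v_Z2[OF cZ] v_Z2[OF dZ] unfolding zero_ereal_def by blast+
  have vk: "v (to_ac ?k) = 0"
  proof -
    have "norm_q2 (4 * (4 * a6 b + a3 b * g)) < 1"
    proof -
      have "4 * a6 b + a3 b * g \<in> Z2" by (intro Z2.R_add Z2.R_mult num c gZ)
      then show ?thesis by (simp only: norm_q2_mult n4) (simp add: Z2_iff)
    qed
    moreover have "norm_q2 (- (g^2)) = 1" using ng by (simp add: power2_eq_square norm_q2_mult)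
    ultimately have n: "norm_q2 (- (g^2) + 4 * (4 * a6 b + a3 b * g)) = 1" by (subst norm_q2_add_eq) simp_all
    have e: "- (g^2) + 4 * (4 * a6 b + a3 b * g) = ?k" by (simp add: algebra_simps)
    have "norm_q2 ?k = 1" using n unfolding e .
    moreover from this have "?k \<noteq> 0" by (metis norm_q2_0 zero_neq_one)
    ultimately show ?thesis by (simp only: v_to_ac val_q2_def) (simp add: zero_ereal_def)
  qed
  have k0: "to_ac ?k \<noteq> 0" using vk v_0 by (metis infinity_ereal_def ereal.distinct(1) zero_ereal_def)
  have E1: "16 * x^3 + (16 * to_ac ?c * x^2 + 4 * to_ac ?d * x) = - to_ac ?k"
    using e1 w by (simp only: add.assoc eq_neg_iff_add_eq_0 mult_zero_right)
  have E2: "4 * (3 * x^2) + (8 * to_ac ?c * x + to_ac ?d) = 0"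
    using e2 d by (simp only: add.assoc diff_self mult_zero_right)
  have x0: "x \<noteq> 0"
  proof
    assume x: "x = 0"
    have "- to_ac ?k = 0" unfolding E1[symmetric] x by simp
    then show False using k0 by (simp only: neg_equal_0_iff_equal)
  qed
  then obtain \<rho> where \<rho>: "v x = ereal \<rho>" using v_real by blast
  have x2: "v (x^2) = ereal (2 * \<rho>)" and x3: "v (x^3) = ereal (3 * \<rho>)"
    using v_power[OF x0 \<rho>, of 2] v_power[OF x0 \<rho>, of 3] by simp_all
  have ge: "ereal (t + r) \<le> v (n * to_ac e * w)" if "v n = ereal t" "ereal 0 \<le> v (to_ac e)" "v w = ereal r" for n e w t r
    using that by (cases "v (to_ac e)") (auto simp: v_mult)
  show False
  \<comment> \<open>Above -4/3 all terms except k have positive valuation, which contradicts the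
    equation. Otherwise 12 x^2 has strictly the smallest valuation in 12 x^2 + 8 c x + d, which
    contradicts tangency.\<close>
  proof (cases "\<rho> > - 4/3")
    case True
    have "0 < v (16 * x^3)" using True by (simp add: v_mult v16 x3 zero_ereal_def)
    moreover have "0 < v (16 * to_ac ?c * x^2)"
    proof -
      have "0 < ereal (4 + 2 * \<rho>)" using True by (simp add: zero_ereal_def)
      then show ?thesis using ge[OF v16 vc x2] by (rule less_le_trans)
    qed
    moreover have "0 < v (4 * to_ac ?d * x)"
    proof -
      have "0 < ereal (2 + \<rho>)" using True by (simp add: zero_ereal_def)
      then show ?thesis using ge[OF v4 vd \<rho>] by (rule less_le_trans)
    qed
    ultimately have "0 < v (16 * x^3 + (16 * to_ac ?c * x^2 + 4 * to_ac ?d * x))" by (intro v_add_gt)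
    then show False unfolding E1 v_uminus vk by simp
  next
    case False
    have m: "v (4 * (3 * x^2)) = ereal (2 + 2 * \<rho>)" by (simp only: v_mult v4 v_3 x2) simp
    have "v (4 * (3 * x^2)) < v (8 * to_ac ?c * x)"
    proof -
      have "ereal (2 + 2 * \<rho>) < ereal (3 + \<rho>)" using False by simp
      then show ?thesis unfolding m using ge[OF v8 vc \<rho>] by (rule less_le_trans)
    qed
    moreover have "v (4 * (3 * x^2)) < v (to_ac ?d)"
    proof -
      have "ereal (2 + 2 * \<rho>) < ereal 0" using False by simp
      then show ?thesis unfolding m using vd by (rule less_le_trans)
    qed
    ultimately have "v (4 * (3 * x^2)) < v (8 * to_ac ?c * x + to_ac ?d)" by (rule v_add_gt)
    from v_add_eq[OF this] have "v 0 = ereal (2 + 2 * \<rho>)" unfolding E2 m .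
    then show False by simp
  qed
qed

end


section \<open>Passage to the 2-adic numbers and the good model\<close>

lemma (in field_map) weq_map: "weq (map_wcoeffs h a) (h x) (h y) = h (weq a x y)"
  by (simp add: weq_def wcoeffs_sel)

lemma map_wcoeffs_comp: "map_wcoeffs g (map_wcoeffs h a) = map_wcoeffs (\<lambda>c. g (h c)) a"
  by (cases a) simp

lemma good_weierstrass_model_change:
  assumes "good_weierstrass_model a b u r s t"
  shows "wchange_curves (map_wcoeffs of_rat a) b u r s t"
proof
  interpret q: field_map "of_rat :: rat \<Rightarrow> q2" by (rule field_map_of_rat)
  interpret i: field_map "id :: q2 \<Rightarrow> q2" by (rule field_map_id)
  show "u \<noteq> 0" using assms by (simp add: good_weierstrass_model_def)
  fix x y
  have "meval of_rat (wchange u r s t (vec3 x y 1)) (wform a) = u^6 * meval id (vec3 x y 1) (wform b)"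
    using assms by (simp add: good_weierstrass_model_def)
  moreover have "wchange u r s t (vec3 x y 1) = vec3 (u^2 * x + r) (u^3 * y + u^2 * s * x + t) 1"
    by (simp add: wchange_def)
  ultimately show "weq (map_wcoeffs of_rat a) (u^2 * x + r) (u^3 * y + u^2 * s * x + t) = u^6 * weq b x y"
    by (simp add: q.meval_wform_affine i.meval_wform_affine)
qed

text \<open>An identity of rational pairs is evaluated at the generic point over the 2-adic numbers,
  where the pair of G is still nonzero and can be cancelled.\<close>

lemma ratfun_line:
  fixes a :: "rat wcoeffs" and d :: rat
  assumes F: "F \<in> mpolys UNIV 3" and G: "G \<in> mpolys UNIV 3" and Gz: "wred a G \<noteq> (0, 0)"
    and FG: "wred a F = pmul a (wred a G) ([:c0, c1:], [:c2:])"
  shows "ratfun (map_wcoeffs of_rat a) (Poly_Mapping.map of_rat (mconst d * F)) (Poly_Mapping.map of_rat G)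
    = ffc_const (of_rat d :: q2) * (ffc_const (of_rat c0) + ffc_const (of_rat c1) * ffc_t
      + ffc_const (of_rat c2) * wgeneric (map_wcoeffs of_rat a) 1)"
proof -
  interpret q: field_map "of_rat :: rat \<Rightarrow> q2" by (rule field_map_of_rat)
  let ?h = "\<lambda>c. ffc_const (of_rat c :: q2)"
  let ?A = "map_wcoeffs of_rat a :: q2 wcoeffs"
  let ?t = "ffc_t :: q2 ffc" and ?Y = "wgeneric ?A 1"
  have h: "field_map ?h" by (rule field_map_comp[OF field_map_ffc_const field_map_of_rat])
  interpret h: field_map ?h by (rule h)
  have w: "weq (map_wcoeffs ?h a) ?t ?Y = 0"
    using weq_wgeneric[of ?A] by (simp add: map_wcoeffs_comp)
  have ev: "meval ffc_const (wgeneric ?A) (Poly_Mapping.map of_rat M) = meval ?h (wgeneric ?A) M" for M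
    by (rule q.meval_map[OF field_map_ffc_const])
  have val: "meval ?h (wgeneric ?A) M = pval ?h (wred a M) ?t ?Y" if "M \<in> mpolys UNIV 3" for M
    by (subst wgeneric_vec3) (rule h.meval_affine[OF w that])
  have nz: "pval ?h (wred a G) ?t ?Y \<noteq> 0"
  proof
    assume z: "pval ?h (wred a G) ?t ?Y = 0"
    obtain U V where UV: "wred a G = (U, V)" by force
    have "pval ffc_const (map_poly (of_rat :: rat \<Rightarrow> q2) U, map_poly of_rat V) ?t ?Y = 0"
      using z unfolding UV pval_map_poly[OF field_map_of_rat field_map_ffc_const] .
    then have "(map_poly (of_rat :: rat \<Rightarrow> q2) U, map_poly (of_rat :: rat \<Rightarrow> q2) V) = (0, 0)"
      using generic_wgeneric[of ?A] unfolding generic_xy_def by blast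
    then show False using UV Gz by simp
  qed
  have "meval ?h (wgeneric ?A) (mconst d * F) = ?h d * (pval ?h (wred a G) ?t ?Y * pval ?h ([:c0, c1:], [:c2:]) ?t ?Y)"
    by (simp add: h.meval_mult h.meval_const val[OF F] FG h.pval_pmul[OF w] del: pval.simps One_nat_def)
  then show ?thesis
    using nz unfolding ratfun_def ev val[OF G] by (simp add: algebra_simps del: One_nat_def)
qed

theorem proposition2p9:
  fixes a :: "rat wcoeffs"
    and P :: "nat \<Rightarrow> rat alg_closure wpoint"
    and D D' :: divisor
    and F G :: "rat mpoly"
    and b :: "q2 wcoeffs"
    and u r s t :: q2
    and \<iota> :: "rat alg_closure \<Rightarrow> q2 alg_closure"
    and v\<^sub>2 :: "q2 alg_closure \<Rightarrow> ereal"
    and x z :: "nat \<Rightarrow> q2 alg_closure"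
  assumes "smooth_weierstrass a"
    and "inj_on P {1..4}"
    and "D = (\<lambda>Q. if Q \<in> P ` {1..4} then 1 else 0)"
    and "rational_divisor a D"
    and "rational_divisor a D'"
    and "lin_equiv a D (\<lambda>Q. 2 * D' Q)"
    and "nonzero_ratfun a F G"
    and "div_of a F G = (\<lambda>Q. D Q - 2 * D' Q)"
    and "P 4 = Infty"
    and "D' = (\<lambda>Q. if Q = Infty then 2 else 0)"
    and "good_weierstrass_model a b u r s t"
    and "field_hom \<iota>"
    and "extends_val2 v\<^sub>2"
    and "\<And>i. i \<in> {1..3} \<Longrightarrow> \<exists>c. c \<noteq> 0 \<and> (\<forall>j<3.
           wchange (to_ac u) (to_ac r) (to_ac s) (to_ac t) (vec3 (x i) 1 (z i)) j
             = c * \<iota> (pcoords (P i) j))"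
    and "x 4 = 0" and "z 4 = 0"
    and "\<And>i. i \<in> {1..3} \<Longrightarrow> v\<^sub>2 (x i) > 0 \<and> v\<^sub>2 (z i) > 0"
    and "\<And>i j. i \<in> {1..4} \<Longrightarrow> j \<in> {1..4} \<Longrightarrow> i \<noteq> j \<Longrightarrow>
           min (v\<^sub>2 (x i - x j)) (v\<^sub>2 (z i - z j)) = ereal (2/3)"
  shows "\<exists>d::rat. d \<noteq> 0 \<and> double_cover_good_reduction a (mconst d * F) G"
proof -
  note smooth = assms(1) and inj = assms(2) and model = assms(11)
  interpret ext_val v\<^sub>2 by unfold_locales (rule assms(13))
  interpret \<iota>: field_map \<iota> by (rule field_map_field_hom[OF assms(12)])
  interpret t: field_map "to_ac :: rat \<Rightarrow> rat alg_closure" by (rule field_map_to_ac)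
  interpret t2: field_map "to_ac :: q2 \<Rightarrow> q2 alg_closure" by (rule field_map_to_ac)
  interpret q: field_map "of_rat :: rat \<Rightarrow> q2" by (rule field_map_of_rat)
  interpret c: field_map "ffc_const :: q2 \<Rightarrow> q2 ffc" by (rule field_map_ffc_const)
  let ?A = "map_wcoeffs of_rat a :: q2 wcoeffs"
  interpret ch: wchange_curves ?A b u r s t by (rule good_weierstrass_model_change[OF model])
  have u0: "u \<noteq> 0" and bZ: "set_wcoeffs b \<subseteq> Z2" and bsm: "smooth_weierstrass (map_wcoeffs reduce2 b)"
    using model by (simp_all add: good_weierstrass_model_def)

  have divD: "div_of a F G Q = (if Q \<in> P ` {1..4} then 1 else 0) - 2 * (if Q = Infty then 2 else 0)" for Q
    using assms(3,8,10) by simp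
  have InfP: "Infty \<in> P ` {1..4}" using assms(9) by (intro image_eqI[of _ _ 4]) simp_all
  \<comment> \<open>\<open>P 4\<close> contributes 1 and \<open>D'\<close> contributes -2 *
    2.\<close>
  have pole: "div_of a F G Infty = - 3" using divD InfP by simp
  have reg: "div_of a F G (Aff X0 Y0) \<ge> 0" for X0 Y0 using divD by simp
  obtain d where FG: "F \<in> forms UNIV 3 d" "G \<in> forms UNIV 3 d"
    and nz: "meval ffc_const (wgeneric a) F \<noteq> 0" "meval ffc_const (wgeneric a) G \<noteq> 0"
    using assms(7) unfolding nonzero_ratfun_def by blast
  obtain c0 c1 c2 where c2: "c2 \<noteq> 0"
    and red: "wred a F = pmul a (wred a G) ([:c0, c1:], [:c2:])"
    and zero: "\<And>X0 Y0. weq (geom a) X0 Y0 = 0 \<Longrightarrow> div_of a F G (Aff X0 Y0) > 0 \<Longrightarrow>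
       to_ac c0 + to_ac c1 * X0 + to_ac c2 * Y0 = 0"
    by (rule function_with_triple_pole[OF smooth FG nz pole reg]) blast

  have "P 1 \<noteq> P 4" using inj by (simp add: inj_on_eq_iff)
  then obtain X1 Y1 where P1: "P 1 = Aff X1 Y1" using assms(9) by (cases "P 1") auto
  have mem: "P 1 \<in> P ` {1..4}" by simp
  have "P 1 \<in> wpoints (geom a)"
    using assms(3,4) mem unfolding rational_divisor_def by auto
  then have w1: "weq (geom a) X1 Y1 = 0" using P1 by (simp add: Aff_in_wpoints)
  have "div_of a F G (Aff X1 Y1) > 0" using divD[of "P 1"] mem P1 by simp
  then have line: "to_ac c0 + to_ac c1 * X1 + to_ac c2 * Y1 = 0" by (rule zero[OF w1])
  \<comment> \<open>Affine coordinates, on the model \<open>b\<close>, of the point (x : 1 :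
    z).\<close>
  define x1 where "x1 = x 1 / z 1"
  define y1 where "y1 = 1 / z 1"
  obtain k where k: "k \<noteq> 0" "\<And>j. j < 3 \<Longrightarrow>
      wchange (to_ac u) (to_ac r) (to_ac s) (to_ac t) (vec3 (x 1) 1 (z 1)) j = k * \<iota> (pcoords (P 1) j)"
    using assms(14)[of 1] by auto
  \<comment> \<open>The coordinate change fixes the third coordinate, which is 1 for the affine
    point \<open>P 1\<close>; this determines the scaling factor.\<close>
  have kz: "k = z 1" using k(2)[of 2] P1 by (simp add: wchange_def)
  then have z1: "z 1 \<noteq> 0" using k(1) by simp
  have zx: "z 1 * x1 = x 1" and zy: "z 1 * y1 = 1" using z1 by (simp_all add: x1_def y1_def)
  have X1: "\<iota> X1 = to_ac u ^ 2 * x1 + to_ac r"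
  proof -
    have "z 1 * \<iota> X1 = to_ac u ^ 2 * x 1 + to_ac r * z 1"
      using k(2)[of 0] P1 kz by (simp add: wchange_def)
    also have "\<dots> = z 1 * (to_ac u ^ 2 * x1 + to_ac r)" unfolding zx[symmetric] by (simp add: algebra_simps)
    finally show ?thesis using z1 by (simp only: mult_cancel_left simp_thms)
  qed
  have Y1: "\<iota> Y1 = to_ac u ^ 3 * y1 + to_ac u ^ 2 * to_ac s * x1 + to_ac t"
  proof -
    have "z 1 * \<iota> Y1 = to_ac u ^ 3 * 1 + to_ac u ^ 2 * to_ac s * x 1 + to_ac t * z 1"
      using k(2)[of 1] P1 kz by (simp add: wchange_def)
    also have "\<dots> = z 1 * (to_ac u ^ 3 * y1 + to_ac u ^ 2 * to_ac s * x1 + to_ac t)"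
      unfolding zx[symmetric] zy[symmetric] by (simp add: algebra_simps)
    finally show ?thesis using z1 by (simp only: mult_cancel_left simp_thms)
  qed
  have tq: "field_map (\<lambda>q. to_ac (of_rat q :: q2))" by (rule field_map_comp[OF field_map_to_ac field_map_of_rat])
  \<comment> \<open>The valuation lives on the closure of the 2-adic numbers; there the rational
    coefficients of f must agree with their 2-adic images.\<close>
  have \<iota>q: "\<iota> (to_ac q) = to_ac (of_rat q)" for q
    using field_map_of_rat_unique[OF field_map_comp[OF \<iota>.field_map_axioms field_map_to_ac], of q]
      field_map_of_rat_unique[OF tq, of q] by simp
  have "map_wcoeffs \<iota> (geom a) = map_wcoeffs to_ac ?A"
    by (cases a) (simp add: geom_def \<iota>q)
  then have "weq (map_wcoeffs to_ac ?A) (\<iota> X1) (\<iota> Y1) = 0"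
    using \<iota>.weq_map[of "geom a" X1 Y1] w1 by simp
  then have wb1: "weq (map_wcoeffs to_ac b) (x 1 / z 1) (1 / z 1) = 0"
    using ch.change_ext[OF field_map_to_ac, of x1 y1] u0 unfolding X1 Y1 by (simp add: x1_def y1_def)

  have p1: "0 < v\<^sub>2 (x 1)" "0 < v\<^sub>2 (z 1)" using assms(17)[of 1] by auto
  \<comment> \<open>The distance to \<open>P 4\<close>, the origin of the coordinates x and
    z.\<close>
  have "min (v\<^sub>2 (x 1)) (v\<^sub>2 (z 1)) = ereal (2/3)"
    using assms(18)[of 1 4] assms(15,16) by simp
  note fg = formal_group_valuation[OF bZ z1 wb1 p1 this]

  \<comment> \<open>In the coordinates of \<open>b\<close> the function f becomes C (y + \<alpha> x
    + \<gamma>).\<close>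
  define C where "C = of_rat c2 * u ^ 3"
  define \<alpha> where "\<alpha> = (of_rat c1 * u ^ 2 + of_rat c2 * u ^ 2 * s) / C"
  define \<gamma> where "\<gamma> = (of_rat c0 + of_rat c1 * r + of_rat c2 * t) / C"
  have C0: "C \<noteq> 0" using c2 u0 by (simp add: C_def)
  have C\<alpha>: "C * \<alpha> = of_rat c1 * u ^ 2 + of_rat c2 * u ^ 2 * s"
    and C\<gamma>: "C * \<gamma> = of_rat c0 + of_rat c1 * r + of_rat c2 * t"
    using C0 by (simp_all add: \<alpha>_def \<gamma>_def)
  have line': "1 + to_ac \<alpha> * x 1 + to_ac \<gamma> * z 1 = 0"
  proof -
    have "to_ac (of_rat c0) + to_ac (of_rat c1) * \<iota> X1 + to_ac (of_rat c2) * \<iota> Y1 = \<iota> (to_ac c0 + to_ac c1 * X1 + to_ac c2 * Y1)"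
      by (simp add: \<iota>q)
    then have 0: "to_ac (of_rat c0) + to_ac (of_rat c1) * \<iota> X1 + to_ac (of_rat c2) * \<iota> Y1 = 0" using line by simp
    have "to_ac C * (y1 + to_ac \<alpha> * x1 + to_ac \<gamma>) = to_ac C * y1 + to_ac (C * \<alpha>) * x1 + to_ac (C * \<gamma>)"
      by (simp add: algebra_simps)
    also have "\<dots> = to_ac (of_rat c0) + to_ac (of_rat c1) * \<iota> X1 + to_ac (of_rat c2) * \<iota> Y1"
      unfolding C\<alpha> C\<gamma> X1 Y1 by (simp add: C_def algebra_simps)
    finally have "y1 + to_ac \<alpha> * x1 + to_ac \<gamma> = 0" using 0 C0 by simp
    then have "z 1 * (y1 + to_ac \<alpha> * x1 + to_ac \<gamma>) = 0" by simp
    then show ?thesis using z1 by (simp add: x1_def y1_def algebra_simps)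
  qed
  have al: "\<alpha> \<in> Z2" and g0: "\<gamma> \<noteq> 0" and ga: "norm_q2 \<gamma> = 4"
    using line_valuation[OF fg line'] by blast+

  \<comment> \<open>The twist normalises the constant term C \<gamma> of f, which has to be a square
    modulo 4.\<close>
  obtain d :: rat and m where d: "d \<noteq> 0" and m: "m \<in> Z2" "of_rat d * (C * \<gamma>) = 1 + 4 * m"
    using twist_to_1_mod_4[of "C * \<gamma>"] C0 g0 by auto
  define \<rho> where "\<rho> = 1 + 4 * m"
  have n4: "norm_q2 4 = 1/4" using norm_q2_of_rat[of 4] by (simp add: abs2_rat_4)
  have n\<rho>: "norm_q2 \<rho> = 1"
    unfolding \<rho>_def using m(1) by (subst norm_q2_add_eq) (simp_all add: norm_q2_mult n4 Z2_iff)
  then have \<rho>0: "\<rho> \<noteq> 0" by auto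
  \<comment> \<open>After the twist, w^2 = \<rho> + (\<rho> / \<gamma>) (y + \<alpha> x). Putting w
    = 1 + 2 v and dividing by 4 gives e (v^2 + v - m) = y + \<alpha> x with this unit e.\<close>
  define e where "e = 4 * \<gamma> / \<rho>"
  define be where "be = m * e"
  have e0: "e \<noteq> 0" using g0 \<rho>0 by (simp add: e_def)
  have e\<rho>: "e * \<rho> = 4 * \<gamma>" using \<rho>0 by (simp add: e_def)
  have ne: "norm_q2 e = 1" using arg_cong[OF e\<rho>, of norm_q2] by (simp add: norm_q2_mult n4 ga n\<rho>)
  have eZ: "e \<in> Z2" using ne by (simp add: Z2_iff)
  have beZ: "be \<in> Z2" unfolding be_def by (rule Z2.R_mult[OF m(1) eZ])
  have \<gamma>e: "4 * \<gamma> = e + 4 * be" using e\<rho> by (simp add: be_def \<rho>_def algebra_simps)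
  let ?Q = "quartic b e \<alpha> be"

  let ?t = "ffc_t :: q2 ffc" and ?Y = "wgeneric ?A 1"
  define \<xi> where "\<xi> = (?t - ffc_const r) / ffc_const u ^ 2"
  define \<eta> where "\<eta> = (?Y - ffc_const u ^ 2 * ffc_const s * \<xi> - ffc_const t) / ffc_const u ^ 3"
  have t\<xi>: "?t = ffc_const u ^ 2 * \<xi> + ffc_const r" using u0 by (simp add: \<xi>_def)
  have Y\<eta>: "?Y = ffc_const u ^ 3 * \<eta> + ffc_const u ^ 2 * ffc_const s * \<xi> + ffc_const t" using u0 by (simp add: \<eta>_def)
  have gen: "generic_xy b \<xi> \<eta>" by (rule ch.change_generic[OF generic_wgeneric t\<xi> Y\<eta>])

  let ?f = "ratfun ?A (Poly_Mapping.map of_rat (mconst d * F)) (Poly_Mapping.map of_rat G)"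
  define w where "w = (SOME w. w ^ 2 = ?f)"
  have "\<exists>w. w ^ 2 = ?f"
  proof -
    have "\<exists>w. poly [:- ?f, 0, 1:] w = 0" by (rule alg_closed_imp_poly_has_root) simp
    then obtain w where "poly [:- ?f, 0, 1:] w = 0" ..
    then have "w ^ 2 = ?f" by (simp add: power2_eq_square)
    then show ?thesis ..
  qed
  then have w2: "w ^ 2 = ?f" unfolding w_def by (rule someI_ex)
  have F3: "F \<in> mpolys UNIV 3" "G \<in> mpolys UNIV 3" using FG by (simp_all add: forms_def)
  have Gz: "wred a G \<noteq> (0, 0)" using nz(2) unfolding meval_wgeneric[OF F3(2)] by auto
  have f: "?f = ffc_const (of_rat d * C) * (\<eta> + ffc_const \<alpha> * \<xi> + ffc_const \<gamma>)"
  proof -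
    have "ffc_const C * (\<eta> + ffc_const \<alpha> * \<xi> + ffc_const \<gamma>) = ffc_const C * \<eta> + ffc_const (C * \<alpha>) * \<xi> + ffc_const (C * \<gamma>)"
      by (simp add: algebra_simps)
    also have "\<dots> = ffc_const (of_rat c0) + ffc_const (of_rat c1) * ?t + ffc_const (of_rat c2) * ?Y"
      unfolding C\<alpha> C\<gamma> by (subst t\<xi>, subst Y\<eta>) (simp add: C_def algebra_simps)
    finally show ?thesis unfolding ratfun_line[OF F3 Gz red] by (simp add: mult.assoc)
  qed
  have two: "(2 :: q2 ffc) \<noteq> 0" using c.h_eq_0_iff[of 2] by simp
  define v where "v = (w - 1) / 2"
  have wv: "w = 1 + 2 * v" using two by (simp add: v_def)
  have y: "\<eta> = ffc_const e * (v ^ 2 + v) - ffc_const \<alpha> * \<xi> - ffc_const be"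
  proof -
    have dC: "of_rat d * C * \<gamma> = \<rho>" using m(2) by (simp add: \<rho>_def mult.assoc)
    have "e * (of_rat d * C) * \<gamma> = 4 * \<gamma>" using dC e\<rho> by (simp add: mult.assoc)
    then have edC: "e * (of_rat d * C) = 4" using g0 by simp
    have "ffc_const e * (1 + 4 * (v ^ 2 + v)) = ffc_const e * w ^ 2"
      unfolding wv by (simp add: power2_eq_square algebra_simps)
    also have "\<dots> = ffc_const (e * (of_rat d * C)) * (\<eta> + ffc_const \<alpha> * \<xi> + ffc_const \<gamma>)"
      unfolding w2 f by (simp add: mult.assoc)
    also have "\<dots> = 4 * \<eta> + 4 * ffc_const \<alpha> * \<xi> + ffc_const (4 * \<gamma>)"
      unfolding edC by (simp add: algebra_simps)
    also have "\<dots> = 4 * \<eta> + 4 * ffc_const \<alpha> * \<xi> + ffc_const e + 4 * ffc_const be"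
      unfolding \<gamma>e by simp
    finally have "4 * (ffc_const e * (v ^ 2 + v)) = 4 * (\<eta> + ffc_const \<alpha> * \<xi> + ffc_const be)"
      by (simp add: algebra_simps)
    moreover have "(4 :: q2 ffc) \<noteq> 0" using c.h_eq_0_iff[of 4] by simp
    ultimately have "ffc_const e * (v ^ 2 + v) = \<eta> + ffc_const \<alpha> * \<xi> + ffc_const be" by (simp only: mult_cancel_left simp_thms)
    then show ?thesis by simp
  qed

  have Qforms: "?Q \<in> forms Z2 3 4" by (rule quartic_forms[OF Z2.coeff_ring_axioms bZ eZ al beZ])
  have smooth0: "smooth_curve_at 2 {?Q} to_ac p" if p: "\<exists>i\<le>2. p i \<noteq> 0" "meval to_ac p ?Q = 0" for p :: "nat \<Rightarrow> q2 alg_closure"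
  proof (rule smooth_curve_at_plane[OF Qforms])
    show "meval to_ac p (1 :: q2 mpoly) \<noteq> 0" by simp
    show "\<exists>j\<le>2. meval to_ac p (mderiv j ?Q) \<noteq> 0"
    proof (rule quartic_smooth[OF coeff_hom_Z2_field_map[OF field_map_to_ac] bZ eZ al beZ _ _ _ p])
      show "to_ac e \<noteq> 0" using e0 by simp
    next
      fix x y assume wxy: "weq (map_wcoeffs to_ac b) x y = 0"
      have "poly (pderiv (wdisc (map_wcoeffs to_ac ?A))) x \<noteq> 0" if "poly (wdisc (map_wcoeffs to_ac ?A)) x = 0" for x
        using wdisc_separable[OF smooth field_map_comp[OF field_map_to_ac field_map_of_rat], of x] that
        by (simp add: map_wcoeffs_comp)
      then show "weq_x (map_wcoeffs to_ac b) x y \<noteq> 0 \<or> weq_y (map_wcoeffs to_ac b) x y \<noteq> 0"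
        by (rule ch.change_smooth[OF field_map_to_ac _ wxy])
    next
      fix x v y assume v: "2 * v + 1 = 0" and yv: "y = to_ac e * (v ^ 2 + v) - to_ac \<alpha> * x - to_ac be"
        and wxy: "weq (map_wcoeffs to_ac b) x y = 0"
      \<comment> \<open>Where 2 v + 1 = 0, v^2 + v is -1/4, and e + 4 m e = 4 \<gamma> puts the
        point on the line y + \<alpha> x + \<gamma> = 0. The partial derivative in x could then
        vanish only by tangency.\<close>
      have "4 * (v ^ 2 + v) = (2 * v + 1) ^ 2 - 1" by (simp add: power2_eq_square algebra_simps)
      then have v4: "4 * (v ^ 2 + v) = - 1" using v by simp
      have "4 * y = to_ac e * (4 * (v ^ 2 + v)) - 4 * (to_ac \<alpha> * x) - 4 * to_ac be"
        unfolding yv by (simp add: algebra_simps)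
      also have "\<dots> = - (4 * (to_ac \<alpha> * x)) - to_ac (e + 4 * be)" unfolding v4 by simp
      also have "\<dots> = 4 * (- (to_ac \<alpha> * x + to_ac \<gamma>))" unfolding \<gamma>e[symmetric] by simp
      finally have "y = - (to_ac \<alpha> * x + to_ac \<gamma>)" by (simp only: mult_cancel_left) simp
      then show "weq_x (map_wcoeffs to_ac b) x y \<noteq> to_ac \<alpha> * weq_y (map_wcoeffs to_ac b) x y"
        using line_transversal[OF bZ al ga _ wxy] by blast
    qed
  qed
  let ?h = "\<lambda>c. to_ac (reduce2 c)"
  have smooth2: "smooth_curve_at 2 {?Q} ?h p" if p: "\<exists>i\<le>2. p i \<noteq> 0" "meval ?h p ?Q = 0" for p :: "nat \<Rightarrow> bit alg_closure"
  proof (rule smooth_curve_at_plane[OF Qforms])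
    interpret h: coeff_hom Z2 ?h by (rule coeff_hom_reduce2)
    show "meval ?h p (1 :: q2 mpoly) \<noteq> 0" by simp
    show "\<exists>j\<le>2. meval ?h p (mderiv j ?Q) \<noteq> 0"
    proof (rule quartic_smooth[OF coeff_hom_reduce2 bZ eZ al beZ _ _ _ p])
      show "to_ac (reduce2 e) \<noteq> 0" using ne by (simp add: reduce2_iff)
    next
      fix x y assume "weq (map_wcoeffs ?h b) x y = 0"
      then show "weq_x (map_wcoeffs ?h b) x y \<noteq> 0 \<or> weq_y (map_wcoeffs ?h b) x y \<noteq> 0"
        using smooth_weierstrass_affine[OF bsm, of x y] by (simp add: map_wcoeffs_comp)
    next
      fix x v y assume v: "2 * v + 1 = (0 :: bit alg_closure)"
      \<comment> \<open>In characteristic 2 the equation 2 v + 1 = 0 reads 1 = 0: no affine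
        ramification modulo 2.\<close>
      have "(2 :: bit alg_closure) = to_ac 2" by (rule to_ac_numeral[symmetric])
      also have "\<dots> = 0" by (simp only: to_ac_eq_0_iff) simp
      finally show "weq_x (map_wcoeffs ?h b) x y \<noteq> to_ac (reduce2 \<alpha>) * weq_y (map_wcoeffs ?h b) x y"
        using v by simp
    qed
  qed
  have model2: "smooth_proj_curve_Z2 2 {?Q}"
    unfolding smooth_proj_curve_Z2_def using Qforms smooth0 smooth2 by auto

  let ?p = "vec3 \<xi> v 1"
  let ?g = "\<lambda>i. if i < 2 then wgeneric ?A i else if i = 2 then w else 1"
  have L: "double_cover_field ?A (Poly_Mapping.map of_rat (mconst d * F)) (Poly_Mapping.map of_rat G) = fun_field 4 ?g"
    unfolding double_cover_field_def w_def ..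
  have "fun_field 3 ?p = fun_field 4 ?g"
  proof (rule antisym)
    interpret S: const_field "fun_field 4 ?g" by (rule fun_field_const_field)
    have in4: "?g i \<in> fun_field 4 ?g" if "i < 4" for i by (rule fun_field_coord[OF that, of 3]) simp_all
    have tS: "?t \<in> fun_field 4 ?g" and YS: "?Y \<in> fun_field 4 ?g" and wS: "w \<in> fun_field 4 ?g"
      using in4[of 0] in4[of 1] in4[of 2] by (simp_all add: wgeneric_simps)
    have "\<xi> \<in> fun_field 4 ?g"
      unfolding \<xi>_def by (intro S.S_divide S.S_diff S.S_power S.S_const tS)
    moreover have "v \<in> fun_field 4 ?g"
      unfolding v_def by (intro S.S_divide S.S_diff S.S_numeral S.S_1 wS)
    ultimately have "?p i \<in> fun_field 4 ?g" if "i < 3" for i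
      using S.S_1 by (simp add: vec3_def)
    then show "fun_field 3 ?p \<subseteq> fun_field 4 ?g" by (rule S.fun_field_subset)
  next
    interpret S: const_field "fun_field 3 ?p" by (rule fun_field_const_field)
    have in3: "?p i \<in> fun_field 3 ?p" if "i < 3" for i by (rule fun_field_coord[OF that, of 2]) simp_all
    have xS: "\<xi> \<in> fun_field 3 ?p" and vS: "v \<in> fun_field 3 ?p"
      using in3[of 0] in3[of 1] by simp_all
    \<comment> \<open>The quartic coordinates omit y, which is recovered as a polynomial in x and
      v.\<close>
    have yS: "\<eta> \<in> fun_field 3 ?p"
      unfolding y by (intro S.S_diff S.S_mult S.S_add S.S_power S.S_const xS vS)
    have "?t \<in> fun_field 3 ?p"
      unfolding t\<xi> by (intro S.S_add S.S_mult S.S_power S.S_const xS)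
    moreover have "?Y \<in> fun_field 3 ?p"
      unfolding Y\<eta> by (intro S.S_add S.S_mult S.S_power S.S_const xS yS)
    moreover have "w \<in> fun_field 3 ?p"
      unfolding wv by (intro S.S_add S.S_mult S.S_numeral S.S_1 vS)
    moreover have "i = 0 \<or> i = 1 \<or> i \<ge> 2" for i :: nat by linarith
    ultimately have "?g i \<in> fun_field 3 ?p" for i
      using S.S_1 by (cases "i < 2") (auto simp: wgeneric_simps less_2_cases_iff)
    then show "fun_field 4 ?g \<subseteq> fun_field 3 ?p" by (intro S.fun_field_subset)
  qed
  then have "fun_field (2 + 1) ?p = fun_field 4 ?g" by (simp only: numeral_plus_one add_num_simps)
  then have "good_reduction (fun_field 4 ?g)"
    unfolding good_reduction_def using model2 quartic_generic_point[OF gen e0 y] by blast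
  then have "double_cover_good_reduction a (mconst d * F) G"
    unfolding double_cover_good_reduction_def L .
  then show ?thesis using d by blast
qed

end
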